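(* Let $\{J^kg\}_{k\in\mathbb N_0}$ be a block diagonal Carleson frame with $\sigma_p(J)=\{z_i\}_{i\in\mathbb N_0}\subset\mathbb D$ a Carleson sequence. Assume that $\{|z_i|\}_{i\in\mathbb N_0}$ is also a Carleson sequence, and let $r>0$. If $z_i\ne0$ for all $i\in\mathbb N_0$, then $\{J^{rk}g\}_{k\in\mathbb N_0}$ is a frame for $\ell^2(\mathbb N_0)$. Otherwise, if $z_0=0$ and $K=\left\lfloor\frac{n_0-1}{r}\right\rfloor+1$, then $\{g,Jg,\dots,J^{n_0-1}g\}\cup\{J^{rk}g\}_{k=K}^\infty$ is a frame for $\ell^2(\mathbb N_0)$.
   Context: $\mathbb N_0=\{0,1,2,\dots\}$ and $\mathbb D$ is the open unit disc. Let $(n_i)_{i\ge0}$ be positive integers with $\sup_i n_i<\infty$ and $(z_i)_{i\ge0}\subset\mathbb D$. For each $i$, $V_i\cong\mathbb C^{n_i}$ has orthonormal basis $\{\delta_{i,j}\}_{j=0}^{n_i-1}$, and $\ell^2(\mathbb N_0)$ is identified with the orthogonal direct sum $\bigoplus_iV_i$. $J_{n_i}(z_i)$ is the operator on $V_i$ with $J_{n_i}(z_i)\delta_{i,j}=z_i\delta_{i,j}+(1-|z_i|^2)\delta_{i,j+1}$ for $0\le j<n_i-1$ and $J_{n_i}(z_i)\delta_{i,n_i-1}=z_i\delta_{i,n_i-1}$. A block diagonal Carleson frame is a frame for $\ell^2(\mathbb N_0)$ of the form $\{J^kg\}_{k=0}^\infty$, where $J=\bigoplus_iJ_{n_i}(z_i)$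 and $g\in\ell^2(\mathbb N_0)$; $\sigma_p(J)$ denotes the point spectrum. A sequence $\{z_i\}_{i\ge0}\subset\mathbb D$ is a Carleson sequence if $\inf_k\prod_{j\ne k}\left|\frac{z_j-z_k}{1-\overline{z_j}z_k}\right|>0$. A sequence $\{f_k\}$ in a Hilbert space $H$ is a frame for $H$ if there are $B\ge A>0$ with $A\|h\|^2\le\sum_k|\langle h,f_k\rangle|^2\le B\|h\|^2$ for all $h\in H$. Noninteger powers: $J^\lambda=\bigoplus_iJ_{n_i}^\lambda(z_i)$, where $J_n^\lambda(z)=\sum_{j=0}^{n-1}\binom{\lambda}{j}z^{\lambda-j}(1-|z|^2)^jM_n^j$ for $z\neq 0$ and $\lambda\in\mathbb C$, with $M_n$ the $n\times n$ matrix having ones on the subdiagonal and zeros elsewhere, $z^\lambda$ the principal branch, $\binom{\lambda}{j}=\lambda(\lambda-1)\cdots(\lambda-j+1)/j!$, $\binom\lambda0=1$; for $z=0$ the same formula is used when $\operatorname{Re}\lambda>n-1$ (giving $J_n^\lambda(0)=0$), and $J_n^\lambda(0)$ is the ordinary power for $\lambda\in\mathbb N_0$. *)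

theory Defs
  imports "HOL-Analysis.Analysis"
begin

definition ell2 :: "(nat \<Rightarrow> complex) set" where
  "ell2 = {f. summable (\<lambda>m. (cmod (f m))\<^sup>2)}"

definition ell2_inner :: "(nat \<Rightarrow> complex) \<Rightarrow> (nat \<Rightarrow> complex) \<Rightarrow> complex" where
  "ell2_inner f g = (\<Sum>m. f m * cnj (g m))"

definition ell2_norm :: "(nat \<Rightarrow> complex) \<Rightarrow> real" where
  "ell2_norm f = sqrt (\<Sum>m. (cmod (f m))\<^sup>2)"

text \<open>Summability is demanded explicitly because a divergent \<^term>\<open>suminf\<close> is an
  unspecified real number.\<close>

definition is_frame :: "(nat \<Rightarrow> nat \<Rightarrow> complex) \<Rightarrow> bool" where
  "is_frame f \<longleftrightarrow> (\<forall>k. f k \<in> ell2) \<and>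
     (\<exists>A B. 0 < A \<and> A \<le> B \<and>
       (\<forall>h\<in>ell2. summable (\<lambda>k. (cmod (ell2_inner h (f k)))\<^sup>2) \<and>
          A * (ell2_norm h)\<^sup>2 \<le> (\<Sum>k. (cmod (ell2_inner h (f k)))\<^sup>2) \<and>
          (\<Sum>k. (cmod (ell2_inner h (f k)))\<^sup>2) \<le> B * (ell2_norm h)\<^sup>2))"

definition point_spectrum :: "((nat \<Rightarrow> complex) \<Rightarrow> nat \<Rightarrow> complex) \<Rightarrow> complex set" where
  "point_spectrum T = {\<mu>. \<exists>f\<in>ell2. f \<noteq> (\<lambda>m. 0) \<and> T f = (\<lambda>m. \<mu> * f m)}"

text \<open>The infinite product is the limit of its partial products. It always exists, the factors
  lying in [0,1). (The library's \<^const>\<open>prodinf\<close> is unspecified when the partial products tend to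
  0 without a zero factor.)\<close>

definition carleson_sequence :: "(nat \<Rightarrow> complex) \<Rightarrow> bool" where
  "carleson_sequence z \<longleftrightarrow> (\<forall>j. z j \<in> ball 0 1) \<and>
     0 < (INF k. lim (\<lambda>N. \<Prod>j\<in>{..<N} - {k}. cmod ((z j - z k) / (1 - cnj (z j) * z k))))"

text \<open>A vector of the \<open>n\<close>-dimensional space is a function on \<^typ>\<open>nat\<close> of which only the values
  at \<open>0, \<dots>, n - 1\<close> matter: these are the coordinates in the orthonormal basis.\<close>

definition subdiag :: "nat \<Rightarrow> (nat \<Rightarrow> complex) \<Rightarrow> nat \<Rightarrow> complex" where
  "subdiag n v = (\<lambda>a. if 0 < a \<and> a < n then v (a - 1) else 0)"

definition jordan_block :: "nat \<Rightarrow> complex \<Rightarrow> (nat \<Rightarrow> complex) \<Rightarrow> nat \<Rightarrow> complex" where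
  "jordan_block n z v = (\<lambda>a. z * v a + of_real (1 - (cmod z)\<^sup>2) * subdiag n v a)"

text \<open>For \<open>z = 0\<close> and \<open>s\<close> not a natural number the power is only meaningful if
  \<open>Re s > n - 1\<close>; the formula then yields the zero operator, as \<open>0 powr w = 0\<close>.\<close>

definition jordan_block_powr ::
    "nat \<Rightarrow> complex \<Rightarrow> complex \<Rightarrow> (nat \<Rightarrow> complex) \<Rightarrow> nat \<Rightarrow> complex" where
  "jordan_block_powr n z s v =
     (if z = 0 \<and> s \<in> \<nat> then (jordan_block n z ^^ nat \<lfloor>Re s\<rfloor>) v
      else (\<lambda>a. \<Sum>j<n. (s gchoose j) * z powr (s - of_nat j) * of_real (1 - (cmod z)\<^sup>2) ^ j
                          * (subdiag n ^^ j) v a))"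

text \<open>The identification of \<^const>\<open>ell2\<close> with the direct sum of the \<open>n i\<close>-dimensional spaces is the
  consecutive one: block \<open>i\<close> occupies the positions \<open>offset n i, \<dots>, offset n i + n i - 1\<close>.\<close>

definition offset :: "(nat \<Rightarrow> nat) \<Rightarrow> nat \<Rightarrow> nat" where
  "offset n i = (\<Sum>l<i. n l)"

definition block_of :: "(nat \<Rightarrow> nat) \<Rightarrow> nat \<Rightarrow> nat" where
  "block_of n m = (LEAST i. m < offset n (Suc i))"

definition direct_sum ::
    "(nat \<Rightarrow> nat) \<Rightarrow> (nat \<Rightarrow> (nat \<Rightarrow> complex) \<Rightarrow> nat \<Rightarrow> complex)
      \<Rightarrow> (nat \<Rightarrow> complex) \<Rightarrow> nat \<Rightarrow> complex" where
  "direct_sum n T f = (\<lambda>m. let i = block_of n m in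
     T i (\<lambda>j. if j < n i then f (offset n i + j) else 0) (m - offset n i))"

definition block_op :: "(nat \<Rightarrow> nat) \<Rightarrow> (nat \<Rightarrow> complex) \<Rightarrow> (nat \<Rightarrow> complex) \<Rightarrow> nat \<Rightarrow> complex" where
  "block_op n z = direct_sum n (\<lambda>i. jordan_block (n i) (z i))"

definition block_op_powr ::
    "(nat \<Rightarrow> nat) \<Rightarrow> (nat \<Rightarrow> complex) \<Rightarrow> complex \<Rightarrow> (nat \<Rightarrow> complex) \<Rightarrow> nat \<Rightarrow> complex" where
  "block_op_powr n z s = direct_sum n (\<lambda>i. jordan_block_powr (n i) (z i) s)"

definition basis_vec :: "(nat \<Rightarrow> nat) \<Rightarrow> nat \<Rightarrow> nat \<Rightarrow> nat \<Rightarrow> complex" where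
  "basis_vec n i j = (\<lambda>m. if m = offset n i + j then 1 else 0)"

definition block_diagonal_carleson_frame ::
    "(nat \<Rightarrow> nat) \<Rightarrow> (nat \<Rightarrow> complex) \<Rightarrow> (nat \<Rightarrow> complex) \<Rightarrow> bool" where
  "block_diagonal_carleson_frame n z g \<longleftrightarrow>
     (\<forall>i. 0 < n i) \<and> bdd_above (range n) \<and> (\<forall>i. z i \<in> ball 0 1) \<and>
     g \<in> ell2 \<and> is_frame (\<lambda>k. (block_op n z ^^ k) g)"

lemma offset_Suc: "offset n (Suc i) = offset n i + n i"
  by (simp add: offset_def)

lemma offset_mono: "i \<le> j \<Longrightarrow> offset n i \<le> offset n j"
  unfolding offset_def by (rule sum_mono2) auto

lemma block_of_offset:
  assumes "j < n i"
  shows "block_of n (offset n i + j) = i"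
  unfolding block_of_def
proof (rule Least_equality)
  show "offset n i + j < offset n (Suc i)"
    using assms by (simp add: offset_Suc)
next
  fix l assume "offset n i + j < offset n (Suc l)"
  then show "i \<le> l"
    using offset_mono[of "Suc l" i n] by (meson le_add1 le_trans not_less not_less_eq_eq)
qed

lemma position_cases:
  assumes "\<And>i. 0 < n i"
  obtains i j where "j < n i" "m = offset n i + j"
proof -
  have "\<exists>i j. j < n i \<and> m = offset n i + j"
  proof (induction m)
    case 0
    then show ?case using assms[of 0] by (intro exI[of _ 0]) (simp add: offset_def)
  next
    case (Suc m)
    then obtain i j where ij: "j < n i" "m = offset n i + j" by blast
    show ?case
    proof (cases "Suc j < n i")
      case True
      then show ?thesis using ij by (metis add_Suc_right)
    next
      case False
      then have "Suc m = offset n (Suc i) + 0" using ij by (simp add: offset_Suc)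
      then show ?thesis using assms by blast
    qed
  qed
  then show thesis using that by blast
qed

lemma direct_sum_at:
  assumes "j < n i"
  shows "direct_sum n T f (offset n i + j) = T i (\<lambda>j. if j < n i then f (offset n i + j) else 0) j"
  by (simp add: direct_sum_def block_of_offset[where n = n, OF assms])

lemma offset_inj:
  assumes "j < n i" "j' < n i'"
  shows "offset n i + j = offset n i' + j' \<longleftrightarrow> i = i' \<and> j = j'"
  using block_of_offset[where n = n, OF assms(1)] block_of_offset[where n = n, OF assms(2)] by auto

lemma block_op_basis_vec:
  assumes n: "\<And>i. 0 < n i" and j: "j < n i"
  shows "block_op n z (basis_vec n i j) = (\<lambda>m. z i * basis_vec n i j m +
           (if Suc j < n i then of_real (1 - (cmod (z i))\<^sup>2) * basis_vec n i (Suc j) m else 0))"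
proof
  fix m
  obtain i' j' where m: "j' < n i'" "m = offset n i' + j'"
    using position_cases[of n m] n by blast
  have 1: "basis_vec n i l (offset n i' + l') = (if i' = i \<and> l' = l then 1 else 0)"
    if "l < n i" "l' < n i'" for l l'
    using that by (simp add: basis_vec_def offset_inj)
  have "(\<lambda>l. if l < n i' then basis_vec n i j (offset n i' + l) else 0) =
          (\<lambda>l. if i' = i \<and> l = j then 1 else 0)"
    using 1[OF j] j by (intro ext) auto
  then have "block_op n z (basis_vec n i j) m =
          jordan_block (n i') (z i') (\<lambda>l. if i' = i \<and> l = j then 1 else 0) j'"
    unfolding m(2) block_op_def direct_sum_at[where n = n, OF m(1)] by simp
  then show "block_op n z (basis_vec n i j) m = z i * basis_vec n i j m +
           (if Suc j < n i then of_real (1 - (cmod (z i))\<^sup>2) * basis_vec n i (Suc j) m else 0)"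
    using m(1) j 1[OF j m(1)] 1[of "Suc j" j'] unfolding m(2)
    by (cases j') (auto simp: jordan_block_def subdiag_def)
qed

end

theory Submission
  imports Defs
begin

text \<open>Put \<open>w\<^sub>i = z\<^sub>i\<^sup>r\<close> and \<open>\<epsilon>(w) = 1 - |w|\<^sup>2\<close>. Since \<open>z\<^sub>i powr (r k) = w\<^sub>i ^ k\<close> and a binomial coefficient of \<open>r k\<close> is
a polynomial in \<open>k\<close>, the conjugated frame coefficient of a vector \<open>h\<close> is, as a function of \<open>k\<close>,

  \<open>\<Sum>\<^sub>i \<Sum>\<^sub>m d\<^sub>i\<^sub>m sqrt (\<epsilon>(w\<^sub>i)) (k choose m) w\<^sub>i ^ (k - m) \<epsilon>(w\<^sub>i) ^ m\<close>.

The passage from block \<open>i\<close> of \<open>h\<close> to \<open>(d\<^sub>i\<^sub>m)\<^sub>m\<close> is a product of triangular matrices of bounded size whose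
entries are bounded above and whose diagonals are bounded below, uniformly in \<open>i\<close>
(\<open>block_orbit_coefficients\<close>). This uses that the generator satisfies \<open>|g\<^sub>i\<^sub>0| \<ge> \<gamma> sqrt (\<epsilon>(z\<^sub>i))\<close> and
\<open>|g\<^sub>i\<^sub>j| \<le> G sqrt (\<epsilon>(z\<^sub>i))\<close>, which the given frame reveals when it is tested on basis vectors
(\<open>generator_bounds\<close>). So it remains to see that the sequences attached to the \<open>w\<^sub>i\<close> form a Riesz system.

Read as power series, these sequences are \<open>(b + cnj w)^m k\<^sub>w\<close> with \<open>b\<close> the Blaschke factor of \<open>w\<close> and \<open>k\<^sub>w\<close> the
normalised kernel. Multiplication by a Blaschke factor is an isometry of square-summable sequences
(\<open>ip_blaschke\<close>), and the products of all Blaschke factors but those of one block yield a dual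
system. A block with small \<open>\<epsilon>\<close> is long and flat: its sum norm is of order \<open>\<epsilon>\<close> to the power \<open>-1/2\<close> and its sup norm
of order \<open>\<epsilon>\<close> to the power \<open>1/2\<close>. Pairing sum norm with sup norm bounds all Gram
entries, of the system and of its dual, by a constant times \<open>sqrt (min / max)\<close> of the two values of \<open>\<epsilon>\<close>. If the
row sums of this matrix are bounded, the Schur test gives both Bessel bounds; the one for the dual
system, with the lower bound on the Blaschke products, is the lower Riesz bound (\<open>blocks_lower\<close>).

The hypothesis on the moduli makes the row sums finite: a Carleson sequence on a radius is
lacunary, so that even the sum of square roots converges (\<open>sum_sqrt_le\<close>, \<open>sum_ratio_le\<close>). Taking
moduli to the power \<open>r\<close> changes \<open>\<epsilon>\<close> and the pseudohyperbolic distances only by bounded factors,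
whence the same conclusions for the \<open>w\<^sub>i\<close>, whatever their arguments (\<open>carleson_radial_powr\<close>).

If \<open>z\<^sub>0 = 0\<close>, the powers with exponent \<open>r k\<close>, \<open>k \<ge> K\<close>, annihilate block 0. By the above, with exponents
\<open>r k + r K\<close>, the corresponding vectors control the other blocks; the first \<open>n\<^sub>0\<close> vectors of the
original frame control block 0.\<close>

section \<open>Power series with absolutely summable coefficients\<close>

text \<open>All sequences in the finite-dimensional estimates have absolutely summable coefficients. This
class is an algebra that is stable under multiplication by Blaschke factors, and it has the
continuous embeddings into bounded and square-summable sequences that the argument needs.\<close>

definition wiener :: "complex fps \<Rightarrow> bool" where
  "wiener f \<longleftrightarrow> summable (\<lambda>k. cmod (fps_nth f k))"

definition l1_norm :: "complex fps \<Rightarrow> real" where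
  "l1_norm f = (\<Sum>k. cmod (fps_nth f k))"

definition ip :: "complex fps \<Rightarrow> complex fps \<Rightarrow> complex" where
  "ip f g = (\<Sum>k. fps_nth f k * cnj (fps_nth g k))"

definition sq_norm :: "complex fps \<Rightarrow> real" where
  "sq_norm f = (\<Sum>k. (cmod (fps_nth f k))\<^sup>2)"

lemma wiener_bound: "wiener f \<Longrightarrow> cmod (fps_nth f k) \<le> l1_norm f"
  unfolding wiener_def l1_norm_def
  using sum_le_suminf[of "\<lambda>k. cmod (fps_nth f k)" "{k}"] by simp

lemma l1_norm_nonneg: "wiener f \<Longrightarrow> 0 \<le> l1_norm f"
  using wiener_bound[of f 0] norm_ge_zero[of "fps_nth f 0"] by linarith

lemma wiener_mult:
  assumes "wiener f" "wiener g"
  shows "wiener (f * g)" and "l1_norm (f * g) \<le> l1_norm f * l1_norm g"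
proof -
  let ?a = "\<lambda>k. cmod (fps_nth f k)" and ?b = "\<lambda>k. cmod (fps_nth g k)"
  have s: "summable (\<lambda>k. \<Sum>i\<le>k. ?a i * ?b (k - i))"
    using assms unfolding wiener_def by (intro summable_Cauchy_product) auto
  have le: "cmod (fps_nth (f * g) k) \<le> (\<Sum>i\<le>k. ?a i * ?b (k - i))" for k
    unfolding fps_mult_nth atLeast0AtMost
    by (rule order.trans[OF norm_sum]) (simp add: norm_mult)
  show w: "wiener (f * g)" unfolding wiener_def
    by (rule summable_comparison_test'[OF s]) (simp add: le)
  have "l1_norm (f * g) \<le> (\<Sum>k. \<Sum>i\<le>k. ?a i * ?b (k - i))"
    unfolding l1_norm_def by (rule suminf_le[OF le _ s]) (use w in \<open>simp add: wiener_def\<close>)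
  also have "\<dots> = l1_norm f * l1_norm g"
    unfolding l1_norm_def using assms unfolding wiener_def
    by (intro Cauchy_product[symmetric]) auto
  finally show "l1_norm (f * g) \<le> l1_norm f * l1_norm g" .
qed

lemma sup_mult_le:
  assumes "wiener f" "\<And>k. cmod (fps_nth g k) \<le> C"
  shows "cmod (fps_nth (f * g) k) \<le> l1_norm f * C"
proof -
  have C: "0 \<le> C" using assms(2)[of 0] norm_ge_zero order.trans by blast
  have "cmod (fps_nth (f * g) k) \<le> (\<Sum>i\<in>{0..k}. cmod (fps_nth f i) * C)"
    unfolding fps_mult_nth
    by (rule order.trans[OF norm_sum], rule sum_mono)
       (simp add: norm_mult assms(2) mult_left_mono)
  also have "\<dots> = (\<Sum>i\<in>{0..k}. cmod (fps_nth f i)) * C" by (simp add: sum_distrib_right)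
  also have "\<dots> \<le> l1_norm f * C"
    unfolding l1_norm_def using assms(1) C unfolding wiener_def
    by (intro mult_right_mono sum_le_suminf) auto
  finally show ?thesis .
qed

lemma wiener_add: "wiener f \<Longrightarrow> wiener g \<Longrightarrow> wiener (f + g)"
  unfolding wiener_def fps_add_nth
  by (rule summable_comparison_test'[where g="\<lambda>k. cmod (fps_nth f k) + cmod (fps_nth g k)"])
     (auto intro: summable_add norm_triangle_ineq)

lemma wiener_const: "wiener (fps_const c)" "l1_norm (fps_const c) = cmod c"
proof -
  have "(\<lambda>k. cmod (fps_nth (fps_const c) k)) sums (\<Sum>k\<in>{0}. cmod (fps_nth (fps_const c) k))"
    by (rule sums_finite) auto
  then show "wiener (fps_const c)" "l1_norm (fps_const c) = cmod c"
    by (auto simp: wiener_def l1_norm_def sums_iff)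
qed

lemma wiener_0: "wiener 0" and wiener_1: "wiener 1" and l1_norm_1: "l1_norm 1 = 1"
  using wiener_const[of 0] wiener_const[of 1] by simp_all

lemma wiener_X: "wiener fps_X" "l1_norm fps_X = 1"
proof -
  have "(\<lambda>k. cmod (fps_nth fps_X k)) sums (\<Sum>k\<in>{1}. cmod (fps_nth fps_X k))"
    by (rule sums_finite) auto
  then show "wiener fps_X" "l1_norm fps_X = 1"
    by (auto simp: wiener_def l1_norm_def sums_iff)
qed

lemma wiener_scale: "wiener f \<Longrightarrow> wiener (fps_const c * f)"
  by (intro wiener_mult wiener_const)

lemma wiener_diff: "wiener f \<Longrightarrow> wiener g \<Longrightarrow> wiener (f - g)"
  using wiener_add[of f "fps_const (-1) * g"] wiener_scale[of g "-1"]
  by (simp flip: fps_const_neg)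

lemma wiener_sum: "(\<And>a. a \<in> A \<Longrightarrow> wiener (f a)) \<Longrightarrow> wiener (\<Sum>a\<in>A. f a)"
  by (induction A rule: infinite_finite_induct) (auto intro: wiener_add wiener_0)

lemma wiener_prod: "(\<And>a. a \<in> A \<Longrightarrow> wiener (f a)) \<Longrightarrow> wiener (\<Prod>a\<in>A. f a)"
  by (induction A rule: infinite_finite_induct) (auto intro: wiener_mult wiener_1)

lemma wiener_power: "wiener f \<Longrightarrow> wiener (f ^ m)"
  by (induction m) (auto intro: wiener_mult wiener_1)

lemma l1_norm_power: "wiener f \<Longrightarrow> l1_norm f \<le> c \<Longrightarrow> l1_norm (f ^ m) \<le> c ^ m"
proof (induction m)
  case 0
  then show ?case by (simp add: l1_norm_1)
next
  case (Suc m)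
  have "l1_norm (f ^ Suc m) \<le> l1_norm f * l1_norm (f ^ m)"
    using wiener_mult[of f "f ^ m"] Suc.prems by (simp add: wiener_power)
  also have "\<dots> \<le> c * c ^ m"
    using Suc l1_norm_nonneg[of f] l1_norm_nonneg[of "f ^ m"]
    by (intro mult_mono) (auto simp: wiener_power)
  finally show ?case by simp
qed

lemma ip_summable:
  assumes "wiener f" "wiener g"
  shows "summable (\<lambda>k. cmod (fps_nth f k) * cmod (fps_nth g k))"
    and "summable (\<lambda>k. fps_nth f k * cnj (fps_nth g k))"
proof -
  show *: "summable (\<lambda>k. cmod (fps_nth f k) * cmod (fps_nth g k))"
    by (rule summable_comparison_test'[OF summable_mult2[of _ "l1_norm g"]])
       (use assms in \<open>auto simp: wiener_def intro!: mult_left_mono wiener_bound\<close>)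
  show "summable (\<lambda>k. fps_nth f k * cnj (fps_nth g k))"
    by (rule summable_norm_cancel) (use * in \<open>simp add: norm_mult\<close>)
qed

lemma sq_summable: "wiener f \<Longrightarrow> summable (\<lambda>k. (cmod (fps_nth f k))\<^sup>2)"
  using ip_summable(1)[of f f] by (simp add: power2_eq_square)



lemma sq_norm_nonneg: "wiener f \<Longrightarrow> 0 \<le> sq_norm f"
  unfolding sq_norm_def by (intro suminf_nonneg sq_summable) auto

lemma ip_self: "wiener f \<Longrightarrow> ip f f = of_real (sq_norm f)"
  unfolding ip_def sq_norm_def
  by (simp add: suminf_of_real[OF sq_summable] complex_norm_square[symmetric])

lemma ip_cnj: "wiener f \<Longrightarrow> wiener g \<Longrightarrow> cnj (ip f g) = ip g f"
  unfolding ip_def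
  using bounded_linear.suminf[OF bounded_linear_cnj ip_summable(2)[of f g]]
  by (simp add: mult.commute)

lemma ip_add_left: "wiener f \<Longrightarrow> wiener g \<Longrightarrow> wiener h \<Longrightarrow> ip (f + g) h = ip f h + ip g h"
  unfolding ip_def
  by (subst suminf_add[OF ip_summable(2) ip_summable(2)]) (auto simp: algebra_simps)

lemma ip_scale_left: "wiener f \<Longrightarrow> wiener g \<Longrightarrow> ip (fps_const c * f) g = c * ip f g"
  unfolding ip_def
  by (subst suminf_mult[OF ip_summable(2), symmetric]) (auto simp: algebra_simps)

lemma ip_0_left: "ip 0 g = 0"
  by (simp add: ip_def)

lemma ip_sum_left:
  assumes "wiener g" "\<And>a. a \<in> A \<Longrightarrow> wiener (f a)"
  shows "ip (\<Sum>a\<in>A. fps_const (c a) * f a) g = (\<Sum>a\<in>A. c a * ip (f a) g)"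
  using assms(2)
  by (induction A rule: infinite_finite_induct)
     (auto simp: ip_0_left ip_add_left ip_scale_left wiener_sum wiener_scale assms(1))

lemma ip_sum_right:
  assumes "wiener g" "\<And>a. a \<in> A \<Longrightarrow> wiener (f a)"
  shows "ip g (\<Sum>a\<in>A. fps_const (c a) * f a) = (\<Sum>a\<in>A. cnj (c a) * ip g (f a))"
proof -
  have "ip g (\<Sum>a\<in>A. fps_const (c a) * f a) = cnj (ip (\<Sum>a\<in>A. fps_const (c a) * f a) g)"
    using assms by (intro ip_cnj[symmetric] wiener_sum wiener_scale) auto
  also have "\<dots> = (\<Sum>a\<in>A. cnj (c a) * ip g (f a))"
    using assms by (subst ip_sum_left) (auto simp: ip_cnj)
  finally show ?thesis .
qed

text \<open>The only way in which Gram entries are estimated for two blocks at different scales.\<close>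

lemma ip_le_l1_sup:
  assumes "wiener f" "wiener g" "\<And>k. cmod (fps_nth g k) \<le> C"
  shows "cmod (ip f g) \<le> l1_norm f * C"
proof -
  have "cmod (ip f g) \<le> (\<Sum>k. cmod (fps_nth f k * cnj (fps_nth g k)))"
    unfolding ip_def by (rule summable_norm) (use ip_summable(1)[OF assms(1,2)] in \<open>simp add: norm_mult\<close>)
  also have "\<dots> \<le> (\<Sum>k. cmod (fps_nth f k) * C)"
    using assms ip_summable(1)[OF assms(1,2)]
    by (intro suminf_le summable_mult2) (auto simp: norm_mult wiener_def intro: mult_left_mono)
  also have "\<dots> = l1_norm f * C"
    unfolding l1_norm_def using assms(1) unfolding wiener_def by (intro suminf_mult2[symmetric])
  finally show ?thesis .
qed

lemma ip_le_sq_norm: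
  assumes "wiener f" "wiener g"
  shows "cmod (ip f g) \<le> (sq_norm f + sq_norm g) / 2"
proof -
  have "cmod (ip f g) \<le> (\<Sum>k. cmod (fps_nth f k * cnj (fps_nth g k)))"
    unfolding ip_def by (rule summable_norm) (use ip_summable(1)[OF assms] in \<open>simp add: norm_mult\<close>)
  also have "\<dots> \<le> (\<Sum>k. ((cmod (fps_nth f k))\<^sup>2 + (cmod (fps_nth g k))\<^sup>2) / 2)"
  proof (intro suminf_le summable_divide summable_add sq_summable assms)
    show "cmod (fps_nth f k * cnj (fps_nth g k))
        \<le> ((cmod (fps_nth f k))\<^sup>2 + (cmod (fps_nth g k))\<^sup>2) / 2" for k
      using sum_squares_bound[of "cmod (fps_nth f k)" "cmod (fps_nth g k)"]
      by (simp add: norm_mult)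
  qed (use ip_summable(1)[OF assms] in \<open>simp add: norm_mult\<close>)
  also have "\<dots> = (sq_norm f + sq_norm g) / 2"
    unfolding sq_norm_def using assms
    by (simp add: suminf_divide suminf_add sq_summable summable_add)
  finally show ?thesis .
qed

section \<open>The Schur test\<close>

text \<open>Schur test: expand the square and use \<open>2 |c\<^sub>a c\<^sub>b| \<le> |c\<^sub>a|\<^sup>2 + |c\<^sub>b|\<^sup>2\<close>.\<close>

lemma schur_synthesis:
  assumes "finite Q" and f: "\<And>a. a \<in> Q \<Longrightarrow> wiener (f a)"
    and sym: "\<And>a b. m a b = m b a"
    and gram: "\<And>a b. a \<in> Q \<Longrightarrow> b \<in> Q \<Longrightarrow> cmod (ip (f a) (f b)) \<le> m a b"
    and row: "\<And>a. a \<in> Q \<Longrightarrow> (\<Sum>b\<in>Q. m a b) \<le> C"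
  shows "sq_norm (\<Sum>a\<in>Q. fps_const (c a) * f a) \<le> C * (\<Sum>a\<in>Q. (cmod (c a))\<^sup>2)"
proof -
  let ?F = "\<Sum>a\<in>Q. fps_const (c a) * f a"
  have F: "wiener ?F" using f by (intro wiener_sum wiener_scale)
  have "complex_of_real (sq_norm ?F) = (\<Sum>a\<in>Q. \<Sum>b\<in>Q. c a * cnj (c b) * ip (f a) (f b))"
  proof -
    have "complex_of_real (sq_norm ?F) = (\<Sum>a\<in>Q. c a * ip (f a) ?F)"
      using ip_sum_left[OF F, of Q f c] f ip_self[OF F] by simp
    also have "\<dots> = (\<Sum>a\<in>Q. \<Sum>b\<in>Q. c a * cnj (c b) * ip (f a) (f b))"
      using f by (intro sum.cong) (auto simp: ip_sum_right sum_distrib_left mult.assoc)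
    finally show ?thesis .
  qed
  then have "cmod (complex_of_real (sq_norm ?F))
      = cmod (\<Sum>a\<in>Q. \<Sum>b\<in>Q. c a * cnj (c b) * ip (f a) (f b))" by simp
  then have "sq_norm ?F = cmod (\<Sum>a\<in>Q. \<Sum>b\<in>Q. c a * cnj (c b) * ip (f a) (f b))"
    using sq_norm_nonneg[OF F] by (simp only: norm_of_real abs_of_nonneg)
  also have "\<dots> \<le> (\<Sum>a\<in>Q. \<Sum>b\<in>Q. cmod (c a * cnj (c b) * ip (f a) (f b)))"
    by (rule order.trans[OF norm_sum sum_mono[OF norm_sum]])
  also have "\<dots> \<le> (\<Sum>a\<in>Q. \<Sum>b\<in>Q. (cmod (c a))\<^sup>2 / 2 * m a b + (cmod (c b))\<^sup>2 / 2 * m a b)"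
  proof (intro sum_mono)
    fix a b assume ab: "a \<in> Q" "b \<in> Q"
    have m: "0 \<le> m a b" using gram[OF ab] norm_ge_zero order.trans by blast
    have "cmod (c a * cnj (c b) * ip (f a) (f b)) \<le> (cmod (c a) * cmod (c b)) * m a b"
      using gram[OF ab] by (simp add: norm_mult mult_left_mono)
    also have "\<dots> \<le> (((cmod (c a))\<^sup>2 + (cmod (c b))\<^sup>2) / 2) * m a b"
      using sum_squares_bound[of "cmod (c a)" "cmod (c b)"] m by (intro mult_right_mono) auto
    finally show "cmod (c a * cnj (c b) * ip (f a) (f b))
        \<le> (cmod (c a))\<^sup>2 / 2 * m a b + (cmod (c b))\<^sup>2 / 2 * m a b"
      by (simp add: field_simps)
  qed
  also have "\<dots> = (\<Sum>a\<in>Q. (cmod (c a))\<^sup>2 / 2 * (\<Sum>b\<in>Q. m a b))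
      + (\<Sum>a\<in>Q. \<Sum>b\<in>Q. (cmod (c b))\<^sup>2 / 2 * m a b)"
    by (simp add: sum.distrib sum_distrib_left)
  also have "(\<Sum>a\<in>Q. \<Sum>b\<in>Q. (cmod (c b))\<^sup>2 / 2 * m a b)
      = (\<Sum>a\<in>Q. (cmod (c a))\<^sup>2 / 2 * (\<Sum>b\<in>Q. m a b))"
    by (subst sum.swap) (simp add: sum_distrib_left sym)
  also have "(\<Sum>a\<in>Q. (cmod (c a))\<^sup>2 / 2 * (\<Sum>b\<in>Q. m a b))
      + (\<Sum>a\<in>Q. (cmod (c a))\<^sup>2 / 2 * (\<Sum>b\<in>Q. m a b)) = (\<Sum>a\<in>Q. (cmod (c a))\<^sup>2 * (\<Sum>b\<in>Q. m a b))"
    by (simp add: mult.commute flip: sum.distrib)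
  also have "\<dots> \<le> (\<Sum>a\<in>Q. (cmod (c a))\<^sup>2 * C)"
    by (intro sum_mono mult_left_mono row) auto
  finally show ?thesis by (simp add: sum_distrib_left mult.commute)
qed

text \<open>The dual form of the synthesis bound. With \<open>G = \<Sum> c\<^sub>a f\<^sub>a\<close>, \<open>c\<^sub>a = \<langle>F, f\<^sub>a\<rangle>\<close>, it drops out of
\<open>0 \<le> \<parallel>F - G / C\<parallel>\<^sup>2\<close>, because \<open>\<langle>F, G\<rangle> = \<Sum> |c\<^sub>a|\<^sup>2\<close>.\<close>

lemma schur_analysis:
  assumes "finite Q" and f: "\<And>a. a \<in> Q \<Longrightarrow> wiener (f a)"
    and sym: "\<And>a b. m a b = m b a"
    and gram: "\<And>a b. a \<in> Q \<Longrightarrow> b \<in> Q \<Longrightarrow> cmod (ip (f a) (f b)) \<le> m a b"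
    and row: "\<And>a. a \<in> Q \<Longrightarrow> (\<Sum>b\<in>Q. m a b) \<le> C"
    and F: "wiener F" and C: "C > 0"
  shows "(\<Sum>a\<in>Q. (cmod (ip F (f a)))\<^sup>2) \<le> C * sq_norm F"
proof -
  define c where "c a = ip F (f a)" for a
  define G where "G = (\<Sum>a\<in>Q. fps_const (c a) * f a)"
  define S where "S = (\<Sum>a\<in>Q. (cmod (c a))\<^sup>2)"
  have G: "wiener G" unfolding G_def using f by (intro wiener_sum wiener_scale)
  have FG: "ip F G = of_real S"
    unfolding G_def S_def using F f
    by (simp add: ip_sum_right c_def[symmetric] mult.commute[of "cnj _"] complex_norm_square[symmetric])
  then have GF: "ip G F = of_real S" using ip_cnj[OF F G] by simp
  let ?t = "- 1 / C"
  have "complex_of_real (sq_norm (F + fps_const (of_real ?t) * G))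
      = of_real (sq_norm F + 2 * ?t * S + ?t\<^sup>2 * sq_norm G)"
  proof -
    define t where "t = ?t"
    define H where "H = fps_const (complex_of_real t) * G"
    have H: "wiener H" unfolding H_def by (intro wiener_scale G)
    have HX: "ip H X = of_real t * ip G X" if "wiener X" for X
      unfolding H_def by (rule ip_scale_left[OF G that])
    have XH: "ip X H = of_real t * ip X G" if "wiener X" for X
    proof -
      have "ip X H = cnj (ip H X)" using ip_cnj[OF H that] by simp
      also have "\<dots> = of_real t * ip X G" using HX[OF that] ip_cnj[OF G that] by simp
      finally show ?thesis .
    qed
    have RX: "ip X (F + H) = ip X F + ip X H" if "wiener X" for X
    proof -
      have "ip X (F + H) = cnj (ip (F + H) X)" using ip_cnj[OF wiener_add[OF F H] that] by simp
      also have "\<dots> = ip X F + ip X H"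
        using ip_add_left[OF F H that] ip_cnj[OF F that] ip_cnj[OF H that] by simp
      finally show ?thesis .
    qed
    have "complex_of_real (sq_norm (F + H)) = ip (F + H) (F + H)"
      using F H by (simp add: ip_self wiener_add)
    also have "\<dots> = ip F F + ip F H + (ip H F + ip H H)"
      using F H by (simp add: ip_add_left RX wiener_add)
    also have "\<dots> = of_real (sq_norm F + 2 * t * S + t\<^sup>2 * sq_norm G)"
    proof -
      have "ip H H = of_real (t\<^sup>2 * sq_norm G)"
        using HX[OF H] XH[OF G] ip_self[OF G] by (simp add: power2_eq_square)
      moreover have "ip H F = of_real (t * S)" "ip F H = of_real (t * S)"
        using HX[OF F] XH[OF F] FG GF by simp_all
      ultimately show ?thesis using ip_self[OF F] by simp
    qed
    finally show ?thesis unfolding H_def t_def .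
  qed
  then have "sq_norm (F + fps_const (of_real ?t) * G) = sq_norm F + 2 * ?t * S + ?t\<^sup>2 * sq_norm G"
    using of_real_eq_iff by blast
  then have "0 \<le> sq_norm F + 2 * ?t * S + ?t\<^sup>2 * sq_norm G"
    using sq_norm_nonneg[OF wiener_add[OF F wiener_scale[OF G, of "of_real ?t"]]] by argo
  also have "\<dots> \<le> sq_norm F + 2 * ?t * S + ?t\<^sup>2 * (C * S)"
    using schur_synthesis[OF assms(1-5), where c=c] unfolding G_def S_def
    by (intro add_left_mono mult_left_mono) auto
  also have "\<dots> = sq_norm F - S / C"
    using C by (simp add: field_simps power2_eq_square)
  finally show ?thesis using C by (simp add: S_def c_def field_simps)
qed

section \<open>Blaschke factors\<close>

definition kern :: "complex \<Rightarrow> complex fps" where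
  "kern w = Abs_fps (\<lambda>k. w ^ k)"

text \<open>Up to a constant factor, its inverse is the number of steps after which the powers of \<open>w\<close> start to
decay.\<close>

definition defect :: "complex \<Rightarrow> real" where
  "defect w = 1 - (cmod w)\<^sup>2"

text \<open>The zero is placed at \<open>cnj w\<close> because pairing with \<open>kern w\<close> is evaluation at that point.\<close>

definition blaschke :: "complex \<Rightarrow> complex fps" where
  "blaschke w = (fps_X - fps_const (cnj w)) * kern w"

definition ukern :: "complex \<Rightarrow> complex fps" where
  "ukern w = fps_const (of_real (sqrt (defect w))) * kern w"

text \<open>The quotient of consecutive elements of a Jordan chain (\<open>fps_nth_blockvec\<close>).\<close>

definition jshift :: "complex \<Rightarrow> complex fps" where
  "jshift w = fps_const (of_real (defect w)) * fps_X * kern w"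

definition evalp :: "complex \<Rightarrow> complex fps \<Rightarrow> complex" where
  "evalp x f = (\<Sum>k. fps_nth f k * x ^ k)"

lemma defect_pos: "cmod w < 1 \<Longrightarrow> 0 < defect w"
  unfolding defect_def by (simp add: power_less_one_iff abs_square_less_1)

lemma defect_le_1: "defect w \<le> 1"
  by (simp add: defect_def)

lemma defect_div: "cmod w < 1 \<Longrightarrow> defect w / (1 - cmod w) \<le> 2"
proof -
  assume w: "cmod w < 1"
  have "defect w = (1 - cmod w) * (1 + cmod w)"
    by (simp add: defect_def power2_eq_square algebra_simps)
  then show ?thesis using w by simp
qed

lemma kern_inverse: "(1 - fps_const w * fps_X) * kern w = 1"
proof (rule fps_ext)
  fix k
  show "fps_nth ((1 - fps_const w * fps_X) * kern w) k = fps_nth 1 k"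
    by (cases k) (simp_all add: kern_def left_diff_distrib mult.assoc)
qed

lemma wiener_kern: "cmod w < 1 \<Longrightarrow> wiener (kern w)"
  by (simp add: wiener_def kern_def norm_power summable_geometric)

lemma l1_norm_kern: "cmod w < 1 \<Longrightarrow> l1_norm (kern w) = 1 / (1 - cmod w)"
  by (simp add: l1_norm_def kern_def norm_power suminf_geometric)

lemma wiener_ukern: "cmod w < 1 \<Longrightarrow> wiener (ukern w)"
  unfolding ukern_def by (intro wiener_scale wiener_kern)

lemma wiener_jshift: "cmod w < 1 \<Longrightarrow> wiener (jshift w)"
  unfolding jshift_def by (intro wiener_mult wiener_kern wiener_const wiener_X)

lemma l1_norm_jshift:
  assumes "cmod w < 1" shows "l1_norm (jshift w) \<le> 2"
proof -
  have "l1_norm (jshift w) \<le> l1_norm (fps_const (of_real (defect w)) * fps_X) * l1_norm (kern w)"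
    unfolding jshift_def using assms by (intro wiener_mult wiener_kern wiener_const wiener_X)
  also have "\<dots> \<le> (l1_norm (fps_const (of_real (defect w))) * l1_norm fps_X) * l1_norm (kern w)"
    using assms
    by (intro mult_right_mono wiener_mult l1_norm_nonneg wiener_kern wiener_const wiener_X)
  also have "\<dots> = defect w / (1 - cmod w)"
    using assms defect_pos[of w] by (simp add: wiener_const wiener_X l1_norm_kern)
  finally show ?thesis using defect_div[OF assms] by simp
qed

text \<open>The reason for the weight \<open>1 - |z|\<^sup>2\<close> in the Jordan blocks: it makes the chain quotient a Blaschke
factor up to an additive constant.\<close>

lemma blaschke_jshift: "blaschke w = jshift w + fps_const (- cnj w)"
proof -
  have *: "kern w = 1 + fps_const w * fps_X * kern w"
    using kern_inverse[of w] by (simp add: algebra_simps)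
  have "fps_const (cnj w) * kern w = fps_const (cnj w) + fps_const (of_real ((cmod w)\<^sup>2)) * fps_X * kern w"
    by (subst *) (simp add: distrib_left mult.assoc[symmetric] mult.commute[of "cnj w"]
        flip: complex_norm_square)
  moreover have "fps_const (of_real (defect w)) = 1 - fps_const (complex_of_real ((cmod w)\<^sup>2))"
    unfolding defect_def by (metis fps_const_1_eq_1 fps_const_sub of_real_1 of_real_diff)
  ultimately show ?thesis
    unfolding blaschke_def jshift_def
    by (simp only: left_diff_distrib mult_1 fps_const_neg[symmetric]) simp
qed

lemma wiener_blaschke: "cmod w < 1 \<Longrightarrow> wiener (blaschke w)"
  unfolding blaschke_jshift by (intro wiener_add wiener_jshift wiener_const)

lemma l1_norm_add: "wiener f \<Longrightarrow> wiener g \<Longrightarrow> l1_norm (f + g) \<le> l1_norm f + l1_norm g"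
  using wiener_add[of f g] unfolding l1_norm_def wiener_def fps_add_nth
  by (subst suminf_add) (auto intro!: suminf_le norm_triangle_ineq summable_add)

lemma l1_norm_blaschke: 
  assumes "cmod w < 1" shows "l1_norm (blaschke w) \<le> 3"
  using l1_norm_add[OF wiener_jshift[OF assms] wiener_const(1)[of "- cnj w"]]
    l1_norm_jshift[OF assms] assms
  by (simp add: blaschke_jshift wiener_const)

lemma l1_norm_ukern:
  assumes "cmod w < 1" shows "l1_norm (ukern w) \<le> 2 / sqrt (defect w)"
proof -
  have d: "0 < defect w" using defect_pos[OF assms] .
  have "l1_norm (ukern w) \<le> l1_norm (fps_const (of_real (sqrt (defect w)))) * l1_norm (kern w)"
    unfolding ukern_def using assms by (intro wiener_mult wiener_kern wiener_const)
  also have "\<dots> = sqrt (defect w) / (1 - cmod w)"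
    using assms d by (simp add: wiener_const l1_norm_kern)
  also have "\<dots> = defect w / (1 - cmod w) / sqrt (defect w)"
    using d real_div_sqrt[of "defect w"]
    by (metis divide_divide_eq_left mult.commute less_imp_le)
  also have "\<dots> \<le> 2 / sqrt (defect w)"
    using defect_div[OF assms] d by (intro divide_right_mono) auto
  finally show ?thesis .
qed

lemma sup_ukern:
  assumes "cmod w < 1" shows "cmod (fps_nth (ukern w) k) \<le> sqrt (defect w)"
  using assms defect_pos[OF assms]
  by (simp add: ukern_def kern_def norm_mult norm_power power_le_one mult_left_le)

text \<open>Writing \<open>f = (1 - w X) y\<close> and \<open>g = (1 - w X) x\<close>, the coefficientwise difference of the two products is
\<open>(1 - |w|\<^sup>2) (y\<^sub>k\<^sub>-\<^sub>1 cnj x\<^sub>k\<^sub>-\<^sub>1 - y\<^sub>k cnj x\<^sub>k)\<close>, which telescopes to zero.\<close>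

lemma ip_blaschke:
  assumes w: "cmod w < 1" and f: "wiener f" and g: "wiener g"
  shows "ip (blaschke w * f) (blaschke w * g) = ip f g"
proof -
  define y where "y = kern w * f"
  define x where "x = kern w * g"
  have W: "wiener y" "wiener x" "wiener (blaschke w * f)" "wiener (blaschke w * g)"
    unfolding y_def x_def using assms by (auto intro!: wiener_mult wiener_kern wiener_blaschke)
  have f': "f = (1 - fps_const w * fps_X) * y"
    unfolding y_def using kern_inverse[of w] by (simp add: mult.assoc[symmetric])
  have g': "g = (1 - fps_const w * fps_X) * x"
    unfolding x_def using kern_inverse[of w] by (simp add: mult.assoc[symmetric])
  have bf: "blaschke w * f = (fps_X - fps_const (cnj w)) * y" 
    and bg: "blaschke w * g = (fps_X - fps_const (cnj w)) * x"
    unfolding y_def x_def blaschke_def by (simp_all add: mult.assoc)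
  let ?p = "\<lambda>k. fps_nth (blaschke w * f) k * cnj (fps_nth (blaschke w * g) k)
                - fps_nth f k * cnj (fps_nth g k)"
  have D: "complex_of_real (defect w) = 1 - w * cnj w"
    by (simp add: defect_def flip: complex_norm_square)
  have tele: "(\<Sum>k<Suc N. ?p k) = - of_real (defect w) * (fps_nth y N * cnj (fps_nth x N))" for N
  proof (induction N)
    case 0
    have "?p 0 = (- cnj w * fps_nth y 0) * cnj (- cnj w * fps_nth x 0) - fps_nth y 0 * cnj (fps_nth x 0)"
      unfolding bf bg by (subst f', subst g') (simp add: left_diff_distrib mult.assoc)
    then show ?case by (simp add: D algebra_simps)
  next
    case (Suc N)
    have identity: "(y0 - cnj w * y1) * cnj (x0 - cnj w * x1) - (y1 - w * y0) * cnj (x1 - w * x0)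
        = of_real (defect w) * (y0 * cnj x0) - of_real (defect w) * (y1 * cnj x1)" for y0 y1 x0 x1
      unfolding D by (simp add: algebra_simps)
    have shift: "fps_nth ((fps_X - fps_const (cnj w)) * u) (Suc N) = fps_nth u N - cnj w * fps_nth u (Suc N)"
        "fps_nth ((1 - fps_const w * fps_X) * u) (Suc N) = fps_nth u (Suc N) - w * fps_nth u N" for u
      by (simp_all add: left_diff_distrib mult.assoc)
    have "?p (Suc N) = of_real (defect w) * (fps_nth y N * cnj (fps_nth x N))
        - of_real (defect w) * (fps_nth y (Suc N) * cnj (fps_nth x (Suc N)))"
      unfolding bf bg by (subst f', subst g') (simp only: shift identity)
    then show ?case using Suc by simp
  qed
  have "(\<lambda>N. - of_real (defect w) * (fps_nth y N * cnj (fps_nth x N)))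
       \<longlonglongrightarrow> - of_real (defect w) * 0"
    by (intro tendsto_mult tendsto_const summable_LIMSEQ_zero ip_summable W)
  then have "(\<lambda>N. \<Sum>k<Suc N. ?p k) \<longlonglongrightarrow> 0" by (simp only: tele) simp
  then have "?p sums 0" unfolding sums_def by (rule filterlim_sequentially_Suc[THEN iffD1])
  moreover have "?p sums (ip (blaschke w * f) (blaschke w * g) - ip f g)"
    unfolding ip_def by (intro sums_diff summable_sums ip_summable W f g)
  ultimately show ?thesis using sums_unique2 by fastforce
qed

lemma ip_blaschke_power:
  assumes "cmod w < 1" "wiener f" "wiener g"
  shows "ip (blaschke w ^ m * f) (blaschke w ^ m * g) = ip f g"
  using assms
  by (induction m) (simp_all add: ip_blaschke mult.assoc wiener_mult wiener_power wiener_blaschke)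

lemma ip_blaschke_prod:
  assumes "\<And>i. i \<in> A \<Longrightarrow> cmod (w i) < 1" "wiener f" "wiener g"
  shows "ip ((\<Prod>i\<in>A. blaschke (w i) ^ m i) * f) ((\<Prod>i\<in>A. blaschke (w i) ^ m i) * g) = ip f g"
  using assms
proof (induction A rule: infinite_finite_induct)
  case (insert i A)
  have "wiener ((\<Prod>i\<in>A. blaschke (w i) ^ m i) * f)" "wiener ((\<Prod>i\<in>A. blaschke (w i) ^ m i) * g)"
    using insert.prems by (auto intro!: wiener_mult wiener_prod wiener_power wiener_blaschke)
  then show ?case
    using insert by (simp add: mult.assoc ip_blaschke_power)
qed simp_all

section \<open>Evaluation at a point of the disc\<close>

lemma evalp_summable:
  assumes "wiener f" "cmod x < 1"
  shows "summable (\<lambda>k. cmod (fps_nth f k * x ^ k))"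
  by (rule summable_comparison_test'[of "\<lambda>k. cmod (fps_nth f k)"])
     (use assms in \<open>auto simp: wiener_def norm_mult norm_power power_le_one mult_left_le\<close>)

lemma evalp_mult:
  assumes "wiener f" "wiener g" "cmod x < 1"
  shows "evalp x (f * g) = evalp x f * evalp x g"
proof -
  have "evalp x f * evalp x g
      = (\<Sum>k. \<Sum>i\<le>k. (fps_nth f i * x ^ i) * (fps_nth g (k - i) * x ^ (k - i)))"
    unfolding evalp_def using assms by (intro Cauchy_product evalp_summable)
  also have "(\<lambda>k. \<Sum>i\<le>k. (fps_nth f i * x ^ i) * (fps_nth g (k - i) * x ^ (k - i)))
      = (\<lambda>k. fps_nth (f * g) k * x ^ k)"
  proof
    fix k
    have "(\<Sum>i\<le>k. (fps_nth f i * x ^ i) * (fps_nth g (k - i) * x ^ (k - i)))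
        = (\<Sum>i\<le>k. fps_nth f i * fps_nth g (k - i) * x ^ k)"
    proof (rule sum.cong)
      fix i assume "i \<in> {..k}"
      then have "x ^ k = x ^ i * x ^ (k - i)" by (simp flip: power_add)
      then show "(fps_nth f i * x ^ i) * (fps_nth g (k - i) * x ^ (k - i))
          = fps_nth f i * fps_nth g (k - i) * x ^ k" by simp
    qed simp
    then show "(\<Sum>i\<le>k. (fps_nth f i * x ^ i) * (fps_nth g (k - i) * x ^ (k - i)))
        = fps_nth (f * g) k * x ^ k"
      by (simp add: fps_mult_nth atLeast0AtMost sum_distrib_right)
  qed
  finally show ?thesis by (simp add: evalp_def)
qed

lemma evalp_const: "evalp x (fps_const c) = c" and evalp_X: "evalp x fps_X = x"
proof -
  have "(\<lambda>k. fps_nth (fps_const c) k * x ^ k) sums (\<Sum>k\<in>{0}. fps_nth (fps_const c) k * x ^ k)"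
    by (rule sums_finite) auto
  then show "evalp x (fps_const c) = c" by (simp add: evalp_def sums_iff)
  have "(\<lambda>k. fps_nth fps_X k * x ^ k) sums (\<Sum>k\<in>{1}. fps_nth fps_X k * x ^ k)"
    by (rule sums_finite) auto
  then show "evalp x fps_X = x" by (simp add: evalp_def sums_iff)
qed

lemma evalp_1: "evalp x 1 = 1"
  using evalp_const[of x 1] by simp

lemma evalp_diff:
  assumes "wiener f" "wiener g" "cmod x < 1"
  shows "evalp x (f - g) = evalp x f - evalp x g"
  unfolding evalp_def
  by (subst suminf_diff[OF summable_norm_cancel summable_norm_cancel])
     (use assms evalp_summable in \<open>auto simp: algebra_simps\<close>)

lemma evalp_power:
  "wiener f \<Longrightarrow> cmod x < 1 \<Longrightarrow> evalp x (f ^ m) = evalp x f ^ m"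
  by (induction m) (simp_all add: evalp_1 evalp_mult wiener_power)

lemma evalp_prod:
  "(\<And>i. i \<in> A \<Longrightarrow> wiener (f i)) \<Longrightarrow> cmod x < 1 \<Longrightarrow> evalp x (\<Prod>i\<in>A. f i) = (\<Prod>i\<in>A. evalp x (f i))"
  by (induction A rule: infinite_finite_induct)
     (simp_all add: evalp_1 evalp_mult wiener_prod)

lemma evalp_kern:
  assumes "cmod w < 1" "cmod x < 1" shows "evalp x (kern w) = 1 / (1 - w * x)"
proof -
  have "cmod (w * x) < 1" using assms by (metis mult_strict_mono norm_ge_zero norm_mult mult_1 zero_less_one)
  then show ?thesis
    by (simp add: evalp_def kern_def suminf_geometric flip: power_mult_distrib)
qed

lemma evalp_blaschke:
  assumes "cmod w < 1" "cmod x < 1"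
  shows "evalp x (blaschke w) = (x - cnj w) / (1 - w * x)"
  unfolding blaschke_def using assms
  by (simp add: evalp_mult evalp_diff evalp_X evalp_const evalp_kern wiener_X wiener_const
      wiener_kern wiener_diff)

text \<open>Since evaluation is multiplicative, this makes pairings of the kernel with products of Blaschke
factors explicit.\<close>

lemma ip_ukern:
  assumes "cmod w < 1" "wiener f"
  shows "ip (ukern w) f = of_real (sqrt (defect w)) * cnj (evalp (cnj w) f)"
proof -
  have "cnj (evalp (cnj w) f) = (\<Sum>k. cnj (fps_nth f k * cnj w ^ k))"
    unfolding evalp_def
    using assms bounded_linear.suminf[OF bounded_linear_cnj
        summable_norm_cancel[OF evalp_summable[of f "cnj w"]]] by simp
  then have "cnj (evalp (cnj w) f) = ip (kern w) f"
    by (simp add: ip_def kern_def mult.commute)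
  then show ?thesis using assms by (simp add: ukern_def ip_scale_left wiener_kern)
qed

lemma ip_ukern_self:
  assumes "cmod w < 1" shows "ip (ukern w) (ukern w) = 1"
proof -
  have d: "0 < defect w" by (rule defect_pos[OF assms])
  have "evalp (cnj w) (ukern w) = of_real (sqrt (defect w)) / (1 - w * cnj w)"
    unfolding ukern_def using assms by (simp add: evalp_mult evalp_const wiener_const wiener_kern evalp_kern)
  also have "1 - w * cnj w = of_real (defect w)"
    by (simp add: defect_def complex_norm_square[symmetric])
  finally have "evalp (cnj w) (ukern w) = of_real (sqrt (defect w) / defect w)" by simp
  then have "ip (ukern w) (ukern w) = of_real (sqrt (defect w) * (sqrt (defect w) / defect w))"
    using ip_ukern[OF assms wiener_ukern[OF assms]] by (simp only: of_real_mult complex_cnj_complex_of_real)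
  also have "sqrt (defect w) * (sqrt (defect w) / defect w) = 1"
    using d by simp
  finally show ?thesis by simp
qed

lemma ip_ukern_blaschke:
  assumes "cmod w < 1" "wiener f" shows "ip (ukern w) (blaschke w * f) = 0"
  using assms by (simp add: ip_ukern wiener_mult wiener_blaschke evalp_mult evalp_blaschke)

lemma ip_ukern_mult:
  assumes "cmod w < 1" "wiener f"
  shows "ip (ukern w) (f * ukern w) = cnj (evalp (cnj w) f)"
proof -
  have "ip (ukern w) (f * ukern w) = cnj (evalp (cnj w) f) * ip (ukern w) (ukern w)"
    using assms by (simp add: ip_ukern wiener_mult wiener_ukern evalp_mult)
  then show ?thesis using ip_ukern_self[OF assms(1)] by simp
qed

section \<open>The basis of one Jordan block\<close>

text \<open>The normalised Jordan chain: \<open>blockvec w m\<close> has the coefficients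
\<open>sqrt (1 - |w|\<^sup>2) (k choose m) w ^ (k - m) (1 - |w|\<^sup>2) ^ m\<close>.\<close>

definition blockvec :: "complex \<Rightarrow> nat \<Rightarrow> complex fps" where
  "blockvec w m = jshift w ^ m * ukern w"

lemma wiener_blockvec: "cmod w < 1 \<Longrightarrow> wiener (blockvec w m)"
  unfolding blockvec_def by (intro wiener_mult wiener_power wiener_jshift wiener_ukern)

lemma l1_norm_blockvec:
  assumes "cmod w < 1" shows "l1_norm (blockvec w m) \<le> 2 ^ m * (2 / sqrt (defect w))"
proof -
  have "l1_norm (blockvec w m) \<le> l1_norm (jshift w ^ m) * l1_norm (ukern w)"
    unfolding blockvec_def using assms by (intro wiener_mult wiener_power wiener_jshift wiener_ukern)
  also have "\<dots> \<le> 2 ^ m * (2 / sqrt (defect w))"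
    using assms
    by (intro mult_mono l1_norm_power l1_norm_jshift l1_norm_ukern l1_norm_nonneg wiener_jshift wiener_ukern) auto
  finally show ?thesis .
qed

lemma sup_blockvec:
  assumes "cmod w < 1" shows "cmod (fps_nth (blockvec w m) k) \<le> 2 ^ m * sqrt (defect w)"
proof -
  have "cmod (fps_nth (blockvec w m) k) \<le> l1_norm (jshift w ^ m) * sqrt (defect w)"
    unfolding blockvec_def using assms by (intro sup_mult_le sup_ukern wiener_power wiener_jshift)
  also have "\<dots> \<le> 2 ^ m * sqrt (defect w)"
    using assms defect_pos[OF assms]
    by (intro mult_right_mono l1_norm_power l1_norm_jshift wiener_jshift) auto
  finally show ?thesis .
qed

lemma fps_nth_blockvec:
  "fps_nth (blockvec w m) k
     = of_real (sqrt (defect w)) * (of_nat (k choose m) * w ^ (k - m) * of_real (defect w) ^ m)"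
proof -
  define E where "E m = Abs_fps (\<lambda>k. of_nat (k choose m) * w ^ (k - m) * of_real (defect w) ^ m)" for m
  have E0: "E 0 = kern w" by (simp add: E_def kern_def)
  have ES: "E (Suc m) = jshift w * E m" for m
  proof -
    have rec: "(1 - fps_const w * fps_X) * E (Suc m) = fps_const (of_real (defect w)) * fps_X * E m"
    proof (rule fps_ext)
      fix k
      show "fps_nth ((1 - fps_const w * fps_X) * E (Suc m)) k
          = fps_nth (fps_const (of_real (defect w)) * fps_X * E m) k"
      proof (cases k)
        case (Suc l)
        show ?thesis
        proof (cases "Suc m \<le> l")
          case True
          then have "l - m = Suc (l - Suc m)" by simp
          then show ?thesis using Suc by (simp add: E_def left_diff_distrib mult.assoc algebra_simps)
        next
          case False
          then show ?thesis using Suc by (auto simp: E_def left_diff_distrib mult.assoc not_le less_Suc_eq binomial_eq_0)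
        qed
      qed (simp add: E_def left_diff_distrib mult.assoc)
    qed
    then have "kern w * ((1 - fps_const w * fps_X) * E (Suc m)) = jshift w * E m"
      unfolding jshift_def rec by (simp only: ac_simps)
    moreover have "kern w * ((1 - fps_const w * fps_X) * E (Suc m)) = E (Suc m)"
      using arg_cong[OF kern_inverse[of w], of "\<lambda>u. u * E (Suc m)"]
      by (simp only: mult.assoc mult.left_commute mult_1 mult.commute[of "kern w"])
    ultimately show ?thesis by simp
  qed
  have "E m = jshift w ^ m * kern w"
    by (induction m) (simp_all add: E0 ES mult.assoc)
  then have "blockvec w m = fps_const (of_real (sqrt (defect w))) * E m"
    by (simp add: blockvec_def ukern_def algebra_simps)
  then show ?thesis by (simp add: E_def)
qed

text \<open>In \<open>blockvec w m = (b + cnj w)^m ukern w\<close>, with \<open>b\<close> the Blaschke factor, only the summand \<open>b^m ukern w\<close>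
contributes: removing common factors \<open>b\<close> from any other one leaves the kernel paired with a
multiple of \<open>b\<close>, which vanishes at \<open>cnj w\<close>.\<close>

lemma ip_blockvec_diag:
  assumes "cmod w < 1" "wiener f"
  shows "ip (blockvec w m) (blaschke w ^ m * f) = ip (ukern w) f"
  using assms(2)
proof (induction m arbitrary: f)
  case 0
  then show ?case by (simp add: blockvec_def)
next
  case (Suc m)
  let ?g = "blaschke w ^ m * f"
  have W: "wiener ?g" "wiener (blaschke w * ?g)" "wiener (blaschke w * f)" "wiener (blaschke w)"
    using Suc.prems assms(1) by (auto intro!: wiener_mult wiener_power wiener_blaschke)
  have "jshift w = blaschke w + fps_const (cnj w)" by (simp add: blaschke_jshift)
  then have "blockvec w (Suc m) = blaschke w * blockvec w m + fps_const (cnj w) * blockvec w m"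
    by (simp add: blockvec_def algebra_simps)
  moreover have B: "blaschke w ^ Suc m * f = blaschke w * ?g" by (simp add: mult.assoc)
  ultimately have "ip (blockvec w (Suc m)) (blaschke w ^ Suc m * f)
     = ip (blaschke w * blockvec w m) (blaschke w * ?g) + cnj w * ip (blockvec w m) (blaschke w * ?g)"
    unfolding B using W assms(1)
    by (simp only: ip_add_left[OF wiener_mult(1) wiener_scale] ip_scale_left wiener_blockvec)
  also have "blaschke w * ?g = blaschke w ^ m * (blaschke w * f)" by (simp add: algebra_simps)
  also have "ip (blockvec w m) \<dots> = ip (ukern w) (blaschke w * f)"
    by (rule Suc.IH[OF W(3)])
  also have "\<dots> = 0" by (rule ip_ukern_blaschke[OF assms(1) Suc.prems])
  also have "blaschke w ^ m * (blaschke w * f) = blaschke w * ?g" by (simp add: algebra_simps)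
  also have "ip (blaschke w * blockvec w m) (blaschke w * ?g) = ip (ukern w) f"
    using W assms(1) Suc by (simp add: ip_blaschke wiener_blockvec)
  finally show ?case by simp
qed

lemma ip_blockvec_zero:
  assumes "cmod w < 1" "wiener f" "m < j"
  shows "ip (blockvec w m) (blaschke w ^ j * f) = 0"
proof -
  define l where "l = j - Suc m"
  have j: "j = m + Suc l" using assms(3) by (simp add: l_def)
  have "blaschke w ^ j * f = blaschke w ^ m * (blaschke w * (blaschke w ^ l * f))"
    unfolding j power_add power_Suc by (simp only: mult.assoc)
  then show ?thesis
    using assms
    by (simp only: ip_blockvec_diag ip_ukern_blaschke wiener_mult wiener_power wiener_blaschke)
qed

section \<open>Uniformly triangular systems\<close>

text \<open>Back substitution. The constant depends on the size, the bound of the entries and the lower bound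
of the diagonal only, so it serves all blocks at once.\<close>

lemma triangular_bounded_below:
  fixes K c :: real
  assumes "0 \<le> K" "0 < c"
  shows "\<exists>C>0. \<forall>n\<le>N. \<forall>(A :: nat \<Rightarrow> nat \<Rightarrow> complex) x.
    (\<forall>m<n. \<forall>j<n. cmod (A m j) \<le> K) \<longrightarrow> (\<forall>m<n. c \<le> cmod (A m m)) \<longrightarrow>
    (\<Sum>j<n. (cmod (x j))\<^sup>2) \<le> C * (\<Sum>m<n. (cmod (\<Sum>j=m..<n. A m j * x j))\<^sup>2)"
proof -
  \<comment> \<open>Each step of the back substitution multiplies the bound by at most this factor.\<close>
  define D where "D = max 1 ((1 + K * N) / c)"
  have D1: "1 \<le> D" and D2: "1 + K * N \<le> c * D"
    unfolding D_def using assms by (auto simp: max_def field_simps)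
  have main: "(\<Sum>j<n. (cmod (x j))\<^sup>2) \<le> (N * (D ^ N)\<^sup>2 + 1) * (\<Sum>m<n. (cmod (\<Sum>j=m..<n. A m j * x j))\<^sup>2)"
    if n: "n \<le> N" and K: "\<And>m j. m < n \<Longrightarrow> j < n \<Longrightarrow> cmod (A m j) \<le> K"
      and c: "\<And>m. m < n \<Longrightarrow> c \<le> cmod (A m m)" for n and A :: "nat \<Rightarrow> nat \<Rightarrow> complex" and x
  proof -
    define y where "y m = (\<Sum>j=m..<n. A m j * x j)" for m
    define S where "S = sqrt (\<Sum>m<n. (cmod (y m))\<^sup>2)"
    have S0: "0 \<le> S" by (simp add: S_def sum_nonneg)
    have yS: "cmod (y m) \<le> S" if "m < n" for m
    proof -
      have "(cmod (y m))\<^sup>2 \<le> (\<Sum>m<n. (cmod (y m))\<^sup>2)"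
        using that by (intro member_le_sum) auto
      then show ?thesis unfolding S_def using real_le_rsqrt by blast
    qed
    have x: "m < n \<Longrightarrow> n - m \<le> p \<Longrightarrow> cmod (x m) \<le> D ^ p * S" for m p
    proof (induction p arbitrary: m)
      case 0
      then show ?case by simp
    next
      case (Suc p)
      have "y m = A m m * x m + (\<Sum>j=Suc m..<n. A m j * x j)"
        unfolding y_def using Suc.prems by (simp add: sum.atLeast_Suc_lessThan)
      then have "A m m * x m = y m - (\<Sum>j=Suc m..<n. A m j * x j)" by simp
      then have "cmod (A m m * x m) \<le> cmod (y m) + cmod (\<Sum>j=Suc m..<n. A m j * x j)"
        by (metis norm_triangle_ineq4)
      also have "cmod (\<Sum>j=Suc m..<n. A m j * x j) \<le> (\<Sum>j=Suc m..<n. K * (D ^ p * S))"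
        using Suc K assms(1)
        by (intro order.trans[OF norm_sum] sum_mono) (auto simp: norm_mult intro!: mult_mono)
      also have "\<dots> = real (n - Suc m) * (K * (D ^ p * S))" by simp
      also have "\<dots> \<le> real N * (K * (D ^ p * S))"
        using n D1 S0 assms(1) by (intro mult_right_mono) auto
      also have "cmod (y m) \<le> D ^ p * S"
        using yS[OF Suc.prems(1)] mult_right_mono[OF one_le_power[OF D1, of p] S0] by simp
      finally have "cmod (A m m) * cmod (x m) \<le> (1 + K * N) * (D ^ p * S)"
        by (simp add: norm_mult algebra_simps)
      also have "\<dots> \<le> c * D * (D ^ p * S)"
        using D1 S0 by (intro mult_right_mono D2) auto
      finally have "c * cmod (x m) \<le> c * (D ^ Suc p * S)"
        using mult_right_mono[OF c[OF Suc.prems(1)], of "cmod (x m)"] by (simp add: mult.assoc)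
      then show ?case using assms(2) by simp
    qed
    have "(\<Sum>j<n. (cmod (x j))\<^sup>2) \<le> (\<Sum>j<n. (D ^ N * S)\<^sup>2)"
      using x n by (intro sum_mono power_mono) auto
    also have "\<dots> \<le> (N * (D ^ N)\<^sup>2) * S\<^sup>2"
      using n by (simp add: power_mult_distrib mult_right_mono mult.assoc)
    also have "\<dots> \<le> (N * (D ^ N)\<^sup>2 + 1) * S\<^sup>2" by (intro mult_right_mono) auto
    finally show ?thesis by (simp add: S_def y_def sum_nonneg)
  qed
  have "0 < real N * (D ^ N)\<^sup>2 + 1" by (simp add: add_nonneg_pos)
  then show ?thesis
    by (intro exI[of _ "real N * (D ^ N)\<^sup>2 + 1"] conjI allI impI main) blast+
qed

lemma norm_sum_sq_le:
  fixes a b :: "'a \<Rightarrow> complex" and K :: real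
  assumes "finite A" "\<And>j. j \<in> A \<Longrightarrow> cmod (a j) \<le> K"
  shows "(cmod (\<Sum>j\<in>A. a j * b j))\<^sup>2 \<le> card A * K\<^sup>2 * (\<Sum>j\<in>A. (cmod (b j))\<^sup>2)"
proof -
  have "cmod (\<Sum>j\<in>A. a j * b j) \<le> (\<Sum>j\<in>A. K * cmod (b j))"
    using assms by (intro order.trans[OF norm_sum] sum_mono) (auto simp: norm_mult mult_right_mono)
  then have "(cmod (\<Sum>j\<in>A. a j * b j))\<^sup>2 \<le> (K * (\<Sum>j\<in>A. cmod (b j)))\<^sup>2"
    by (intro power_mono) (auto simp: sum_distrib_left)
  also have "\<dots> \<le> K\<^sup>2 * ((\<Sum>j\<in>A. 1\<^sup>2) * (\<Sum>j\<in>A. (cmod (b j))\<^sup>2))"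
    using Cauchy_Schwarz_ineq_sum[of "\<lambda>_. 1" "\<lambda>j. cmod (b j)" A]
    by (simp add: power_mult_distrib mult_left_mono)
  finally show ?thesis by (simp add: mult_ac)
qed

lemma triangular_bounded_above:
  fixes K :: real and n N :: nat
  assumes "n \<le> N" and K: "\<And>m j. m < n \<Longrightarrow> j < n \<Longrightarrow> cmod (A m j) \<le> K"
  shows "(\<Sum>m<n. (cmod (\<Sum>j=m..<n. A m j * x j))\<^sup>2) \<le> (N * K)\<^sup>2 * (\<Sum>j<n. (cmod (x j))\<^sup>2)"
proof -
  have "(cmod (\<Sum>j=m..<n. A m j * x j))\<^sup>2 \<le> N * K\<^sup>2 * (\<Sum>j<n. (cmod (x j))\<^sup>2)" if "m < n" for m
  proof -
    have "(cmod (\<Sum>j=m..<n. A m j * x j))\<^sup>2 \<le> card {m..<n} * K\<^sup>2 * (\<Sum>j=m..<n. (cmod (x j))\<^sup>2)"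
      by (rule norm_sum_sq_le[of "{m..<n}" "A m" K x]) (auto intro: K that)
    also have "\<dots> \<le> N * K\<^sup>2 * (\<Sum>j<n. (cmod (x j))\<^sup>2)"
      using assms(1) by (intro mult_mono sum_mono2) (auto intro!: sum_nonneg)
    finally show ?thesis .
  qed
  then have "(\<Sum>m<n. (cmod (\<Sum>j=m..<n. A m j * x j))\<^sup>2) \<le> (\<Sum>m<n. N * K\<^sup>2 * (\<Sum>j<n. (cmod (x j))\<^sup>2))"
    by (intro sum_mono) auto
  also have "\<dots> = n * (N * K\<^sup>2 * (\<Sum>j<n. (cmod (x j))\<^sup>2))" by simp
  also have "\<dots> \<le> N * (N * K\<^sup>2 * (\<Sum>j<n. (cmod (x j))\<^sup>2))"
    using assms(1) by (intro mult_right_mono) (auto intro!: sum_nonneg mult_nonneg_nonneg)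
  finally show ?thesis by (simp add: power2_eq_square mult_ac)
qed

section \<open>Riesz bounds for finitely many blocks\<close>

text \<open>The pseudohyperbolic distance.\<close>

definition pseudohyp :: "complex \<Rightarrow> complex \<Rightarrow> real" where
  "pseudohyp a b = cmod ((a - b) / (1 - cnj a * b))"

text \<open>Up to a constant, a bound for the inner products of unit vectors from blocks with defects \<open>x\<close> and
\<open>y\<close>.\<close>

definition ratio :: "real \<Rightarrow> real \<Rightarrow> real" where
  "ratio x y = sqrt (min x y / max x y)"

lemma ratio_sym: "ratio x y = ratio y x"
  by (simp add: ratio_def min.commute max.commute)

lemma ratio_nonneg: "0 < x \<Longrightarrow> 0 < y \<Longrightarrow> 0 \<le> ratio x y"
  by (simp add: ratio_def min_def max_def)

lemma ratio_self: "0 < x \<Longrightarrow> ratio x x = 1"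
  by (simp add: ratio_def)

lemma pseudohyp_nonneg: "0 \<le> pseudohyp a b"
  by (simp add: pseudohyp_def)

lemma denominator_nonzero:
  assumes "cmod a < 1" "cmod b < 1" shows "0 < 1 - cmod a * cmod b" "1 - cmod a * cmod b \<le> cmod (1 - cnj a * b)"
proof -
  show "0 < 1 - cmod a * cmod b"
    using assms mult_strict_mono[of "cmod a" 1 "cmod b" 1] by simp
  show "1 - cmod a * cmod b \<le> cmod (1 - cnj a * b)"
    using norm_triangle_ineq2[of 1 "cnj a * b"] by (simp add: norm_mult)
qed

text \<open>The standard identity that turns products of distances into sums over defects.\<close>

lemma pseudohyp_sq:
  assumes "cmod a < 1" "cmod b < 1"
  shows "1 - (pseudohyp a b)\<^sup>2 = defect a * defect b / (cmod (1 - cnj a * b))\<^sup>2"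
proof -
  have "0 < cmod (1 - cnj a * b)" using denominator_nonzero[OF assms] by linarith
  moreover have "(cmod (1 - cnj a * b))\<^sup>2 - (cmod (a - b))\<^sup>2 = defect a * defect b"
  proof -
    have "complex_of_real ((cmod (1 - cnj a * b))\<^sup>2 - (cmod (a - b))\<^sup>2)
        = complex_of_real (defect a * defect b)"
      unfolding defect_def of_real_diff of_real_mult of_real_1 complex_norm_square
      by (simp add: algebra_simps)
    then show ?thesis using of_real_eq_iff by blast
  qed
  ultimately show ?thesis
    by (simp add: pseudohyp_def norm_divide power_divide diff_divide_eq_iff flip: diff_divide_distrib)
qed

lemma pseudohyp_le_1:
  assumes "cmod a < 1" "cmod b < 1" shows "pseudohyp a b \<le> 1"
proof -
  have "0 \<le> 1 - (pseudohyp a b)\<^sup>2"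
    unfolding pseudohyp_sq[OF assms] using defect_pos[OF assms(1)] defect_pos[OF assms(2)] by simp
  then show ?thesis using abs_square_le_1[of "pseudohyp a b"] by simp
qed

lemma gram_le_ratio:
  assumes "wiener f" "wiener g" "0 < a" "0 < b"
    and "cmod (ip f g) \<le> B * sqrt (b / a)" "cmod (ip g f) \<le> B * sqrt (a / b)"
  shows "cmod (ip f g) \<le> B * ratio a b"
proof -
  have "cmod (ip f g) = cmod (ip g f)"
    using ip_cnj[OF assms(1,2)] complex_mod_cnj by metis
  then show ?thesis using assms by (auto simp: ratio_def min_def max_def)
qed

text \<open>The sum norm of the first vector is of order \<open>(defect w) powr (-1/2)\<close>, the sup norm of the second
of order \<open>sqrt (defect v)\<close>; exchanging the roles gives the reciprocal ratio, and the smaller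
bound is the claim.\<close>

lemma gram_blockvec:
  assumes "cmod w < 1" "cmod v < 1" "m \<le> N" "p \<le> N"
  shows "cmod (ip (blockvec w m) (blockvec v p)) \<le> 2 * 4 ^ N * ratio (defect w) (defect v)"
proof -
  have d: "0 < defect w" "0 < defect v" using assms by (auto intro: defect_pos)
  have *: "cmod (ip (blockvec w m) (blockvec v p)) \<le> 2 * 4 ^ N * sqrt (defect v / defect w)"
    if "cmod w < 1" "cmod v < 1" "m \<le> N" "p \<le> N" for w v m p
  proof -
    have d: "0 < defect w" "0 < defect v" using that by (auto intro: defect_pos)
    have "cmod (ip (blockvec w m) (blockvec v p)) \<le> l1_norm (blockvec w m) * (2 ^ p * sqrt (defect v))"
      using that by (intro ip_le_l1_sup wiener_blockvec sup_blockvec)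
    also have "\<dots> \<le> (2 ^ m * (2 / sqrt (defect w))) * (2 ^ p * sqrt (defect v))"
      using that d by (intro mult_right_mono l1_norm_blockvec) auto
    also have "\<dots> = (2 ^ m * 2 ^ p) * (2 * sqrt (defect v / defect w))"
      by (simp add: real_sqrt_divide)
    also have "\<dots> \<le> (2 ^ N * 2 ^ N) * (2 * sqrt (defect v / defect w))"
      using that d by (intro mult_right_mono mult_mono power_increasing) auto
    also have "(2::real) ^ N * 2 ^ N = 4 ^ N" by (simp flip: power_mult_distrib)
    finally show ?thesis by simp
  qed
  show ?thesis
    by (rule gram_le_ratio) (use assms d * in \<open>auto intro: wiener_blockvec\<close>)
qed

text \<open>Divisible by all Blaschke factors of the other blocks, hence orthogonal to them; within its own
block the pairing with the chain is triangular.\<close>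

definition dualvec :: "'i set \<Rightarrow> ('i \<Rightarrow> nat) \<Rightarrow> ('i \<Rightarrow> complex) \<Rightarrow> 'i \<Rightarrow> nat \<Rightarrow> complex fps" where
  "dualvec A n w i j = (\<Prod>l\<in>A - {i}. blaschke (w l) ^ n l) * (blaschke (w i) ^ j * ukern (w i))"

context
  fixes A :: "'i set" and n :: "'i \<Rightarrow> nat" and w :: "'i \<Rightarrow> complex" and N :: nat
  assumes fin: "finite A" and w: "\<And>i. i \<in> A \<Longrightarrow> cmod (w i) < 1" and n: "\<And>i. i \<in> A \<Longrightarrow> n i \<le> N"
begin

lemma wiener_dualvec: "i \<in> A \<Longrightarrow> wiener (dualvec A n w i j)"
  unfolding dualvec_def using w
  by (intro wiener_mult wiener_prod wiener_power wiener_blaschke wiener_ukern) auto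

lemma sq_norm_dualvec:
  assumes "i \<in> A" shows "sq_norm (dualvec A n w i j) = 1"
proof -
  have "complex_of_real (sq_norm (dualvec A n w i j)) = ip (dualvec A n w i j) (dualvec A n w i j)"
    using assms by (simp add: ip_self wiener_dualvec)
  also have "\<dots> = ip (blaschke (w i) ^ j * ukern (w i)) (blaschke (w i) ^ j * ukern (w i))"
    unfolding dualvec_def using assms w
    by (intro ip_blaschke_prod wiener_mult wiener_power wiener_blaschke wiener_ukern) auto
  also have "\<dots> = 1"
    using assms w by (simp add: ip_blaschke_power wiener_ukern ip_ukern_self)
  finally show ?thesis by simp
qed

text \<open>The infinite family of Blaschke factors has no bounded sum norm, but all factors common to both
vectors are isometries and cancel. At most \<open>n i + n l\<close> factors remain, each of sum norm at most 3.\<close>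

lemma gram_dualvec:
  assumes "i \<in> A" "l \<in> A" "j < n i" "m < n l"
  shows "cmod (ip (dualvec A n w i j) (dualvec A n w l m)) \<le> 2 * 9 ^ N * ratio (defect (w i)) (defect (w l))"
proof (cases "i = l")
  case True
  have "cmod (ip (dualvec A n w i j) (dualvec A n w l m)) \<le> 1"
    using ip_le_sq_norm[OF wiener_dualvec wiener_dualvec, of i l j m] assms sq_norm_dualvec by simp
  also have "1 \<le> 2 * (9::real) ^ N" using one_le_power[of "9::real" N] by linarith
  finally show ?thesis using True ratio_self[OF defect_pos[OF w[OF assms(1)]]] by simp
next
  case False
  have *: "cmod (ip (dualvec A n w i j) (dualvec A n w l m)) \<le> 2 * 9 ^ N * sqrt (defect (w l) / defect (w i))"
    if il: "i \<in> A" "l \<in> A" "j < n i" "m < n l" "i \<noteq> l" for i l j m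
  proof -
    define P where "P = (\<Prod>q\<in>A - {i} - {l}. blaschke (w q) ^ n q)"
    have d: "0 < defect (w i)" "0 < defect (w l)" using il w by (auto intro: defect_pos)
    have "dualvec A n w i j = (blaschke (w l) ^ n l * P) * (blaschke (w i) ^ j * ukern (w i))"
      unfolding dualvec_def P_def using fin il by (subst prod.remove[of _ l]) auto
    moreover have "blaschke (w l) ^ n l = blaschke (w l) ^ m * blaschke (w l) ^ (n l - m)"
      using il by (simp flip: power_add)
    ultimately have 1: "dualvec A n w i j
        = P * (blaschke (w l) ^ m * (blaschke (w i) ^ j * (blaschke (w l) ^ (n l - m) * ukern (w i))))"
      by (simp only: ac_simps)
    have "A - {l} - {i} = A - {i} - {l}" by blast
    then have "dualvec A n w l m = (blaschke (w i) ^ n i * P) * (blaschke (w l) ^ m * ukern (w l))"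
      unfolding dualvec_def P_def using fin il by (subst prod.remove[of _ i]) auto
    moreover have "blaschke (w i) ^ n i = blaschke (w i) ^ j * blaschke (w i) ^ (n i - j)"
      using il by (simp flip: power_add)
    ultimately have 2: "dualvec A n w l m
        = P * (blaschke (w l) ^ m * (blaschke (w i) ^ j * (blaschke (w i) ^ (n i - j) * ukern (w l))))"
      by (simp only: ac_simps)
    have bi: "wiener (blaschke (w i))" "wiener (blaschke (w l))" "wiener (ukern (w i))" "wiener (ukern (w l))"
      using il w by (auto intro: wiener_blaschke wiener_ukern)
    have "ip (dualvec A n w i j) (dualvec A n w l m)
        = ip (blaschke (w l) ^ (n l - m) * ukern (w i)) (blaschke (w i) ^ (n i - j) * ukern (w l))"
      unfolding 1 2 P_def using il w bi
      by (subst ip_blaschke_prod) (auto simp: ip_blaschke_power wiener_mult wiener_power)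
    also have "cmod \<dots> \<le> l1_norm (blaschke (w l) ^ (n l - m) * ukern (w i)) * (3 ^ (n i - j) * sqrt (defect (w l)))"
    proof (rule ip_le_l1_sup)
      fix k
      have "cmod (fps_nth (blaschke (w i) ^ (n i - j) * ukern (w l)) k)
          \<le> l1_norm (blaschke (w i) ^ (n i - j)) * sqrt (defect (w l))"
        using bi il w by (intro sup_mult_le sup_ukern wiener_power) auto
      also have "\<dots> \<le> 3 ^ (n i - j) * sqrt (defect (w l))"
        using bi il w d by (intro mult_right_mono l1_norm_power l1_norm_blaschke) auto
      finally show "cmod (fps_nth (blaschke (w i) ^ (n i - j) * ukern (w l)) k)
          \<le> 3 ^ (n i - j) * sqrt (defect (w l))" .
    qed (use bi in \<open>auto intro!: wiener_mult wiener_power\<close>)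
    also have "\<dots> \<le> (3 ^ (n l - m) * (2 / sqrt (defect (w i)))) * (3 ^ (n i - j) * sqrt (defect (w l)))"
    proof (intro mult_right_mono)
      have "l1_norm (blaschke (w l) ^ (n l - m) * ukern (w i))
          \<le> l1_norm (blaschke (w l) ^ (n l - m)) * l1_norm (ukern (w i))"
        using bi by (intro wiener_mult wiener_power)
      also have "\<dots> \<le> 3 ^ (n l - m) * (2 / sqrt (defect (w i)))"
        using bi il w
        by (intro mult_mono l1_norm_power l1_norm_blaschke l1_norm_ukern l1_norm_nonneg) auto
      finally show "l1_norm (blaschke (w l) ^ (n l - m) * ukern (w i))
          \<le> 3 ^ (n l - m) * (2 / sqrt (defect (w i)))" .
    qed (use d in auto)
    also have "\<dots> = (3 ^ (n l - m) * 3 ^ (n i - j)) * (2 * sqrt (defect (w l) / defect (w i)))"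
      by (simp add: real_sqrt_divide)
    also have "\<dots> \<le> (3 ^ N * 3 ^ N) * (2 * sqrt (defect (w l) / defect (w i)))"
      using d n[OF il(1)] n[OF il(2)] by (intro mult_right_mono mult_mono power_increasing) auto
    also have "(3::real) ^ N * 3 ^ N = 9 ^ N" by (simp flip: power_mult_distrib)
    finally show ?thesis by simp
  qed
  show ?thesis
    by (rule gram_le_ratio)
       (use assms False *[of i l j m] *[of l i m j] w in \<open>auto intro: wiener_dualvec defect_pos\<close>)
qed

lemma ip_blockvec_dualvec_other:
  assumes "i \<in> A" "l \<in> A" "i \<noteq> l" "m < n l"
  shows "ip (blockvec (w l) m) (dualvec A n w i j) = 0"
proof -
  have "dualvec A n w i j = blaschke (w l) ^ n l *
      ((\<Prod>q\<in>A - {i} - {l}. blaschke (w q) ^ n q) * (blaschke (w i) ^ j * ukern (w i)))"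
    unfolding dualvec_def using fin assms by (subst prod.remove[of _ l]) (auto simp: mult.assoc)
  moreover have "wiener ((\<Prod>q\<in>A - {i} - {l}. blaschke (w q) ^ n q) * (blaschke (w i) ^ j * ukern (w i)))"
    using assms w by (intro wiener_mult wiener_prod wiener_power wiener_blaschke wiener_ukern) auto
  ultimately show ?thesis using assms w by (simp only: ip_blockvec_zero)
qed

lemma ip_blockvec_dualvec_below:
  assumes "i \<in> A" "m < j"
  shows "ip (blockvec (w i) m) (dualvec A n w i j) = 0"
proof -
  have "dualvec A n w i j = blaschke (w i) ^ j * ((\<Prod>q\<in>A - {i}. blaschke (w q) ^ n q) * ukern (w i))"
    unfolding dualvec_def by (simp only: ac_simps)
  moreover have "wiener ((\<Prod>q\<in>A - {i}. blaschke (w q) ^ n q) * ukern (w i))"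
    using assms w by (intro wiener_mult wiener_prod wiener_power wiener_blaschke wiener_ukern) auto
  ultimately show ?thesis using assms w by (simp only: ip_blockvec_zero)
qed

text \<open>Here the Carleson product enters: the pairing is the value of the product of the other Blaschke
factors at \<open>cnj (w i)\<close>.\<close>

lemma ip_blockvec_dualvec_diag:
  assumes "i \<in> A"
  shows "cmod (ip (blockvec (w i) j) (dualvec A n w i j)) = (\<Prod>l\<in>A - {i}. pseudohyp (w i) (w l) ^ n l)"
proof -
  let ?P = "\<Prod>q\<in>A - {i}. blaschke (w q) ^ n q"
  have P: "wiener ?P" using w by (intro wiener_prod wiener_power wiener_blaschke) auto
  have "dualvec A n w i j = blaschke (w i) ^ j * (?P * ukern (w i))"
    unfolding dualvec_def by (simp only: ac_simps)
  then have "ip (blockvec (w i) j) (dualvec A n w i j) = ip (ukern (w i)) (?P * ukern (w i))"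
    using assms w P by (simp only: ip_blockvec_diag wiener_mult wiener_ukern)
  also have "\<dots> = cnj (evalp (cnj (w i)) ?P)" using w[OF assms] P by (rule ip_ukern_mult)
  also have "evalp (cnj (w i)) ?P = (\<Prod>q\<in>A - {i}. ((cnj (w i) - cnj (w q)) / (1 - w q * cnj (w i))) ^ n q)"
    using w[OF assms]
    by (subst evalp_prod)
       (auto intro!: prod.cong wiener_power wiener_blaschke w simp: evalp_power evalp_blaschke wiener_blaschke w)
  finally have "cmod (ip (blockvec (w i) j) (dualvec A n w i j))
      = (\<Prod>q\<in>A - {i}. cmod ((cnj (w i) - cnj (w q)) / (1 - w q * cnj (w i))) ^ n q)"
    by (simp only: complex_mod_cnj prod_norm[symmetric] norm_power)
  moreover have "cmod ((cnj (w i) - cnj (w q)) / (1 - w q * cnj (w i))) = pseudohyp (w i) (w q)" for q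
    unfolding pseudohyp_def norm_divide mult.commute[of "w q"]
    by (metis complex_cnj_diff complex_mod_cnj)
  ultimately show ?thesis by simp
qed

context
  fixes C :: real
  assumes row: "\<And>i. i \<in> A \<Longrightarrow> (\<Sum>l\<in>A. ratio (defect (w i)) (defect (w l))) \<le> C"
begin

lemma row_Sigma:
  assumes "i \<in> A" "0 \<le> K"
  shows "(\<Sum>(l, p)\<in>Sigma A (\<lambda>l. {..<n l}). K * ratio (defect (w i)) (defect (w l))) \<le> K * N * C"
proof -
  have r: "0 \<le> ratio (defect (w i)) (defect (w l))" if "l \<in> A" for l
    using ratio_nonneg[OF defect_pos defect_pos] w[OF assms(1)] w[OF that] by simp
  have "(\<Sum>(l, p)\<in>Sigma A (\<lambda>l. {..<n l}). K * ratio (defect (w i)) (defect (w l)))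
      = (\<Sum>l\<in>A. real (n l) * (K * ratio (defect (w i)) (defect (w l))))"
    using fin by (subst sum.Sigma[symmetric]) auto
  also have "\<dots> \<le> (\<Sum>l\<in>A. N * (K * ratio (defect (w i)) (defect (w l))))"
    using n r assms(2) by (intro sum_mono mult_right_mono) auto
  also have "\<dots> = K * N * (\<Sum>l\<in>A. ratio (defect (w i)) (defect (w l)))"
    by (simp add: sum_distrib_left mult_ac)
  also have "\<dots> \<le> K * N * C" using assms by (intro mult_left_mono row) auto
  finally show ?thesis .
qed

lemma blocks_upper:
  "sq_norm (\<Sum>i\<in>A. \<Sum>m<n i. fps_const (d i m) * blockvec (w i) m)
     \<le> 2 * 4 ^ N * real N * C * (\<Sum>i\<in>A. \<Sum>m<n i. (cmod (d i m))\<^sup>2)"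
proof -
  let ?Q = "Sigma A (\<lambda>l. {..<n l})"
  have "sq_norm (\<Sum>a\<in>?Q. fps_const (case a of (i, m) \<Rightarrow> d i m) * (case a of (i, m) \<Rightarrow> blockvec (w i) m))
      \<le> 2 * 4 ^ N * real N * C * (\<Sum>a\<in>?Q. (cmod (case a of (i, m) \<Rightarrow> d i m))\<^sup>2)"
  proof (rule schur_synthesis[where m="\<lambda>a b. 2 * 4 ^ N * ratio (defect (w (fst a))) (defect (w (fst b)))"])
    show "finite ?Q" using fin by auto
    show "(\<Sum>b\<in>?Q. 2 * 4 ^ N * ratio (defect (w (fst a))) (defect (w (fst b)))) \<le> 2 * 4 ^ N * real N * C"
      if "a \<in> ?Q" for a
      using that row_Sigma[of "fst a" "2 * 4 ^ N"] by (auto simp: case_prod_beta)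
    show "cmod (ip (case a of (i, m) \<Rightarrow> blockvec (w i) m) (case b of (i, m) \<Rightarrow> blockvec (w i) m))
        \<le> 2 * 4 ^ N * ratio (defect (w (fst a))) (defect (w (fst b)))"
      if "a \<in> ?Q" "b \<in> ?Q" for a b
      using that n[of "fst a"] n[of "fst b"] by (auto intro!: gram_blockvec w)
  qed (use w in \<open>auto simp: ratio_sym intro: wiener_blockvec\<close>)
  then show ?thesis
    using fin by (simp add: sum.Sigma case_prod_beta)
qed

lemma dual_bessel:
  assumes "wiener F" "0 < N" "0 < C"
  shows "(\<Sum>i\<in>A. \<Sum>j<n i. (cmod (ip F (dualvec A n w i j)))\<^sup>2) \<le> 2 * 9 ^ N * real N * C * sq_norm F"
proof -
  let ?Q = "Sigma A (\<lambda>l. {..<n l})"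
  have "(\<Sum>a\<in>?Q. (cmod (ip F (case a of (i, j) \<Rightarrow> dualvec A n w i j)))\<^sup>2) \<le> 2 * 9 ^ N * real N * C * sq_norm F"
  proof (rule schur_analysis[where m="\<lambda>a b. 2 * 9 ^ N * ratio (defect (w (fst a))) (defect (w (fst b)))"])
    show "finite ?Q" using fin by auto
    show "(\<Sum>b\<in>?Q. 2 * 9 ^ N * ratio (defect (w (fst a))) (defect (w (fst b)))) \<le> 2 * 9 ^ N * real N * C"
      if "a \<in> ?Q" for a
      using that row_Sigma[of "fst a" "2 * 9 ^ N"] by (auto simp: case_prod_beta)
    show "cmod (ip (case a of (i, m) \<Rightarrow> dualvec A n w i m) (case b of (i, m) \<Rightarrow> dualvec A n w i m))
        \<le> 2 * 9 ^ N * ratio (defect (w (fst a))) (defect (w (fst b)))"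
      if "a \<in> ?Q" "b \<in> ?Q" for a b
      using that by (auto intro!: gram_dualvec)
  qed (use assms in \<open>auto simp: ratio_sym intro: wiener_dualvec\<close>)
  then show ?thesis
    using fin by (simp add: sum.Sigma case_prod_beta)
qed

end

end

text \<open>Pairing \<open>F\<close> with the dual vectors of block \<open>i\<close> sees only the coefficients of that block, through
a triangular matrix whose diagonal is at least \<open>(min 1 \<delta>) ^ N\<close>. Inverting it block by block and summing the
squares costs one application of the Bessel bound for the dual system.\<close>

lemma blocks_lower:
  fixes C \<delta> :: real
  assumes "0 < N" "0 < C" "0 < \<delta>"
  shows "\<exists>B>0. \<forall>A n w d. finite A \<longrightarrow> (\<forall>i\<in>A. cmod (w i) < 1 \<and> n i \<le> N) \<longrightarrow>
    (\<forall>i\<in>A. (\<Sum>l\<in>A. ratio (defect (w i)) (defect (w l))) \<le> C) \<longrightarrow>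
    (\<forall>i\<in>A. \<delta> \<le> (\<Prod>l\<in>A - {i::'i}. pseudohyp (w i) (w l))) \<longrightarrow>
    (\<Sum>i\<in>A. \<Sum>m<n i. (cmod (d i m))\<^sup>2)
      \<le> B * sq_norm (\<Sum>i\<in>A. \<Sum>m<n i. fps_const (d i m) * blockvec (w i) m)"
proof -
  define \<eta> where "\<eta> = (min 1 \<delta>) ^ N"
  have \<eta>: "0 < \<eta>" using assms by (simp add: \<eta>_def)
  obtain T where T: "T > 0" and tri: "\<And>n (M :: nat \<Rightarrow> nat \<Rightarrow> complex) x. n \<le> N \<Longrightarrow>
    (\<forall>m<n. \<forall>j<n. cmod (M m j) \<le> 2 * 4 ^ N + 1) \<Longrightarrow> (\<forall>m<n. \<eta> \<le> cmod (M m m)) \<Longrightarrow>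
    (\<Sum>j<n. (cmod (x j))\<^sup>2) \<le> T * (\<Sum>m<n. (cmod (\<Sum>j=m..<n. M m j * x j))\<^sup>2)"
    using triangular_bounded_below[of "2 * 4 ^ N + 1" \<eta> N] \<eta> by force
  have main: "(\<Sum>i\<in>A. \<Sum>m<n i. (cmod (d i m))\<^sup>2)
      \<le> (T * (2 * 9 ^ N * real N * C)) * sq_norm (\<Sum>i\<in>A. \<Sum>m<n i. fps_const (d i m) * blockvec (w i) m)"
    if A: "finite A" and w: "\<And>i. i \<in> A \<Longrightarrow> cmod (w i) < 1" and n: "\<And>i. i \<in> A \<Longrightarrow> n i \<le> N"
      and row: "\<And>i. i \<in> A \<Longrightarrow> (\<Sum>l\<in>A. ratio (defect (w i)) (defect (w l))) \<le> C"
      and \<delta>: "\<And>i. i \<in> A \<Longrightarrow> \<delta> \<le> (\<Prod>l\<in>A - {i}. pseudohyp (w i) (w l))"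
    for A :: "'i set" and n w d
  proof -
    define F where "F = (\<Sum>i\<in>A. \<Sum>m<n i. fps_const (d i m) * blockvec (w i) m)"
    have F: "wiener F"
      unfolding F_def using w by (intro wiener_sum wiener_scale wiener_blockvec)
    have ipF: "ip F (dualvec A n w i j) = (\<Sum>m=j..<n i. ip (blockvec (w i) m) (dualvec A n w i j) * d i m)"
      if i: "i \<in> A" for i j
    proof -
      have W: "wiener (dualvec A n w i j)" using wiener_dualvec[OF A w n i] .
      have "ip F (dualvec A n w i j)
          = (\<Sum>a\<in>Sigma A (\<lambda>l. {..<n l}). d (fst a) (snd a) * ip (blockvec (w (fst a)) (snd a)) (dualvec A n w i j))"
        unfolding F_def using A w W
        by (subst ip_sum_left[symmetric]) (auto simp: sum.Sigma case_prod_beta intro: wiener_blockvec)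
      also have "\<dots> = (\<Sum>l\<in>A. \<Sum>m<n l. d l m * ip (blockvec (w l) m) (dualvec A n w i j))"
        using A by (simp add: sum.Sigma case_prod_beta)
      also have "\<dots> = (\<Sum>l\<in>{i}. \<Sum>m<n l. d l m * ip (blockvec (w l) m) (dualvec A n w i j))"
      proof (intro sum.mono_neutral_right ballI sum.neutral)
        fix l m assume lm: "l \<in> A - {i}" "m \<in> {..<n l}"
        have "ip (blockvec (w l) m) (dualvec A n w i j) = 0"
          by (rule ip_blockvec_dualvec_other[where N=N]) (use A w n i lm in auto)
        then show "d l m * ip (blockvec (w l) m) (dualvec A n w i j) = 0" by simp
      qed (use A i in auto)
      also have "\<dots> = (\<Sum>m<n i. d i m * ip (blockvec (w i) m) (dualvec A n w i j))" by simp
      also have "\<dots> = (\<Sum>m=j..<n i. d i m * ip (blockvec (w i) m) (dualvec A n w i j))"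
      proof (intro sum.mono_neutral_right ballI)
        fix m assume m: "m \<in> {..<n i} - {j..<n i}"
        have "ip (blockvec (w i) m) (dualvec A n w i j) = 0"
          by (rule ip_blockvec_dualvec_below[where N=N]) (use A w n i m in auto)
        then show "d i m * ip (blockvec (w i) m) (dualvec A n w i j) = 0" by simp
      qed auto
      finally show ?thesis by (simp add: mult.commute)
    qed
    have "(\<Sum>m<n i. (cmod (d i m))\<^sup>2) \<le> T * (\<Sum>j<n i. (cmod (ip F (dualvec A n w i j)))\<^sup>2)" if i: "i \<in> A" for i
      unfolding ipF[OF i]
    proof (rule tri[OF n[OF i]]; intro allI impI)
      fix j m
      have "cmod (ip (blockvec (w i) m) (dualvec A n w i j)) \<le> 2 * 4 ^ N + 1" if "m < n i"
      proof -
        have b: "wiener (blockvec (w i) m)" using w[OF i] by (rule wiener_blockvec)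
        have "cmod (ip (blockvec (w i) m) (blockvec (w i) m)) \<le> 2 * 4 ^ N"
          using gram_blockvec[of "w i" "w i" m N m] w[OF i] n[OF i] that ratio_self[OF defect_pos[OF w[OF i]]]
          by simp
        then have "sq_norm (blockvec (w i) m) \<le> 2 * 4 ^ N"
          using sq_norm_nonneg[OF b] unfolding ip_self[OF b] by simp
        moreover have "cmod (ip (blockvec (w i) m) (dualvec A n w i j))
            \<le> (sq_norm (blockvec (w i) m) + sq_norm (dualvec A n w i j)) / 2"
          using i A w n b by (intro ip_le_sq_norm wiener_dualvec)
        moreover have "sq_norm (dualvec A n w i j) = 1"
          by (rule sq_norm_dualvec[where N=N]) (use A w n i in auto)
        ultimately show ?thesis using sq_norm_nonneg[OF b] by simp
      qed
      then show "m < n i \<Longrightarrow> cmod (ip (blockvec (w i) m) (dualvec A n w i j)) \<le> 2 * 4 ^ N + 1" .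
    next
      fix j assume "j < n i"
      have p1: "pseudohyp (w i) (w l) \<le> 1" if "l \<in> A" for l using w[OF i] w[OF that] by (rule pseudohyp_le_1)
      have "\<eta> \<le> (\<Prod>l\<in>A - {i}. pseudohyp (w i) (w l)) ^ N"
        unfolding \<eta>_def using \<delta>[OF i] assms by (intro power_mono) auto
      also have "\<dots> = (\<Prod>l\<in>A - {i}. pseudohyp (w i) (w l) ^ N)" by (simp add: prod_power_distrib)
      also have "\<dots> \<le> (\<Prod>l\<in>A - {i}. pseudohyp (w i) (w l) ^ n l)"
        using n p1 by (intro prod_mono) (auto simp: pseudohyp_nonneg intro!: power_decreasing)
      also have "\<dots> = cmod (ip (blockvec (w i) j) (dualvec A n w i j))"
        by (rule ip_blockvec_dualvec_diag[where N=N, symmetric]) (use A w n i in auto)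
      finally show "\<eta> \<le> cmod (ip (blockvec (w i) j) (dualvec A n w i j))" .
    qed
    then have "(\<Sum>i\<in>A. \<Sum>m<n i. (cmod (d i m))\<^sup>2)
        \<le> (\<Sum>i\<in>A. T * (\<Sum>j<n i. (cmod (ip F (dualvec A n w i j)))\<^sup>2))" by (rule sum_mono)
    also have "\<dots> = T * (\<Sum>i\<in>A. \<Sum>j<n i. (cmod (ip F (dualvec A n w i j)))\<^sup>2)"
      by (simp add: sum_distrib_left)
    also have "\<dots> \<le> T * (2 * 9 ^ N * real N * C * sq_norm F)"
      using T dual_bessel[OF A w n row F assms(1,2)] by (intro mult_left_mono) auto
    finally show ?thesis by (simp add: F_def mult.assoc)
  qed
  have "0 < T * (2 * 9 ^ N * real N * C)" using T assms by simp
  then show ?thesis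
    by (intro exI[of _ "T * (2 * 9 ^ N * real N * C)"] conjI allI impI main) blast+
qed

section \<open>Carleson sequences on a radius\<close>

lemma prod_antimono:
  fixes f :: "'a \<Rightarrow> real"
  assumes "finite B" "A \<subseteq> B" "\<And>x. x \<in> B \<Longrightarrow> 0 \<le> f x" "\<And>x. x \<in> B \<Longrightarrow> f x \<le> 1"
  shows "prod f B \<le> prod f A"
proof -
  have "prod f B = prod f (B - A) * prod f A" using assms(1,2) by (intro prod.subset_diff)
  also have "\<dots> \<le> 1 * prod f A"
    using assms by (intro mult_right_mono prod_le_1 prod_nonneg) auto
  finally show ?thesis by simp
qed

text \<open>The partial products decrease, and omitting factors in \<open>[0, 1]\<close> increases a product.\<close>

lemma carleson_prod_bound:
  assumes "carleson_sequence z"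
  shows "\<exists>\<delta>>0. \<forall>k A. finite A \<longrightarrow> k \<notin> A \<longrightarrow> \<delta> \<le> (\<Prod>j\<in>A. pseudohyp (z j) (z k))"
proof -
  let ?p = "\<lambda>k N. \<Prod>j\<in>{..<N} - {k}. pseudohyp (z j) (z k)"
  let ?\<delta> = "INF k. lim (?p k)"
  have z: "cmod (z j) < 1" for j using assms by (simp add: carleson_sequence_def)
  have pos: "0 < ?\<delta>" using assms by (simp add: carleson_sequence_def pseudohyp_def)
  have f: "0 \<le> pseudohyp (z j) (z k)" "pseudohyp (z j) (z k) \<le> 1" for j k
    using pseudohyp_nonneg pseudohyp_le_1[OF z z] by auto
  have dec: "decseq (?p k)" for k
    unfolding decseq_def using f by (auto intro!: prod_antimono)
  have nn: "0 \<le> ?p k N" for k N using f by (simp add: prod_nonneg)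
  obtain L where L: "\<And>k. ?p k \<longlonglongrightarrow> L k" "\<And>k N. L k \<le> ?p k N"
  proof -
    have "\<exists>L. ?p k \<longlonglongrightarrow> L \<and> (\<forall>N. L \<le> ?p k N)" for k
      using decseq_convergent[OF dec[of k], of 0] nn by blast
    then show ?thesis using that by metis
  qed
  have lim: "lim (?p k) = L k" for k using L(1) by (rule limI)
  have L0: "0 \<le> L k" for k using LIMSEQ_le_const[OF L(1)] nn by blast
  have "?\<delta> \<le> (\<Prod>j\<in>A. pseudohyp (z j) (z k))" if A: "finite A" "k \<notin> A" for A k
  proof -
    obtain N where N: "A \<subseteq> {..<N}" using A finite_nat_iff_bounded by blast
    have "?\<delta> \<le> L k"
      unfolding lim using L0 by (intro cINF_lower bdd_belowI[of _ 0]) auto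
    also have "\<dots> \<le> ?p k N" by (rule L(2))
    also have "\<dots> \<le> (\<Prod>j\<in>A. pseudohyp (z j) (z k))"
      using N A f by (intro prod_antimono) auto
    finally show ?thesis .
  qed
  then show ?thesis using pos by blast
qed

lemma sum_defect_le_log:
  fixes x :: "'a \<Rightarrow> real"
  assumes "finite A" "0 < \<delta>" "\<delta> \<le> (\<Prod>j\<in>A. x j)" "\<And>j. j \<in> A \<Longrightarrow> 0 \<le> x j"
  shows "(\<Sum>j\<in>A. 1 - (x j)\<^sup>2) \<le> - 2 * ln \<delta>"
proof -
  have pos: "0 < x j" if "j \<in> A" for j
    using assms that by (metis less_le less_le_trans prod_zero_iff)
  have "1 - (x j)\<^sup>2 \<le> - 2 * ln (x j)" if "j \<in> A" for j
    using ln_le_minus_one[of "(x j)\<^sup>2"] pos[OF that] by (simp add: ln_realpow)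
  then have "(\<Sum>j\<in>A. 1 - (x j)\<^sup>2) \<le> (\<Sum>j\<in>A. - 2 * ln (x j))" by (rule sum_mono)
  also have "\<dots> = - 2 * ln (\<Prod>j\<in>A. x j)"
    using pos assms(1) by (subst ln_prod) (force simp: sum_distrib_left)+
  also have "\<dots> \<le> - 2 * ln \<delta>" using assms(2,3) by simp
  finally show ?thesis .
qed

text \<open>A converse of \<open>sum_defect_le_log\<close> for factors that stay away from zero: on \<open>[\<eta>, 1]\<close> one has
\<open>ln x \<ge> - (1 - x) / \<eta>\<close>.\<close>

lemma prod_bounded_below:
  fixes x :: "'a \<Rightarrow> real"
  assumes "finite A" "0 < \<eta>" "\<And>j. j \<in> A \<Longrightarrow> \<eta> \<le> x j" "\<And>j. j \<in> A \<Longrightarrow> x j \<le> 1"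
    and "(\<Sum>j\<in>A. 1 - x j) \<le> C"
  shows "exp (- C / \<eta>) \<le> (\<Prod>j\<in>A. x j)"
proof -
  have "exp (- C / \<eta>) \<le> exp (\<Sum>j\<in>A. - (1 - x j) / \<eta>)"
  proof -
    have "(\<Sum>j\<in>A. - (1 - x j) / \<eta>) = - ((\<Sum>j\<in>A. 1 - x j) / \<eta>)"
      by (simp only: sum_divide_distrib minus_divide_left[symmetric] sum_negf)
    then show ?thesis using assms(2,5) by (simp add: divide_right_mono)
  qed
  also have "\<dots> = (\<Prod>j\<in>A. exp (- (1 - x j) / \<eta>))" using assms(1) by (rule exp_sum)
  also have "\<dots> \<le> (\<Prod>j\<in>A. x j)"
  proof (intro prod_mono conjI)
    fix j assume j: "j \<in> A"
    have x: "0 < x j" using assms(2) assms(3)[OF j] by linarith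
    have "(1 - x j) / x j \<le> (1 - x j) / \<eta>"
      using assms(2) assms(3)[OF j] assms(4)[OF j] by (intro divide_left_mono) auto
    moreover have "- ln (x j) \<le> (1 - x j) / x j"
    proof -
      have "- ln (x j) = ln (inverse (x j))" using x by (simp add: ln_inverse)
      also have "\<dots> \<le> inverse (x j) - 1" using x by (intro ln_le_minus_one) simp
      also have "\<dots> = (1 - x j) / x j" using x by (simp add: field_simps)
      finally show ?thesis .
    qed
    ultimately have "- (1 - x j) / \<eta> \<le> ln (x j)"
      unfolding minus_divide_left[symmetric] by linarith
    then show "exp (- (1 - x j) / \<eta>) \<le> x j" using x by (simp add: ln_ge_iff)
  qed auto
  finally show ?thesis .
qed

text \<open>If, up to the constant \<open>C\<close>, every element dominates the sum of those not
exceeding it, the family is lacunary and its square roots are summable. Remove the largest element \<open>x\<^sub>m\<close> from the total \<open>T\<close>: \<open>sqrt T - sqrt (T - x\<^sub>m)\<close> is at least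
\<open>x\<^sub>m / (2 sqrt T)\<close>, hence at least \<open>sqrt x\<^sub>m / (2 sqrt C)\<close>, so the bound telescopes.\<close>

lemma sum_sqrt_le:
  fixes x :: "'a \<Rightarrow> real"
  assumes "finite A" "\<And>i. i \<in> A \<Longrightarrow> 0 < x i"
    and "\<And>i. i \<in> A \<Longrightarrow> (\<Sum>l\<in>{l\<in>A. x l \<le> x i}. x l) \<le> C * x i"
  shows "(\<Sum>i\<in>A. sqrt (x i)) \<le> 2 * sqrt C * sqrt (\<Sum>i\<in>A. x i)"
  using assms
proof (induction A rule: finite_ranking_induct[where f=x])
  case empty
  then show ?case by simp
next
  case (insert m S)
  let ?T = "\<Sum>i\<in>insert m S. x i" and ?T' = "\<Sum>i\<in>S. x i"
  show ?case
  proof (cases "m \<in> S")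
    case True
    then show ?thesis using insert by (simp add: insert_absorb)
  next
    case False
    have xm: "0 < x m" using insert.prems by simp
    have T: "?T = x m + ?T'" using False insert.hyps by simp
    have T'0: "0 \<le> ?T'" using insert.prems by (intro sum_nonneg less_imp_le) auto
    have "(\<Sum>l\<in>{l \<in> S. x l \<le> x i}. x l) \<le> C * x i" if "i \<in> S" for i
    proof -
      have "(\<Sum>l\<in>{l \<in> S. x l \<le> x i}. x l) \<le> (\<Sum>l\<in>{l \<in> insert m S. x l \<le> x i}. x l)"
        using insert by (intro sum_mono2) (auto intro: less_imp_le)
      then show ?thesis using insert.prems(2)[of i] that by simp
    qed
    then have IH: "(\<Sum>i\<in>S. sqrt (x i)) \<le> 2 * sqrt C * sqrt ?T'"
      using insert by simp
    have "{l \<in> insert m S. x l \<le> x m} = insert m S" using insert.hyps by auto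
    then have TC: "?T \<le> C * x m" using insert.prems(2)[of m] by simp
    have "x m = (sqrt ?T - sqrt ?T') * (sqrt ?T + sqrt ?T')"
      using T T'0 xm by (simp add: algebra_simps)
    also have "\<dots> \<le> (sqrt ?T - sqrt ?T') * (2 * (sqrt C * sqrt (x m)))"
    proof (rule mult_left_mono)
      have "sqrt ?T' \<le> sqrt ?T" using T xm by simp
      moreover have "sqrt ?T \<le> sqrt C * sqrt (x m)"
        using TC by (simp flip: real_sqrt_mult)
      ultimately show "sqrt ?T + sqrt ?T' \<le> 2 * (sqrt C * sqrt (x m))" by linarith
    qed (use T xm in simp)
    finally have "sqrt (x m) * sqrt (x m) \<le> (2 * sqrt C * (sqrt ?T - sqrt ?T')) * sqrt (x m)"
      using xm by (simp add: mult_ac)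
    then have "sqrt (x m) \<le> 2 * sqrt C * (sqrt ?T - sqrt ?T')"
      using xm by (simp only: mult_le_cancel_right_pos real_sqrt_gt_0_iff)
    then have "sqrt (x m) + (\<Sum>i\<in>S. sqrt (x i)) \<le> 2 * sqrt C * sqrt ?T"
      using IH by (simp add: algebra_simps)
    then show ?thesis using False insert.hyps by simp
  qed
qed

lemma sum_ratio_below:
  fixes x :: "'a \<Rightarrow> real"
  assumes A: "finite A" and x: "\<And>i. i \<in> A \<Longrightarrow> 0 < x i"
    and C: "\<And>i. i \<in> A \<Longrightarrow> (\<Sum>l\<in>A. min (x i) (x l) / max (x i) (x l)) \<le> C"
    and i: "i \<in> A"
  shows "(\<Sum>l\<in>{l\<in>A. x l \<le> x i}. ratio (x i) (x l)) \<le> 2 * C"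
proof -
  have small: "(\<Sum>l\<in>{l\<in>A. x l \<le> x i}. x l) \<le> C * x i" if i: "i \<in> A" for i
  proof -
    have "(\<Sum>l\<in>{l\<in>A. x l \<le> x i}. x l / x i) = (\<Sum>l\<in>{l\<in>A. x l \<le> x i}. min (x i) (x l) / max (x i) (x l))"
      by (intro sum.cong) (auto simp: min_def max_def)
    also have "\<dots> \<le> (\<Sum>l\<in>A. min (x i) (x l) / max (x i) (x l))"
      using A x i by (intro sum_mono2) (auto intro!: divide_nonneg_nonneg simp: less_imp_le min_def max_def)
    also have "\<dots> \<le> C" by (rule C[OF i])
    finally show ?thesis using x[OF i] by (simp add: sum_divide_distrib[symmetric] field_simps)
  qed
  let ?A = "{l\<in>A. x l \<le> x i}"
  have C0: "0 \<le> C"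
  proof -
    have "0 \<le> (\<Sum>l\<in>A. min (x i) (x l) / max (x i) (x l))"
      using x i by (intro sum_nonneg) (auto intro!: divide_nonneg_nonneg simp: less_imp_le min_def max_def)
    then show ?thesis using C[OF i] by linarith
  qed
  have "(\<Sum>l\<in>?A. ratio (x i) (x l)) = (\<Sum>l\<in>?A. sqrt (x l)) / sqrt (x i)"
    unfolding sum_divide_distrib
    by (intro sum.cong) (auto simp: ratio_def min_def max_def real_sqrt_divide)
  also have "\<dots> \<le> (2 * sqrt C * sqrt (\<Sum>l\<in>?A. x l)) / sqrt (x i)"
  proof (intro divide_right_mono sum_sqrt_le)
    fix k assume k: "k \<in> ?A"
    then have "{l \<in> ?A. x l \<le> x k} = {l\<in>A. x l \<le> x k}" by auto
    then show "(\<Sum>l\<in>{l \<in> ?A. x l \<le> x k}. x l) \<le> C * x k" using small k by simp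
  qed (use A x i in \<open>auto simp: less_imp_le\<close>)
  also have "\<dots> \<le> (2 * sqrt C * sqrt (C * x i)) / sqrt (x i)"
    using small[OF i] C0 x[OF i] by (intro divide_right_mono mult_left_mono) auto
  also have "\<dots> = 2 * C" using C0 x[OF i] by (simp add: real_sqrt_mult)
  finally show ?thesis .
qed

text \<open>The hypothesis is symmetric under \<open>x \<mapsto> 1 / x\<close>, so the elements above \<open>x i\<close> are handled like those
below it.\<close>

lemma sum_ratio_le:
  fixes x :: "'a \<Rightarrow> real"
  assumes A: "finite A" and x: "\<And>i. i \<in> A \<Longrightarrow> 0 < x i"
    and C: "\<And>i. i \<in> A \<Longrightarrow> (\<Sum>l\<in>A. min (x i) (x l) / max (x i) (x l)) \<le> C"
    and i: "i \<in> A"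
  shows "(\<Sum>l\<in>A. ratio (x i) (x l)) \<le> 4 * C"
proof -
  \<comment> \<open>Inversion exchanges minimum and maximum up to the same quotient.\<close>
  let ?y = "\<lambda>l. inverse (x l)"
  have inv: "min (?y k) (?y l) / max (?y k) (?y l) = min (x k) (x l) / max (x k) (x l)"
    if "k \<in> A" "l \<in> A" for k l
    using x[OF that(1)] x[OF that(2)] by (auto simp: min_def max_def field_simps)
  have "(\<Sum>l\<in>{l\<in>A. ?y l \<le> ?y i}. ratio (?y i) (?y l)) \<le> 2 * C"
    using A x i C inv by (intro sum_ratio_below) auto
  also have "(\<Sum>l\<in>{l\<in>A. ?y l \<le> ?y i}. ratio (?y i) (?y l)) = (\<Sum>l\<in>{l\<in>A. x i \<le> x l}. ratio (x i) (x l))"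
  proof (rule sum.cong)
    fix l assume "l \<in> {l \<in> A. x i \<le> x l}"
    then show "ratio (?y i) (?y l) = ratio (x i) (x l)" unfolding ratio_def using i by (simp only: inv mem_Collect_eq)
  qed (use x i in auto)
  finally have 2: "(\<Sum>l\<in>{l\<in>A. x i \<le> x l}. ratio (x i) (x l)) \<le> 2 * C" .
  have 1: "(\<Sum>l\<in>{l\<in>A. x l \<le> x i}. ratio (x i) (x l)) \<le> 2 * C"
    using assms by (rule sum_ratio_below)
  have "(\<Sum>l\<in>A. ratio (x i) (x l))
      = (\<Sum>l\<in>{l\<in>A. x l \<le> x i}. ratio (x i) (x l)) + (\<Sum>l\<in>A - {l\<in>A. x l \<le> x i}. ratio (x i) (x l))"
    using sum.subset_diff[of "{l\<in>A. x l \<le> x i}" A "\<lambda>l. ratio (x i) (x l)"] A by simp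
  also have "(\<Sum>l\<in>A - {l\<in>A. x l \<le> x i}. ratio (x i) (x l)) \<le> (\<Sum>l\<in>{l\<in>A. x i \<le> x l}. ratio (x i) (x l))"
    using A x i by (intro sum_mono2) (auto intro: ratio_nonneg)
  finally show ?thesis using 1 2 by linarith
qed

lemma pseudohyp_radial:
  assumes "0 \<le> a" "a < 1" "0 \<le> b" "b < 1"
  shows "pseudohyp (of_real a) (of_real b) = \<bar>a - b\<bar> / (1 - a * b)"
proof -
  have "a * b < 1" using assms mult_strict_mono[of a 1 b 1] by simp
  moreover have "1 - complex_of_real a * complex_of_real b = of_real (1 - a * b)" by simp
  moreover have "complex_of_real a - complex_of_real b = of_real (a - b)" by simp
  ultimately show ?thesis
    unfolding pseudohyp_def norm_divide complex_cnj_complex_of_real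
    by (simp only: norm_of_real abs_of_pos diff_gt_0_iff_gt)
qed

lemma min_div_max:
  fixes x y :: real assumes "0 < x" "0 < y" shows "min x y / max x y = x * y / (max x y)\<^sup>2"
  using assms by (auto simp: min_def max_def power2_eq_square)

text \<open>On a radius, the defect quotient that measures lacunarity is dominated by the summand that the
Carleson condition controls; \<open>pseudohyp_sq_le_min_div_max\<close> is the reverse estimate, valid for
arbitrary arguments.\<close>

lemma min_div_max_le_pseudohyp:
  assumes "cmod a < 1" "cmod b < 1"
  shows "min (defect a) (defect b) / max (defect a) (defect b)
     \<le> 1 - (pseudohyp (of_real (cmod a)) (of_real (cmod b)))\<^sup>2"
proof -
  have d: "0 < defect a" "0 < defect b" using assms by (auto intro: defect_pos)
  have ab: "0 < 1 - cmod a * cmod b" by (rule denominator_nonzero[OF assms])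
  have "1 - cmod a * cmod b \<le> max (defect a) (defect b)"
  proof (cases "cmod a \<le> cmod b")
    case True
    then have "(cmod a)\<^sup>2 \<le> cmod a * cmod b" by (simp add: power2_eq_square mult_left_mono)
    then show ?thesis by (simp add: defect_def)
  next
    case False
    then have "(cmod b)\<^sup>2 \<le> cmod a * cmod b" by (simp add: power2_eq_square mult_right_mono)
    then show ?thesis by (simp add: defect_def)
  qed
  then have "defect a * defect b / (max (defect a) (defect b))\<^sup>2
      \<le> defect a * defect b / (1 - cmod a * cmod b)\<^sup>2"
    using d ab by (intro divide_left_mono power_mono) auto
  also have "\<dots> = defect (of_real (cmod a)) * defect (of_real (cmod b))
      / (cmod (1 - cnj (of_real (cmod a)) * of_real (cmod b)))\<^sup>2"
  proof -
    have "cmod (1 - cnj (of_real (cmod a)) * of_real (cmod b)) = cmod (of_real (1 - cmod a * cmod b))" by simp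
    then show ?thesis using ab by (simp only: norm_of_real) (simp add: defect_def)
  qed
  also have "\<dots> = 1 - (pseudohyp (of_real (cmod a)) (of_real (cmod b)))\<^sup>2"
    using assms by (intro pseudohyp_sq[symmetric]) auto
  finally show ?thesis using min_div_max[OF d] by simp
qed

lemma pseudohyp_sq_le_min_div_max:
  assumes "cmod a < 1" "cmod b < 1"
  shows "1 - (pseudohyp a b)\<^sup>2 \<le> 4 * (min (defect a) (defect b) / max (defect a) (defect b))"
proof -
  have d: "0 < defect a" "0 < defect b" using assms by (auto intro: defect_pos)
  have half: "defect a \<le> 2 * (1 - cmod a * cmod b)" if "cmod a < 1" "cmod b < 1" for a b
  proof -
    have "defect a = (1 - cmod a) * (1 + cmod a)" by (simp add: defect_def power2_eq_square algebra_simps)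
    also have "\<dots> \<le> (1 - cmod a) * 2" using that by (intro mult_left_mono) auto
    also have "\<dots> \<le> 2 * (1 - cmod a * cmod b)" using that mult_left_le[of "cmod b" "cmod a"] by simp
    finally show ?thesis .
  qed
  have "max (defect a) (defect b) / 2 \<le> cmod (1 - cnj a * b)"
    using half[OF assms] half[OF assms(2,1)] denominator_nonzero(2)[OF assms] by (simp add: mult.commute)
  then have "defect a * defect b / (cmod (1 - cnj a * b))\<^sup>2
      \<le> defect a * defect b / (max (defect a) (defect b) / 2)\<^sup>2"
    using d denominator_nonzero[OF assms]
    by (intro divide_left_mono power_mono mult_pos_pos zero_less_power) (auto simp: max_def)
  also have "\<dots> = 4 * (min (defect a) (defect b) / max (defect a) (defect b))"
    using min_div_max[OF d] by (simp add: power_divide)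
  finally show ?thesis using pseudohyp_sq[OF assms] by simp
qed

text \<open>Rotating two points onto a common radius brings them closest to each other.\<close>

lemma pseudohyp_radial_le:
  assumes "cmod a < 1" "cmod b < 1"
  shows "pseudohyp (of_real (cmod a)) (of_real (cmod b)) \<le> pseudohyp a b"
proof -
  have d: "0 < defect a" "0 < defect b" using assms by (auto intro: defect_pos)
  have ab: "0 < 1 - cmod a * cmod b" by (rule denominator_nonzero[OF assms])
  have "1 - (pseudohyp a b)\<^sup>2 \<le> defect a * defect b / (1 - cmod a * cmod b)\<^sup>2"
    unfolding pseudohyp_sq[OF assms] using d ab denominator_nonzero(2)[OF assms]
    by (intro divide_left_mono power_mono mult_pos_pos zero_less_power) auto
  also have "\<dots> = defect (of_real (cmod a)) * defect (of_real (cmod b))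
      / (cmod (1 - cnj (of_real (cmod a)) * of_real (cmod b)))\<^sup>2"
  proof -
    have "cmod (1 - cnj (of_real (cmod a)) * of_real (cmod b)) = cmod (of_real (1 - cmod a * cmod b))" by simp
    then show ?thesis using ab by (simp only: norm_of_real) (simp add: defect_def)
  qed
  also have "\<dots> = 1 - (pseudohyp (of_real (cmod a)) (of_real (cmod b)))\<^sup>2"
    using assms by (intro pseudohyp_sq[symmetric]) auto
  finally show ?thesis
    using power2_le_imp_le[OF _ pseudohyp_nonneg[of a b], of "pseudohyp (of_real (cmod a)) (of_real (cmod b))"] by simp
qed

section \<open>The power map\<close>

text \<open>Mean value theorem; \<open>t powr (r - 1)\<close> lies between \<open>c powr r\<close> and \<open>1 / c\<close> for \<open>t\<close> in \<open>[c, 1]\<close>, whatever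
the sign of \<open>r - 1\<close>.\<close>

lemma powr_diff_bounds:
  fixes c x y r :: real
  assumes "0 < c" "c \<le> x" "x \<le> y" "y \<le> 1" "0 < r"
  shows "r * c powr r * (y - x) \<le> y powr r - x powr r" "y powr r - x powr r \<le> r / c * (y - x)"
proof -
  have "r * c powr r * (y - x) \<le> y powr r - x powr r \<and> y powr r - x powr r \<le> r / c * (y - x)"
  proof (cases "x = y")
    case False
    then have xy: "x < y" using assms by simp
    have "\<exists>t>x. t < y \<and> y powr r - x powr r = (y - x) * (r * t powr (r - 1))"
      using xy assms by (intro MVT2) (auto intro!: derivative_eq_intros simp: powr_diff field_simps)
    then obtain t where t: "x < t" "t < y" "y powr r - x powr r = (y - x) * (r * t powr (r - 1))" by blast
    have t0: "0 < t" "t \<le> 1" using t assms by auto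
    have p: "t powr (r - 1) = t powr r / t" using t0 by (simp add: powr_diff)
    have "c powr r \<le> t powr r" using assms t by (intro powr_mono2) auto
    also have "\<dots> \<le> t powr r / t" using t0 by (simp add: field_simps mult_right_le_one_le)
    finally have lo: "c powr r \<le> t powr (r - 1)" using p by simp
    have "t powr r \<le> 1" using t0 assms by (intro powr_le1) auto
    then have "t powr r / t \<le> 1 / c" using t t0 assms by (intro frac_le) auto
    then have hi: "t powr (r - 1) \<le> 1 / c" using p by simp
    have "(y - x) * (r * c powr r) \<le> (y - x) * (r * t powr (r - 1))"
      using lo xy assms by (intro mult_left_mono) auto
    moreover have "(y - x) * (r * t powr (r - 1)) \<le> (y - x) * (r * (1 / c))"
      using hi xy assms by (intro mult_left_mono) auto
    ultimately show ?thesis using t(3) by (simp add: mult_ac)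
  qed simp
  then show "r * c powr r * (y - x) \<le> y powr r - x powr r" "y powr r - x powr r \<le> r / c * (y - x)" by auto
qed

lemma cmod_powr_real: "z \<noteq> 0 \<Longrightarrow> cmod (z powr of_real r) = cmod z powr r"
  by (simp add: powr_def mult.commute)

lemma cmod_powr_less_1:
  assumes "z \<noteq> 0" "cmod z < 1" "0 < r" shows "cmod (z powr of_real r) < 1"
  using assms powr_less_mono2[of r "cmod z" 1] by (simp add: cmod_powr_real)

lemma defect_powr_bounds:
  assumes "0 < c" "c \<le> cmod z" "cmod z < 1" "0 < r"
  shows "r * (c\<^sup>2) powr r * defect z \<le> defect (z powr of_real r)"
    and "defect (z powr of_real r) \<le> r / c\<^sup>2 * defect z"
proof -
  have z: "z \<noteq> 0" using assms by auto
  have "(cmod (z powr of_real r))\<^sup>2 = (cmod z)\<^sup>2 powr r"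
    using z by (simp add: cmod_powr_real powr_powr[symmetric] powr_mult power2_eq_square)
  then have e: "defect (z powr of_real r) = 1 powr r - (cmod z)\<^sup>2 powr r" by (simp add: defect_def)
  have "c\<^sup>2 \<le> (cmod z)\<^sup>2" "(cmod z)\<^sup>2 \<le> 1" "0 < c\<^sup>2"
    using assms by (auto simp: power_mono power_le_one)
  from powr_diff_bounds[OF this(3,1,2) order_refl assms(4)]
  show "r * (c\<^sup>2) powr r * defect z \<le> defect (z powr of_real r)"
    "defect (z powr of_real r) \<le> r / c\<^sup>2 * defect z"
    unfolding e by (auto simp: defect_def)
qed

lemma pseudohyp_powr_bound:
  assumes "0 < c" "c \<le> cmod a" "cmod a < 1" "c \<le> cmod b" "cmod b < 1" "0 < r"
  shows "c\<^sup>2 * (c\<^sup>2) powr r * pseudohyp (of_real (cmod a)) (of_real (cmod b))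
     \<le> pseudohyp (a powr of_real r) (b powr of_real r)"
proof -
  let ?x = "cmod a powr r" and ?y = "cmod b powr r"
  have nz: "a \<noteq> 0" "b \<noteq> 0" using assms by auto
  have w: "cmod (a powr of_real r) < 1" "cmod (b powr of_real r) < 1"
    using assms nz by (auto intro: cmod_powr_less_1)
  have c2: "c\<^sup>2 \<le> c" using assms by (simp add: power2_eq_square mult_left_le)
  have diff: "r * (c\<^sup>2) powr r * \<bar>u - v\<bar> \<le> \<bar>u powr r - v powr r\<bar>"
    if "c \<le> u" "u < 1" "c \<le> v" "v < 1" for u v
    using that c2 assms powr_diff_bounds(1)[of "c\<^sup>2" u v r] powr_diff_bounds(1)[of "c\<^sup>2" v u r]
    by (cases "u \<le> v") (auto simp: abs_if algebra_simps)
  have ab: "0 < 1 - cmod a * cmod b" by (rule denominator_nonzero) (use assms in auto)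
  have xy: "0 < 1 - ?x * ?y" using denominator_nonzero(1)[OF w] nz by (simp add: cmod_powr_real)
  have cab: "c\<^sup>2 \<le> cmod a * cmod b" using assms by (simp add: power2_eq_square mult_mono)
  have "1 - ?x * ?y = 1 powr r - (cmod a * cmod b) powr r" by (simp add: powr_mult)
  also have "\<dots> \<le> r / c\<^sup>2 * (1 - cmod a * cmod b)"
    using assms cab ab by (intro powr_diff_bounds) auto
  finally have den: "1 - ?x * ?y \<le> r / c\<^sup>2 * (1 - cmod a * cmod b)" .
  have "c\<^sup>2 * (c\<^sup>2) powr r * (\<bar>cmod a - cmod b\<bar> / (1 - cmod a * cmod b))
      = (r * (c\<^sup>2) powr r * \<bar>cmod a - cmod b\<bar>) / (r / c\<^sup>2 * (1 - cmod a * cmod b))"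
    using assms by simp
  also have "\<dots> \<le> \<bar>?x - ?y\<bar> / (1 - ?x * ?y)"
    using diff[of "cmod a" "cmod b"] den xy assms by (intro frac_le) auto
  also have "\<dots> = pseudohyp (of_real (cmod (a powr of_real r))) (of_real (cmod (b powr of_real r)))"
    using w nz by (subst pseudohyp_radial) (auto simp: cmod_powr_real)
  also have "\<dots> \<le> pseudohyp (a powr of_real r) (b powr of_real r)" using w by (rule pseudohyp_radial_le)
  finally show ?thesis using assms by (simp add: pseudohyp_radial)
qed

lemma min_div_max_scale:
  fixes x y u v a b :: real
  assumes "0 < x" "0 < y" "0 < a" "0 < b" "a * x \<le> u" "u \<le> b * x" "a * y \<le> v" "v \<le> b * y"
  shows "min u v / max u v \<le> b / a * (min x y / max x y)"
proof -
  have "min u v \<le> b * min x y" using assms by (auto simp: min_def)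
  moreover have "a * max x y \<le> max u v" using assms by (auto simp: max_def)
  moreover have "0 < a * max x y" using assms by (auto simp: max_def)
  moreover have "0 \<le> b * min x y" using assms by (auto simp: min_def)
  ultimately have "min u v / max u v \<le> (b * min x y) / (a * max x y)" by (intro frac_le)
  then show ?thesis by simp
qed

text \<open>Two points of small modulus are close to each other, so separation leaves room for at most one
modulus near zero. This keeps the powers \<open>z powr (r k - j)\<close> under control.\<close>

lemma carleson_radial_bounded_below:
  assumes "carleson_sequence (\<lambda>i. complex_of_real (cmod (z i)))"
  shows "\<exists>c>0. \<forall>i. z i \<noteq> 0 \<longrightarrow> c \<le> cmod (z i)" and "\<And>i j. z i = 0 \<Longrightarrow> z j = 0 \<Longrightarrow> i = j"
proof -
  have z: "cmod (z i) < 1" for i using assms by (simp add: carleson_sequence_def)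
  obtain \<delta> where \<delta>: "0 < \<delta>"
    and prod: "\<And>k A. finite A \<Longrightarrow> k \<notin> A \<Longrightarrow> \<delta> \<le> (\<Prod>j\<in>A. pseudohyp (of_real (cmod (z j))) (of_real (cmod (z k))))"
    using carleson_prod_bound[OF assms] by blast
  have sep: "\<delta> \<le> pseudohyp (of_real (cmod (z i))) (of_real (cmod (z j)))" if "i \<noteq> j" for i j
    using prod[of "{i}" j] that by simp
  show zero: "i = j" if "z i = 0" "z j = 0" for i j
    using sep[of i j] that \<delta> by (auto simp: pseudohyp_def)
  \<comment> \<open>Moduli below this bound would make the distance of two points smaller than \<open>\<delta>\<close>.\<close>
  define \<eta> where "\<eta> = min \<delta> 1 / 2"
  have \<eta>: "0 < \<eta>" "2 * \<eta> \<le> \<delta>" "\<eta> \<le> 1 / 2" using \<delta> by (auto simp: \<eta>_def)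
  have one: "i = j" if "cmod (z i) < \<eta>" "cmod (z j) < \<eta>" for i j
  proof (rule ccontr)
    assume "i \<noteq> j"
    then have "\<delta> \<le> \<bar>cmod (z i) - cmod (z j)\<bar> / (1 - cmod (z i) * cmod (z j))"
      using sep[of i j] z by (simp add: pseudohyp_radial)
    also have "\<dots> \<le> \<bar>cmod (z i) - cmod (z j)\<bar> / (1 / 2)"
    proof (intro divide_left_mono)
      have "cmod (z i) * cmod (z j) \<le> 1 / 2 * 1" using that \<eta> z by (intro mult_mono) (auto simp: less_imp_le)
      then show "1 / 2 \<le> 1 - cmod (z i) * cmod (z j)" by simp
      then show "0 < (1 - cmod (z i) * cmod (z j)) * (1 / 2)" by simp
    qed auto
    also have "\<dots> < 2 * \<eta>" proof -
      have "\<bar>cmod (z i) - cmod (z j)\<bar> < \<eta>"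
        using that norm_ge_zero[of "z i"] norm_ge_zero[of "z j"] by linarith
      then show ?thesis by simp
    qed
    finally show False using \<eta> by linarith
  qed
  show "\<exists>c>0. \<forall>i. z i \<noteq> 0 \<longrightarrow> c \<le> cmod (z i)"
  proof (cases "\<exists>i. z i \<noteq> 0 \<and> cmod (z i) < \<eta>")
    case True
    then obtain i where i: "z i \<noteq> 0" "cmod (z i) < \<eta>" by blast
    have "cmod (z i) \<le> cmod (z j)" for j
      using one[of i j] i by (cases "cmod (z j) < \<eta>") auto
    then show ?thesis using i by (intro exI[of _ "cmod (z i)"]) auto
  next
    case False
    then show ?thesis using \<eta> by (intro exI[of _ \<eta>]) (auto simp: not_less)
  qed
qed

text \<open>The moduli of the \<open>z i\<close> are lacunary by the Carleson condition, and powers preserve lacunarity.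
Lacunarity of the moduli alone bounds the sums of \<open>1 - pseudohyp\<^sup>2\<close>, and with the pairwise separation
this gives the Carleson products, independently of the arguments of the powers.\<close>

theorem carleson_radial_powr:
  assumes "carleson_sequence (\<lambda>i. complex_of_real (cmod (z i)))" and r: "0 < r"
  shows "\<exists>C>0. \<exists>\<delta>>0. \<forall>A. finite A \<longrightarrow> (\<forall>i\<in>A. z i \<noteq> 0) \<longrightarrow>
     (\<forall>i\<in>A. (\<Sum>l\<in>A. ratio (defect (z i powr of_real r)) (defect (z l powr of_real r))) \<le> C \<and>
            \<delta> \<le> (\<Prod>l\<in>A - {i}. pseudohyp (z i powr of_real r) (z l powr of_real r)))"
proof -
  have z: "cmod (z i) < 1" for i using assms by (simp add: carleson_sequence_def)
  obtain \<delta> where \<delta>: "0 < \<delta>"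
    and prod: "\<And>k A. finite A \<Longrightarrow> k \<notin> A \<Longrightarrow> \<delta> \<le> (\<Prod>j\<in>A. pseudohyp (of_real (cmod (z j))) (of_real (cmod (z k))))"
    using carleson_prod_bound[OF assms(1)] by blast
  obtain c where c: "0 < c" "\<And>i. z i \<noteq> 0 \<Longrightarrow> c \<le> cmod (z i)"
    using carleson_radial_bounded_below(1)[OF assms(1)] by blast
  define a where "a = r * (c\<^sup>2) powr r"
  define b where "b = r / c\<^sup>2"
  have ab: "0 < a" "0 < b" using r c by (auto simp: a_def b_def)
  define C where "C = b / a * (1 + max 0 (- 2 * ln \<delta>))"
  define \<eta> where "\<eta> = (c\<^sup>2 * (c\<^sup>2) powr r * \<delta>)\<^sup>2"
  have C: "0 < C" unfolding C_def using ab by (intro mult_pos_pos) auto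
  have \<eta>: "0 < \<eta>" using c \<delta> by (simp add: \<eta>_def)
  let ?w = "\<lambda>i. z i powr complex_of_real r"
  have "(\<Sum>l\<in>A. ratio (defect (?w i)) (defect (?w l))) \<le> 4 * C
      \<and> exp (- (4 * C) / \<eta>) \<le> (\<Prod>l\<in>A - {i}. pseudohyp (?w i) (?w l))"
    if A: "finite A" and nz: "\<And>i. i \<in> A \<Longrightarrow> z i \<noteq> 0" and i: "i \<in> A" for A i
  proof -
    have w: "cmod (?w l) < 1" if "l \<in> A" for l using that nz z r by (auto intro: cmod_powr_less_1)
    have dz: "0 < defect (z l)" for l using z by (rule defect_pos)
    have dw: "0 < defect (?w l)" if "l \<in> A" for l using w[OF that] by (rule defect_pos)
    have "(\<Sum>l\<in>A. min (defect (z i)) (defect (z l)) / max (defect (z i)) (defect (z l)))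
        \<le> 1 + max 0 (- 2 * ln \<delta>)" if i: "i \<in> A" for i
    proof -
      have "(\<Sum>l\<in>A. min (defect (z i)) (defect (z l)) / max (defect (z i)) (defect (z l)))
          = 1 + (\<Sum>l\<in>A - {i}. min (defect (z i)) (defect (z l)) / max (defect (z i)) (defect (z l)))"
        using A i dz[of i] by (subst sum.remove[OF A i]) simp
      also have "(\<Sum>l\<in>A - {i}. min (defect (z i)) (defect (z l)) / max (defect (z i)) (defect (z l)))
          \<le> (\<Sum>l\<in>A - {i}. 1 - (pseudohyp (of_real (cmod (z l))) (of_real (cmod (z i))))\<^sup>2)"
        using min_div_max_le_pseudohyp[OF z z] by (intro sum_mono) (metis min.commute max.commute)
      also have "\<dots> \<le> - 2 * ln \<delta>"
        using A \<delta> prod[of "A - {i}" i] by (intro sum_defect_le_log) (auto simp: pseudohyp_nonneg)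
      finally show ?thesis by simp
    qed
    then have rowz: "(\<Sum>l\<in>A. b / a * (min (defect (z i)) (defect (z l)) / max (defect (z i)) (defect (z l)))) \<le> C"
      if "i \<in> A" for i
      unfolding C_def sum_distrib_left[symmetric] using ab that by (intro mult_left_mono) auto
    have row: "(\<Sum>l\<in>A. min (defect (?w i)) (defect (?w l)) / max (defect (?w i)) (defect (?w l))) \<le> C"
      if "i \<in> A" for i
    proof (rule order.trans[OF sum_mono rowz[OF that]])
      fix l assume l: "l \<in> A"
      show "min (defect (?w i)) (defect (?w l)) / max (defect (?w i)) (defect (?w l))
          \<le> b / a * (min (defect (z i)) (defect (z l)) / max (defect (z i)) (defect (z l)))"
        using dz ab c nz that l r z unfolding a_def b_def
        by (intro min_div_max_scale defect_powr_bounds) auto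
    qed
    have "(\<Sum>l\<in>A. ratio (defect (?w i)) (defect (?w l))) \<le> 4 * C"
      using A dw row i by (rule sum_ratio_le)
    moreover have "exp (- (4 * C) / \<eta>) \<le> (\<Prod>l\<in>A - {i}. pseudohyp (?w i) (?w l))"
    proof -
      have "(\<Sum>l\<in>A - {i}. 1 - (pseudohyp (?w i) (?w l))\<^sup>2)
          \<le> (\<Sum>l\<in>A - {i}. 4 * (min (defect (?w i)) (defect (?w l)) / max (defect (?w i)) (defect (?w l))))"
        using w i by (intro sum_mono pseudohyp_sq_le_min_div_max) auto
      also have "\<dots> \<le> (\<Sum>l\<in>A. 4 * (min (defect (?w i)) (defect (?w l)) / max (defect (?w i)) (defect (?w l))))"
        using A dw i by (intro sum_mono2) (auto intro!: divide_nonneg_nonneg simp: less_imp_le min_def max_def)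
      also have "\<dots> \<le> 4 * C" unfolding sum_distrib_left[symmetric] using row[OF i] by simp
      finally have S: "(\<Sum>l\<in>A - {i}. 1 - (pseudohyp (?w i) (?w l))\<^sup>2) \<le> 4 * C" .
      have "exp (- (4 * C) / \<eta>) \<le> (\<Prod>l\<in>A - {i}. (pseudohyp (?w i) (?w l))\<^sup>2)"
      proof (rule prod_bounded_below[OF _ \<eta> _ _ S])
        fix l assume l: "l \<in> A - {i}"
        have "c\<^sup>2 * (c\<^sup>2) powr r * \<delta> \<le> c\<^sup>2 * (c\<^sup>2) powr r * pseudohyp (of_real (cmod (z i))) (of_real (cmod (z l)))"
          using prod[of "{i}" l] l by (intro mult_left_mono) auto
        also have "\<dots> \<le> pseudohyp (?w i) (?w l)"
          using c nz i l z r by (intro pseudohyp_powr_bound) auto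
        finally show "\<eta> \<le> (pseudohyp (?w i) (?w l))\<^sup>2"
          unfolding \<eta>_def using \<delta> by (intro power_mono) auto
        show "(pseudohyp (?w i) (?w l))\<^sup>2 \<le> 1"
          using pseudohyp_le_1[OF w w, of i l] i l pseudohyp_nonneg[of "?w i" "?w l"] by (simp add: power_le_one)
      qed (use A in auto)
      also have "\<dots> \<le> (\<Prod>l\<in>A - {i}. pseudohyp (?w i) (?w l))"
      proof (intro prod_mono conjI)
        fix l assume l: "l \<in> A - {i}"
        show "(pseudohyp (?w i) (?w l))\<^sup>2 \<le> pseudohyp (?w i) (?w l)"
          using pseudohyp_le_1[OF w w, of i l] i l pseudohyp_nonneg[of "?w i" "?w l"]
          by (simp add: power2_eq_square mult_left_le)
      qed auto
      finally show ?thesis .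
    qed
    ultimately show ?thesis by simp
  qed
  then show ?thesis
    using C by (intro exI[of _ "4 * C"] exI[of _ "exp (- (4 * C) / \<eta>)"] conjI allI impI ballI) auto
qed

section \<open>Sums over blocks\<close>

lemma sum_lessThan_add: "(\<Sum>m<a + b. f m) = (\<Sum>m<a. f m) + (\<Sum>j<b. f (a + j))" for f :: "nat \<Rightarrow> 'a::comm_monoid_add"
  by (induction b) (simp_all add: add.assoc)

lemma sum_offset: "(\<Sum>m<offset n M. f m) = (\<Sum>i<M. \<Sum>j<n i. f (offset n i + j))"
  for f :: "nat \<Rightarrow> 'a::comm_monoid_add"
proof (induction M)
  case 0
  then show ?case by (simp add: offset_def)
next
  case (Suc M)
  then show ?case by (simp add: offset_Suc sum_lessThan_add)
qed

lemma strict_mono_offset: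
  assumes "\<And>i. 0 < n i" shows "strict_mono (offset n)"
  using assms by (auto simp: strict_mono_Suc_iff offset_Suc)

lemma block_sums:
  fixes f :: "nat \<Rightarrow> 'a::real_normed_vector"
  assumes "\<And>i. 0 < n i" "summable f"
  shows "(\<lambda>i. \<Sum>j<n i. f (offset n i + j)) sums suminf f"
proof -
  have "(\<lambda>N. \<Sum>m<N. f m) \<longlonglongrightarrow> suminf f"
    using assms(2) by (rule summable_LIMSEQ)
  from LIMSEQ_subseq_LIMSEQ[OF this strict_mono_offset[of n, OF assms(1)]]
  show ?thesis by (simp add: sums_def o_def sum_offset)
qed

lemma summable_blocks:
  fixes f :: "nat \<Rightarrow> real"
  assumes "\<And>i. 0 < n i" "\<And>m. 0 \<le> f m" "summable (\<lambda>i. \<Sum>j<n i. f (offset n i + j))"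
  shows "summable f"
proof (rule summableI_nonneg_bounded[of f])
  fix N
  have "N \<le> offset n N" by (rule strict_mono_imp_increasing[OF strict_mono_offset[of n, OF assms(1)]])
  then have "sum f {..<N} \<le> sum f {..<offset n N}"
    using assms(2) by (intro sum_mono2) auto
  also have "\<dots> = (\<Sum>i<N. \<Sum>j<n i. f (offset n i + j))" by (rule sum_offset)
  also have "\<dots> \<le> (\<Sum>i. \<Sum>j<n i. f (offset n i + j))"
    using assms(2,3) by (intro sum_le_suminf) (auto intro: sum_nonneg)
  finally show "sum f {..<N} \<le> (\<Sum>i. \<Sum>j<n i. f (offset n i + j))" .
qed (rule assms(2))

lemma ell2_inner_summable:
  assumes "f \<in> ell2" "g \<in> ell2"
  shows "summable (\<lambda>m. f m * cnj (g m))"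
proof (rule summable_comparison_test'[where g="\<lambda>m. (cmod (f m))\<^sup>2 + (cmod (g m))\<^sup>2"])
  show "summable (\<lambda>m. (cmod (f m))\<^sup>2 + (cmod (g m))\<^sup>2)"
    using assms by (intro summable_add) (auto simp: ell2_def)
  show "norm (f m * cnj (g m)) \<le> (cmod (f m))\<^sup>2 + (cmod (g m))\<^sup>2" for m
    using sum_squares_bound[of "cmod (f m)" "cmod (g m)"]
      mult_nonneg_nonneg[OF norm_ge_zero norm_ge_zero, of "f m" "g m"]
    unfolding norm_mult complex_mod_cnj by linarith
qed

lemma ell2_norm_sq: "f \<in> ell2 \<Longrightarrow> (ell2_norm f)\<^sup>2 = (\<Sum>m. (cmod (f m))\<^sup>2)"
  by (simp add: ell2_norm_def ell2_def suminf_nonneg)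

definition block_energy :: "(nat \<Rightarrow> nat) \<Rightarrow> (nat \<Rightarrow> complex) \<Rightarrow> nat \<Rightarrow> real" where
  "block_energy n h i = (\<Sum>j<n i. (cmod (h (offset n i + j)))\<^sup>2)"

definition block_inner :: "(nat \<Rightarrow> nat) \<Rightarrow> (nat \<Rightarrow> complex) \<Rightarrow> (nat \<Rightarrow> complex) \<Rightarrow> nat \<Rightarrow> complex" where
  "block_inner n h f i = (\<Sum>j<n i. h (offset n i + j) * cnj (f (offset n i + j)))"

lemma block_energy_nonneg: "0 \<le> block_energy n h i"
  by (simp add: block_energy_def sum_nonneg)

lemma block_energy_sums:
  assumes "\<And>i. 0 < n i" "h \<in> ell2"
  shows "block_energy n h sums (ell2_norm h)\<^sup>2"
  unfolding ell2_norm_sq[OF assms(2)] block_energy_def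
  using assms by (intro block_sums) (auto simp: ell2_def)

lemma block_inner_sums:
  assumes "\<And>i. 0 < n i" "h \<in> ell2" "f \<in> ell2"
  shows "block_inner n h f sums ell2_inner h f"
  unfolding ell2_inner_def block_inner_def
  using assms by (intro block_sums ell2_inner_summable)

lemma sum_sq_add_le:
  fixes a b :: "nat \<Rightarrow> complex"
  assumes "summable (\<lambda>k. (cmod (a k))\<^sup>2)" "summable (\<lambda>k. (cmod (b k))\<^sup>2)"
  shows "summable (\<lambda>k. (cmod (a k + b k))\<^sup>2)"
    and "(\<Sum>k. (cmod (a k + b k))\<^sup>2) \<le> 2 * (\<Sum>k. (cmod (a k))\<^sup>2) + 2 * (\<Sum>k. (cmod (b k))\<^sup>2)"
proof -
  have le: "(cmod (a k + b k))\<^sup>2 \<le> 2 * (cmod (a k))\<^sup>2 + 2 * (cmod (b k))\<^sup>2" for k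
  proof -
    have "(cmod (a k + b k))\<^sup>2 \<le> (cmod (a k) + cmod (b k))\<^sup>2"
      by (intro power_mono norm_triangle_ineq) auto
    also have "\<dots> \<le> 2 * (cmod (a k))\<^sup>2 + 2 * (cmod (b k))\<^sup>2"
      using sum_squares_bound[of "cmod (a k)" "cmod (b k)"] by (simp add: power2_sum)
    finally show ?thesis .
  qed
  have s: "summable (\<lambda>k. 2 * (cmod (a k))\<^sup>2 + 2 * (cmod (b k))\<^sup>2)"
    using assms by (intro summable_add summable_mult)
  show sm: "summable (\<lambda>k. (cmod (a k + b k))\<^sup>2)"
    by (rule summable_comparison_test'[OF s]) (use le in simp)
  have "(\<Sum>k. (cmod (a k + b k))\<^sup>2) \<le> (\<Sum>k. 2 * (cmod (a k))\<^sup>2 + 2 * (cmod (b k))\<^sup>2)"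
    using le sm s by (intro suminf_le)
  then show "(\<Sum>k. (cmod (a k + b k))\<^sup>2) \<le> 2 * (\<Sum>k. (cmod (a k))\<^sup>2) + 2 * (\<Sum>k. (cmod (b k))\<^sup>2)"
    using assms by (simp add: suminf_add[symmetric] suminf_mult summable_mult)
qed

lemma sq_sum_limit_le:
  fixes F :: "nat \<Rightarrow> nat \<Rightarrow> complex"
  assumes lim: "\<And>k. (\<lambda>M. F M k) \<longlonglongrightarrow> G k"
    and F: "\<And>M. M0 \<le> M \<Longrightarrow> summable (\<lambda>k. (cmod (F M k))\<^sup>2) \<and> (\<Sum>k. (cmod (F M k))\<^sup>2) \<le> B"
  shows "summable (\<lambda>k. (cmod (G k))\<^sup>2)" "(\<Sum>k. (cmod (G k))\<^sup>2) \<le> B"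
proof -
  have part: "(\<Sum>k<T. (cmod (G k))\<^sup>2) \<le> B" for T
  proof (rule LIMSEQ_le_const2)
    show "(\<lambda>M. \<Sum>k<T. (cmod (F M k))\<^sup>2) \<longlonglongrightarrow> (\<Sum>k<T. (cmod (G k))\<^sup>2)"
      by (intro tendsto_intros lim)
    have "(\<Sum>k<T. (cmod (F M k))\<^sup>2) \<le> B" if "M0 \<le> M" for M
      using sum_le_suminf[of "\<lambda>k. (cmod (F M k))\<^sup>2" "{..<T}"] F[OF that] by auto
    then show "\<exists>N. \<forall>M\<ge>N. (\<Sum>k<T. (cmod (F M k))\<^sup>2) \<le> B" by blast
  qed
  show s: "summable (\<lambda>k. (cmod (G k))\<^sup>2)" by (rule summableI_nonneg_bounded[OF _ part]) auto
  show "(\<Sum>k. (cmod (G k))\<^sup>2) \<le> B" using s part by (intro suminf_le_const) auto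
qed

text \<open>Bounds that hold uniformly for finitely many blocks pass to the limit. The upper bound applied to the
tail controls the truncation error in the lower bound, at the price of a factor 2.\<close>

lemma frame_bounds_from_finite:
  fixes I :: "nat set"
  assumes n: "\<And>i. 0 < n i" and f: "\<And>k. f k \<in> ell2" and h: "h \<in> ell2"
    and supp: "\<And>i. i \<notin> I \<Longrightarrow> (\<forall>k. block_inner n h (f k) i = 0) \<and> block_energy n h i = 0"
    and c: "0 \<le> c" and B: "0 \<le> B"
    and upper: "\<And>A. finite A \<Longrightarrow> A \<subseteq> I \<Longrightarrow> summable (\<lambda>k. (cmod (\<Sum>i\<in>A. block_inner n h (f k) i))\<^sup>2) \<and>
        (\<Sum>k. (cmod (\<Sum>i\<in>A. block_inner n h (f k) i))\<^sup>2) \<le> B * (\<Sum>i\<in>A. block_energy n h i)"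
    and lower: "\<And>A. finite A \<Longrightarrow> A \<subseteq> I \<Longrightarrow>
        c * (\<Sum>i\<in>A. block_energy n h i) \<le> (\<Sum>k. (cmod (\<Sum>i\<in>A. block_inner n h (f k) i))\<^sup>2)"
  shows "summable (\<lambda>k. (cmod (ell2_inner h (f k)))\<^sup>2)"
    and "(\<Sum>k. (cmod (ell2_inner h (f k)))\<^sup>2) \<le> B * (ell2_norm h)\<^sup>2"
    and "c * (ell2_norm h)\<^sup>2 \<le> 2 * (\<Sum>k. (cmod (ell2_inner h (f k)))\<^sup>2)"
proof -
  let ?F = "\<lambda>M k. \<Sum>i<M. block_inner n h (f k) i"
  let ?G = "\<lambda>k. ell2_inner h (f k)"
  let ?E = "\<lambda>A. \<Sum>i\<in>A. block_energy n h i"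
  let ?H = "(ell2_norm h)\<^sup>2"
  have restrict: "(\<Sum>i\<in>A. block_inner n h (f k) i) = (\<Sum>i\<in>A \<inter> I. block_inner n h (f k) i)"
      "?E A = ?E (A \<inter> I)" if "finite A" for A k
    using that supp by (auto intro!: sum.mono_neutral_right)
  have up: "summable (\<lambda>k. (cmod (\<Sum>i\<in>A. block_inner n h (f k) i))\<^sup>2) \<and>
        (\<Sum>k. (cmod (\<Sum>i\<in>A. block_inner n h (f k) i))\<^sup>2) \<le> B * ?E A" if "finite A" for A
    using upper[of "A \<inter> I"] that by (simp add: restrict[OF that])
  have lo: "c * ?E A \<le> (\<Sum>k. (cmod (\<Sum>i\<in>A. block_inner n h (f k) i))\<^sup>2)" if "finite A" for A
    using lower[of "A \<inter> I"] that by (simp add: restrict[OF that])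
  have lim: "(\<lambda>M. ?F M k) \<longlonglongrightarrow> ?G k" for k
    using block_inner_sums[OF n h f[of k]] by (simp add: sums_def)
  have Elim: "(\<lambda>M. ?E {..<M}) \<longlonglongrightarrow> ?H"
    using block_energy_sums[OF n h] by (simp add: sums_def)
  have EH: "?E A \<le> ?H" if "finite A" for A
    using sum_le_suminf[of "block_energy n h" A] block_energy_sums[OF n h] that block_energy_nonneg
    by (simp add: sums_iff)
  have G: "summable (\<lambda>k. (cmod (?G k))\<^sup>2) \<and> (\<Sum>k. (cmod (?G k))\<^sup>2) \<le> B * ?H"
  proof -
    have "summable (\<lambda>k. (cmod (?F M k))\<^sup>2) \<and> (\<Sum>k. (cmod (?F M k))\<^sup>2) \<le> B * ?H" if "0 \<le> M" for M
      using up[of "{..<M}"] mult_left_mono[OF EH[of "{..<M}"] B] by simp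
    from sq_sum_limit_le[OF lim this] show ?thesis by simp
  qed
  then show s: "summable (\<lambda>k. (cmod (?G k))\<^sup>2)" "(\<Sum>k. (cmod (?G k))\<^sup>2) \<le> B * ?H" by auto
  have "c * ?E {..<M} \<le> 2 * (\<Sum>k. (cmod (?G k))\<^sup>2) + 2 * (B * (?H - ?E {..<M}))" for M
  proof -
    have tail: "summable (\<lambda>k. (cmod (?F M k - ?F M' k))\<^sup>2) \<and>
        (\<Sum>k. (cmod (?F M k - ?F M' k))\<^sup>2) \<le> B * (?H - ?E {..<M})" if "M \<le> M'" for M'
    proof -
      have split: "(\<Sum>i<M'. u i) = (\<Sum>i<M. u i) + (\<Sum>i=M..<M'. u i)" for u :: "nat \<Rightarrow> 'b::comm_monoid_add"
        using that sum.atLeastLessThan_concat[of 0 M M' u] by (simp add: atLeast0LessThan)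
      have "cmod (?F M k - ?F M' k) = cmod (\<Sum>i=M..<M'. block_inner n h (f k) i)" for k
        unfolding split by simp
      moreover have "?E {M..<M'} \<le> ?H - ?E {..<M}"
        using EH[of "{..<M'}"] split[of "block_energy n h"] by simp
      ultimately show ?thesis
        using up[of "{M..<M'}"] mult_left_mono[OF _ B, of "?E {M..<M'}" "?H - ?E {..<M}"] by auto
    qed
    have tl: "(\<lambda>M'. ?F M k - ?F M' k) \<longlonglongrightarrow> ?F M k - ?G k" for k by (intro tendsto_intros lim)
    note T = sq_sum_limit_le[OF tl tail]
    have "c * ?E {..<M} \<le> (\<Sum>k. (cmod (?G k + (?F M k - ?G k)))\<^sup>2)"
      using lo[of "{..<M}"] by simp
    also have "\<dots> \<le> 2 * (\<Sum>k. (cmod (?G k))\<^sup>2) + 2 * (\<Sum>k. (cmod (?F M k - ?G k))\<^sup>2)"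
      by (rule sum_sq_add_le(2)[OF s(1) T(1)])
    also have "\<dots> \<le> 2 * (\<Sum>k. (cmod (?G k))\<^sup>2) + 2 * (B * (?H - ?E {..<M}))"
      using T(2) by simp
    finally show ?thesis .
  qed
  then have "c * ?H \<le> 2 * (\<Sum>k. (cmod (?G k))\<^sup>2) + 2 * (B * (?H - ?H))"
    by (intro LIMSEQ_le[OF tendsto_mult[OF tendsto_const Elim]
          tendsto_add[OF tendsto_const tendsto_mult[OF tendsto_const
            tendsto_mult[OF tendsto_const tendsto_diff[OF tendsto_const Elim]]]]]) auto
  then show "c * ?H \<le> 2 * (\<Sum>k. (cmod (?G k))\<^sup>2)" by simp
qed

section \<open>Powers of Jordan blocks\<close>

lemma subdiag_power:
  "a < n \<Longrightarrow> (subdiag n ^^ j) v a = (if j \<le> a then v (a - j) else 0)"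
proof (induction j arbitrary: a)
  case (Suc j)
  then show ?case by (cases a) (auto simp: subdiag_def)
qed simp

definition jordan_coeff :: "complex \<Rightarrow> nat \<Rightarrow> nat \<Rightarrow> complex" where
  "jordan_coeff z k j = of_nat (k choose j) * z ^ (k - j) * of_real (defect z) ^ j"

lemma jordan_coeff_0: "jordan_coeff z 0 j = (if j = 0 then 1 else 0)"
  by (simp add: jordan_coeff_def)

lemma jordan_coeff_Suc:
  "jordan_coeff z (Suc k) j
     = z * jordan_coeff z k j + (if j = 0 then 0 else of_real (defect z) * jordan_coeff z k (j - 1))"
proof (cases j)
  case (Suc m)
  show ?thesis
  proof (cases "Suc m \<le> k")
    case True
    then have "k - m = Suc (k - Suc m)" by simp
    then show ?thesis using Suc by (simp add: jordan_coeff_def algebra_simps)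
  next
    case False
    then show ?thesis using Suc by (simp add: jordan_coeff_def binomial_eq_0 not_le)
  qed
qed (simp add: jordan_coeff_def)

text \<open>Powers of a Jordan block act on coordinates by convolution; this is one further multiplication by
the block, at the level of the convolution kernels.\<close>

lemma toeplitz_step:
  fixes c c' v :: "nat \<Rightarrow> complex"
  assumes "\<And>j. c' j = z * c j + (if j = 0 then 0 else e * c (j - 1))"
  shows "(\<Sum>j\<le>a. c' j * v (a - j))
     = z * (\<Sum>j\<le>a. c j * v (a - j)) + (if a = 0 then 0 else e * (\<Sum>j\<le>a - 1. c j * v (a - 1 - j)))"
proof (cases a)
  case 0
  then show ?thesis using assms by simp
next
  case (Suc b)
  have "(\<Sum>j\<le>Suc b. c' j * v (Suc b - j))
      = (\<Sum>j\<le>Suc b. z * (c j * v (Suc b - j))) + (\<Sum>j\<le>Suc b. (if j = 0 then 0 else e * c (j - 1)) * v (Suc b - j))"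
    unfolding assms by (simp add: sum.distrib[symmetric] algebra_simps)
  also have "(\<Sum>j\<le>Suc b. (if j = 0 then 0 else e * c (j - 1)) * v (Suc b - j)) = e * (\<Sum>j\<le>b. c j * v (b - j))"
    by (subst sum.atMost_Suc_shift) (simp add: sum_distrib_left mult.assoc)
  finally show ?thesis using Suc by (simp add: sum_distrib_left del: sum.atMost_Suc)
qed

lemma jordan_block_power:
  "a < n \<Longrightarrow> (jordan_block n z ^^ k) v a = (\<Sum>j\<le>a. jordan_coeff z k j * v (a - j))"
proof (induction k arbitrary: a)
  case 0
  then show ?case by (simp add: jordan_coeff_0 sum.atMost_shift)
next
  case (Suc k)
  have "(jordan_block n z ^^ Suc k) v a
      = z * (jordan_block n z ^^ k) v a + (if a = 0 then 0 else of_real (defect z) * (jordan_block n z ^^ k) v (a - 1))"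
    using Suc.prems by (simp add: jordan_block_def subdiag_def defect_def)
  also have "\<dots> = (\<Sum>j\<le>a. jordan_coeff z (Suc k) j * v (a - j))"
    using Suc by (subst toeplitz_step[OF jordan_coeff_Suc]) auto
  finally show ?case .
qed

lemma block_op_power:
  "a < n i \<Longrightarrow> (block_op n z ^^ k) g (offset n i + a)
     = (\<Sum>j\<le>a. jordan_coeff (z i) k j * g (offset n i + (a - j)))"
proof (induction k arbitrary: a)
  case 0
  then show ?case by (simp add: jordan_coeff_0 sum.atMost_shift)
next
  case (Suc k)
  have "(block_op n z ^^ Suc k) g (offset n i + a) = z i * (block_op n z ^^ k) g (offset n i + a)
      + (if a = 0 then 0 else of_real (defect (z i)) * (block_op n z ^^ k) g (offset n i + (a - 1)))"
    using Suc.prems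
    by (auto simp: block_op_def direct_sum_at jordan_block_def subdiag_def defect_def)
  also have "\<dots> = (\<Sum>j\<le>a. jordan_coeff (z i) (Suc k) j * g (offset n i + (a - j)))"
  proof -
    have "a - 1 < n i" using Suc.prems by simp
    then show ?thesis
      unfolding toeplitz_step[where c = "jordan_coeff (z i) k" and c' = "jordan_coeff (z i) (Suc k)"
          and v = "\<lambda>b. g (offset n i + b)", OF jordan_coeff_Suc]
        Suc.IH[OF Suc.prems] Suc.IH[OF \<open>a - 1 < n i\<close>] by simp
  qed
  finally show ?case .
qed

definition jordan_powr_coeff :: "complex \<Rightarrow> real \<Rightarrow> nat \<Rightarrow> complex" where
  "jordan_powr_coeff z t j
     = (complex_of_real t gchoose j) * z powr (of_real t - of_nat j) * of_real (defect z) ^ j"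

lemma block_op_powr_at:
  assumes "a < n i" "z i \<noteq> 0"
  shows "block_op_powr n z (of_real t) g (offset n i + a)
     = (\<Sum>j\<le>a. jordan_powr_coeff (z i) t j * g (offset n i + (a - j)))"
proof -
  have "block_op_powr n z (of_real t) g (offset n i + a)
      = (\<Sum>j<n i. jordan_powr_coeff (z i) t j * (if j \<le> a then g (offset n i + (a - j)) else 0))"
    using assms
    by (auto simp: block_op_powr_def direct_sum_at jordan_block_powr_def subdiag_power
        jordan_powr_coeff_def defect_def intro!: sum.cong)
  also have "\<dots> = (\<Sum>j\<le>a. jordan_powr_coeff (z i) t j * g (offset n i + (a - j)))"
    using assms by (intro sum.mono_neutral_cong_right) auto
  finally show ?thesis .
qed

text \<open>A natural exponent is at least the order of nilpotency of the block; for all others the power is zero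
by \<open>0 powr s = 0\<close>.\<close>

lemma block_op_powr_zero:
  assumes "a < n i" "z i = 0" "real (n i) - 1 < t"
  shows "block_op_powr n z (of_real t) g (offset n i + a) = 0"
proof -
  let ?v = "\<lambda>j. if j < n i then g (offset n i + j) else 0"
  have "block_op_powr n z (of_real t) g (offset n i + a) = jordan_block_powr (n i) 0 (of_real t) ?v a"
    using assms by (simp add: block_op_powr_def direct_sum_at)
  also have "\<dots> = 0"
  proof (cases "complex_of_real t \<in> \<nat>")
    case True
    then obtain k where "complex_of_real t = of_nat k" by (auto elim: Nats_cases)
    then have k: "t = real k" by (metis of_real_eq_iff of_real_of_nat_eq)
    then have "n i \<le> k" using assms(3) by linarith
    then have "jordan_coeff 0 k j = 0" if "j \<le> a" for j
      using that assms(1) by (simp add: jordan_coeff_def)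
    then show ?thesis
      using True k assms(1) by (simp add: jordan_block_powr_def jordan_block_power)
  next
    case False
    then show ?thesis by (simp add: jordan_block_powr_def)
  qed
  finally show ?thesis .
qed

section \<open>What the frame property says about the generator\<close>

lemma basis_vec_ell2: "basis_vec n i a \<in> ell2"
  and ell2_norm_basis_vec: "ell2_norm (basis_vec n i a) = 1"
  and ell2_inner_basis_vec: "ell2_inner (basis_vec n i a) f = cnj (f (offset n i + a))"
proof -
  let ?m = "offset n i + a"
  have 1: "(\<lambda>m. (cmod (basis_vec n i a m))\<^sup>2) sums (\<Sum>m\<in>{?m}. (cmod (basis_vec n i a m))\<^sup>2)"
    by (rule sums_finite) (auto simp: basis_vec_def)
  then show "basis_vec n i a \<in> ell2" "ell2_norm (basis_vec n i a) = 1"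
    by (auto simp: ell2_def ell2_norm_def sums_iff basis_vec_def)
  have "(\<lambda>m. basis_vec n i a m * cnj (f m)) sums (\<Sum>m\<in>{?m}. basis_vec n i a m * cnj (f m))"
    by (rule sums_finite) (auto simp: basis_vec_def)
  then show "ell2_inner (basis_vec n i a) f = cnj (f ?m)"
    by (simp add: ell2_inner_def sums_iff basis_vec_def)
qed

text \<open>Tested on the first basis vector of a block, the lower frame bound reads
\<open>A \<le> |g\<^sub>i\<^sub>0|\<^sup>2 / defect (z i)\<close>. Tested on any basis vector, the upper frame bound controls the norm of a
combination of the chain of \<open>z i\<close> whose coefficients are entries of \<open>g\<close>; the lower Riesz bound for this single
block then controls the entries.\<close>

lemma generator_bounds:
  assumes "block_diagonal_carleson_frame n z g"
  shows "\<exists>\<gamma>>0. \<exists>G>0. \<forall>i. \<gamma> * sqrt (defect (z i)) \<le> cmod (g (offset n i))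
     \<and> (\<forall>a<n i. cmod (g (offset n i + a)) \<le> G * sqrt (defect (z i)))"
proof -
  have n: "\<And>i. 0 < n i" and z: "\<And>i. cmod (z i) < 1" and bdd: "bdd_above (range n)"
    and fr: "is_frame (\<lambda>k. (block_op n z ^^ k) g)"
    using assms by (auto simp: block_diagonal_carleson_frame_def)
  obtain N where N: "\<And>i. n i \<le> N" using bdd by (auto simp: bdd_above_def)
  have N0: "0 < N" using n[of 0] N[of 0] by linarith
  obtain A B where A: "0 < A" and frame: "\<And>h. h \<in> ell2 \<Longrightarrow>
      A * (ell2_norm h)\<^sup>2 \<le> (\<Sum>k. (cmod (ell2_inner h ((block_op n z ^^ k) g)))\<^sup>2)
      \<and> (\<Sum>k. (cmod (ell2_inner h ((block_op n z ^^ k) g)))\<^sup>2) \<le> B * (ell2_norm h)\<^sup>2"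
    and AB: "A \<le> B"
    using fr by (auto simp: is_frame_def)
  have coord: "A \<le> (\<Sum>k. (cmod ((block_op n z ^^ k) g (offset n i + a)))\<^sup>2)"
    "(\<Sum>k. (cmod ((block_op n z ^^ k) g (offset n i + a)))\<^sup>2) \<le> B" for i a
    using frame[OF basis_vec_ell2[of n i a]] by (simp_all add: ell2_norm_basis_vec ell2_inner_basis_vec)
  \<comment> \<open>Coordinate \<open>a\<close> of the orbit is the combination of the chain of \<open>z i\<close> with these coefficients.\<close>
  define d where "d i a j = g (offset n i + (a - j)) / of_real (sqrt (defect (z i)))" for i a j
  have F: "(\<Sum>k. (cmod ((block_op n z ^^ k) g (offset n i + a)))\<^sup>2)
      = sq_norm (\<Sum>j<Suc a. fps_const (d i a j) * blockvec (z i) j)" if a: "a < n i" for i a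
  proof -
    have "0 < defect (z i)" using z by (rule defect_pos)
    then show ?thesis
      unfolding sq_norm_def
      by (simp add: block_op_power[of a n i, OF a] fps_sum_nth fps_nth_blockvec jordan_coeff_def d_def
          lessThan_Suc_atMost mult_ac del: sum.lessThan_Suc)
  qed
  obtain C :: real where C: "0 < C" and low: "\<And>(A :: nat set) n w d. finite A \<Longrightarrow>
      (\<forall>i\<in>A. cmod (w i) < 1 \<and> n i \<le> N) \<Longrightarrow>
      (\<forall>i\<in>A. (\<Sum>l\<in>A. ratio (defect (w i)) (defect (w l))) \<le> 1) \<Longrightarrow>
      (\<forall>i\<in>A. 1 \<le> (\<Prod>l\<in>A - {i}. pseudohyp (w i) (w l))) \<Longrightarrow>
      (\<Sum>i\<in>A. \<Sum>m<n i. (cmod (d i m))\<^sup>2)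
        \<le> C * sq_norm (\<Sum>i\<in>A. \<Sum>m<n i. fps_const (d i m) * blockvec (w i) m)"
    using blocks_lower[OF N0 zero_less_one zero_less_one, where 'i=nat] by blast
  have "sqrt A * sqrt (defect (z i)) \<le> cmod (g (offset n i))" for i
  proof -
    have dz: "0 < defect (z i)" using z by (rule defect_pos)
    have "sq_norm (fps_const c * ukern (z i)) = (cmod c)\<^sup>2" for c
    proof -
      have W: "wiener (fps_const c * ukern (z i))" using z by (intro wiener_scale wiener_ukern)
      have "complex_of_real (sq_norm (fps_const c * ukern (z i)))
          = c * cnj (ip (fps_const c * ukern (z i)) (ukern (z i)))"
        unfolding ip_self[OF W, symmetric] ip_cnj[OF W wiener_ukern[OF z]]
        using z by (intro ip_scale_left wiener_ukern W)
      also have "\<dots> = of_real ((cmod c)\<^sup>2)"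
        using z by (simp add: ip_scale_left wiener_ukern ip_ukern_self complex_norm_square[symmetric])
      finally show ?thesis using of_real_eq_iff by blast
    qed
    then have "A \<le> (cmod (d i 0 0))\<^sup>2"
      using coord(1)[of i 0] F[OF n] by (simp add: blockvec_def)
    also have "\<dots> = (cmod (g (offset n i)))\<^sup>2 / defect (z i)"
      using dz by (simp add: d_def norm_divide power_divide)
    finally have "A * defect (z i) \<le> (cmod (g (offset n i)))\<^sup>2" using dz by (simp add: field_simps)
    then have "sqrt (A * defect (z i)) \<le> cmod (g (offset n i))" using real_le_lsqrt by (simp add: real_le_lsqrt)
    then show ?thesis by (simp add: real_sqrt_mult)
  qed
  moreover have "cmod (g (offset n i + b)) \<le> sqrt (C * B) * sqrt (defect (z i))" if b: "b < n i" for i b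
  proof -
    have dz: "0 < defect (z i)" using z by (rule defect_pos)
    have "(cmod (d i b 0))\<^sup>2 \<le> (\<Sum>m<Suc b. (cmod (d i b m))\<^sup>2)"
      by (intro member_le_sum) auto
    also have "\<dots> \<le> C * sq_norm (\<Sum>m<Suc b. fps_const (d i b m) * blockvec (z i) m)"
      using low[of "{i}" z "\<lambda>_. Suc b" "\<lambda>_. d i b"] z[of i] N[of i] b ratio_self[OF dz]
      by (simp del: sum.lessThan_Suc)
    also have "\<dots> \<le> C * B"
      using coord(2)[of i b] F[OF b] C by (intro mult_left_mono) auto
    finally have "(cmod (g (offset n i + b)))\<^sup>2 / defect (z i) \<le> C * B"
      using dz by (simp add: d_def norm_divide power_divide)
    then have "(cmod (g (offset n i + b)))\<^sup>2 \<le> C * B * defect (z i)" using dz by (simp add: field_simps)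
    then have "cmod (g (offset n i + b)) \<le> sqrt (C * B * defect (z i))" by (rule real_le_rsqrt)
    then show ?thesis by (simp add: real_sqrt_mult)
  qed
  moreover have "0 < sqrt A" "0 < sqrt (C * B)" using A AB C by auto
  ultimately show ?thesis by blast
qed

section \<open>Orbits of a single block under real powers\<close>

text \<open>Both sides are polynomials in \<open>k\<close>, and the Newton basis \<open>k choose m\<close> is triangular with respect to the
degree; the leading coefficient of the left side is \<open>r ^ j / j!\<close>, whence the diagonal entries.\<close>

lemma gbinomial_affine:
  fixes r s :: "'a::field_char_0"
  shows "\<exists>\<alpha>. \<alpha> j = r ^ j \<and> (\<forall>m>j. \<alpha> m = 0) \<and>
    (\<forall>k. (r * of_nat k + s) gchoose j = (\<Sum>m\<le>j. \<alpha> m * of_nat (k choose m)))"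
proof (induction j)
  case 0
  show ?case by (intro exI[of _ "\<lambda>m. if m = 0 then 1 else 0"]) auto
next
  case (Suc j)
  then obtain \<alpha> where \<alpha>: "\<alpha> j = r ^ j" "\<And>m. m > j \<Longrightarrow> \<alpha> m = 0"
    "\<And>k. (r * of_nat k + s) gchoose j = (\<Sum>m\<le>j. \<alpha> m * of_nat (k choose m))" by blast
  define \<beta> where "\<beta> m = (r * of_nat m * (if m = 0 then 0 else \<alpha> (m - 1))
      + (r * of_nat m + s - of_nat j) * \<alpha> m) / of_nat (Suc j)" for m
  have "(r * of_nat k + s) gchoose Suc j = (\<Sum>m\<le>Suc j. \<beta> m * of_nat (k choose m))" for k
  proof -
    let ?C = "\<lambda>m. of_nat (k choose m) :: 'a"
    have pascal: "of_nat k * ?C m = of_nat m * ?C m + of_nat (Suc m) * ?C (Suc m)" for m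
      using gbinomial_mult_1[of "of_nat k :: 'a" m] by (simp add: binomial_gbinomial)
    have "of_nat (Suc j) * ((r * of_nat k + s) gchoose Suc j)
        = (r * of_nat k + s - of_nat j) * ((r * of_nat k + s) gchoose j)"
      using gbinomial_mult_1[of "r * of_nat k + s" j] by (simp add: algebra_simps)
    also have "\<dots> = (\<Sum>m\<le>j. \<alpha> m * (r * (of_nat k * ?C m) + (s - of_nat j) * ?C m))"
      unfolding \<alpha>(3) sum_distrib_left by (intro sum.cong) (auto simp: algebra_simps)
    also have "\<dots> = (\<Sum>m\<le>j. (r * of_nat m + s - of_nat j) * \<alpha> m * ?C m)
        + (\<Sum>m\<le>j. r * of_nat (Suc m) * \<alpha> m * ?C (Suc m))"
      unfolding pascal sum.distrib[symmetric] by (intro sum.cong) (auto simp: algebra_simps)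
    also have "(\<Sum>m\<le>j. (r * of_nat m + s - of_nat j) * \<alpha> m * ?C m)
        = (\<Sum>m\<le>Suc j. (r * of_nat m + s - of_nat j) * \<alpha> m * ?C m)"
      using \<alpha>(2) by simp
    also have "(\<Sum>m\<le>j. r * of_nat (Suc m) * \<alpha> m * ?C (Suc m))
        = (\<Sum>m\<le>Suc j. r * of_nat m * (if m = 0 then 0 else \<alpha> (m - 1)) * ?C m)"
      by (subst sum.atMost_Suc_shift[where n=j]) simp
    finally have "of_nat (Suc j) * ((r * of_nat k + s) gchoose Suc j)
        = (\<Sum>m\<le>Suc j. of_nat (Suc j) * (\<beta> m * ?C m))"
      unfolding sum.distrib[symmetric] \<beta>_def
      by (simp only: times_divide_eq_left times_divide_eq_right nonzero_mult_div_cancel_left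
          of_nat_neq_0 not_False_eq_True) (simp add: algebra_simps)
    then show ?thesis
      unfolding sum_distrib_left[symmetric] using of_nat_neq_0[of j, where 'a='a]
      by (simp only: mult_cancel_left) simp
  qed
  moreover have "\<beta> (Suc j) = r ^ Suc j" using \<alpha>(1,2) of_nat_neq_0[of j, where 'a='a] by (simp add: \<beta>_def del: of_nat_Suc)
  moreover have "\<forall>m>Suc j. \<beta> m = 0" using \<alpha>(2) by (simp add: \<beta>_def)
  ultimately show ?case by blast
qed

lemma sum_triangle_swap:
  fixes f :: "nat \<Rightarrow> nat \<Rightarrow> 'a::comm_monoid_add"
  shows "(\<Sum>m<n. \<Sum>j=m..<n. f m j) = (\<Sum>j<n. \<Sum>m\<le>j. f m j)"
proof -
  have "(\<Sum>m<n. \<Sum>j=m..<n. f m j) = (\<Sum>m<n. \<Sum>j<n. if m \<le> j then f m j else 0)"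
    by (intro sum.cong refl sum.mono_neutral_cong_left) auto
  also have "\<dots> = (\<Sum>j<n. \<Sum>m<n. if m \<le> j then f m j else 0)" by (rule sum.swap)
  also have "\<dots> = (\<Sum>j<n. \<Sum>m\<le>j. f m j)"
    by (intro sum.cong refl sum.mono_neutral_cong_right) auto
  finally show ?thesis .
qed

lemma powr_affine:
  fixes z :: complex
  assumes "z \<noteq> 0"
  shows "z powr (of_real (r * real k + s) - of_nat j) = (z powr of_real r) ^ k * z powr of_real s / z ^ j"
proof -
  have "z powr (of_real (r * real k + s) - of_nat j)
      = exp (of_nat k * (of_real r * Ln z)) * exp (of_real s * Ln z) / exp (of_nat j * Ln z)"
    using assms by (simp add: powr_def algebra_simps exp_diff exp_add)
  also have "exp (of_nat k * (of_real r * Ln z)) = (z powr of_real r) ^ k"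
    using assms by (simp only: exp_of_nat_mult powr_def if_False)
  also have "exp (of_nat j * Ln z) = z ^ j" using assms by (simp add: exp_of_nat_mult)
  finally show ?thesis using assms by (simp add: powr_def)
qed

text \<open>The map from \<open>h\<close> to \<open>d\<close> is the composition of two triangular matrices. The first is the
Toeplitz matrix of \<open>g\<close>, scaled by the square root of the defect. The second expands binomials of
\<open>r k + s\<close> in binomials of \<open>k\<close> and exchanges the defect of \<open>z\<close> for that of its power, which is comparable.
The bound from below on the modulus of \<open>z\<close> takes care of the negative powers of \<open>z\<close>.\<close>

lemma block_orbit_coefficients:
  fixes c r s \<gamma> G :: real
  assumes c: "0 < c" and r: "0 < r" and s: "0 \<le> s" and \<gamma>: "0 < \<gamma>" and G: "0 \<le> G"
  shows "\<exists>T>0. \<forall>z n g h. c \<le> cmod z \<longrightarrow> cmod z < 1 \<longrightarrow> n \<le> N \<longrightarrow>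
     (\<forall>a<n. cmod (g a) \<le> G * sqrt (defect z)) \<longrightarrow> \<gamma> * sqrt (defect z) \<le> cmod (g 0) \<longrightarrow>
     (\<exists>d. (\<forall>k. (\<Sum>a<n. (\<Sum>j\<le>a. jordan_powr_coeff z (r * real k + s) j * g (a - j)) * cnj (h a))
               = fps_nth (\<Sum>m<n. fps_const (d m) * blockvec (z powr of_real r) m) k)
        \<and> (\<Sum>m<n. (cmod (d m))\<^sup>2) \<le> T * (\<Sum>a<n. (cmod (h a))\<^sup>2)
        \<and> (\<Sum>a<n. (cmod (h a))\<^sup>2) \<le> T * (\<Sum>m<n. (cmod (d m))\<^sup>2))"
proof -
  obtain \<alpha> :: "nat \<Rightarrow> nat \<Rightarrow> complex" where \<alpha>diag: "\<And>j. \<alpha> j j = of_real r ^ j"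
    and \<alpha>zero: "\<And>j m. j < m \<Longrightarrow> \<alpha> j m = 0"
    and \<alpha>: "\<And>j k. (of_real r * of_nat k + of_real s) gchoose j = (\<Sum>m\<le>j. \<alpha> j m * of_nat (k choose m))"
    using gbinomial_affine[of _ "complex_of_real r" "complex_of_real s"] by metis
  define K1 where "K1 = (\<Sum>j<N. \<Sum>m<N. cmod (\<alpha> j m))"
  have K1: "cmod (\<alpha> j m) \<le> K1" if "j < N" "m < N" for j m
  proof -
    have "cmod (\<alpha> j m) \<le> (\<Sum>m<N. cmod (\<alpha> j m))" using that by (intro member_le_sum) auto
    also have "\<dots> \<le> K1" unfolding K1_def using that by (intro member_le_sum[of j] sum_nonneg) auto
    finally show ?thesis .
  qed
  have K10: "0 \<le> K1" unfolding K1_def by (intro sum_nonneg) auto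
  define a where "a = r * (c\<^sup>2) powr r"
  define b where "b = r / c\<^sup>2"
  have ab: "0 < a" "0 < b" using r c by (auto simp: a_def b_def)
  define K where "K = sqrt (1 / a) * 1 * (max 1 (1 / a)) ^ N * K1 * (1 / min 1 c) ^ N"
  define \<mu> where "\<mu> = min 1 (c powr r * (1 / b) * r)"
  define \<kappa> where "\<kappa> = sqrt (1 / b) * c powr s * \<mu> ^ N"
  have \<kappa>: "0 < \<kappa>" unfolding \<kappa>_def \<mu>_def using ab c r by simp
  have K0: "0 \<le> K" unfolding K_def using ab c K10 by (intro mult_nonneg_nonneg) auto
  obtain T1 where T1: "0 < T1" and tri1: "\<And>n (A :: nat \<Rightarrow> nat \<Rightarrow> complex) x. n \<le> N \<Longrightarrow>
    (\<forall>m<n. \<forall>j<n. cmod (A m j) \<le> G) \<Longrightarrow> (\<forall>m<n. \<gamma> \<le> cmod (A m m)) \<Longrightarrow>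
    (\<Sum>j<n. (cmod (x j))\<^sup>2) \<le> T1 * (\<Sum>m<n. (cmod (\<Sum>j=m..<n. A m j * x j))\<^sup>2)"
    using triangular_bounded_below[OF G \<gamma>, of N] by blast
  obtain T2 where T2: "0 < T2" and tri2: "\<And>n (A :: nat \<Rightarrow> nat \<Rightarrow> complex) x. n \<le> N \<Longrightarrow>
    (\<forall>m<n. \<forall>j<n. cmod (A m j) \<le> K) \<Longrightarrow> (\<forall>m<n. \<kappa> \<le> cmod (A m m)) \<Longrightarrow>
    (\<Sum>j<n. (cmod (x j))\<^sup>2) \<le> T2 * (\<Sum>m<n. (cmod (\<Sum>j=m..<n. A m j * x j))\<^sup>2)"
    using triangular_bounded_below[OF K0 \<kappa>, of N] by blast
  define T where "T = max (T1 * T2) ((N * K)\<^sup>2 * (N * G)\<^sup>2)"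
  have T: "0 < T" using T1 T2 by (simp add: T_def less_max_iff_disj)
  have "\<exists>d. (\<forall>k. (\<Sum>a<n. (\<Sum>j\<le>a. jordan_powr_coeff z (r * real k + s) j * g (a - j)) * cnj (h a))
               = fps_nth (\<Sum>m<n. fps_const (d m) * blockvec (z powr of_real r) m) k)
        \<and> (\<Sum>m<n. (cmod (d m))\<^sup>2) \<le> T * (\<Sum>a<n. (cmod (h a))\<^sup>2)
        \<and> (\<Sum>a<n. (cmod (h a))\<^sup>2) \<le> T * (\<Sum>m<n. (cmod (d m))\<^sup>2)"
    if cz: "c \<le> cmod z" and z1: "cmod z < 1" and n: "n \<le> N"
      and gG: "\<And>a. a < n \<Longrightarrow> cmod (g a) \<le> G * sqrt (defect z)"
      and g\<gamma>: "\<gamma> * sqrt (defect z) \<le> cmod (g 0)"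
    for z n and g h :: "nat \<Rightarrow> complex"
  proof -
    define w where "w = z powr of_real r"
    define e where "e = defect z"
    define u where "u = defect w"
    have z0: "z \<noteq> 0" using cz c by auto
    have w1: "cmod w < 1" unfolding w_def using z0 z1 r by (rule cmod_powr_less_1)
    have e: "0 < e" "e \<le> 1" unfolding e_def using defect_pos[OF z1] defect_le_1 by auto
    have u: "0 < u" unfolding u_def by (rule defect_pos[OF w1])
    have au: "a * e \<le> u" and ub: "u \<le> b * e"
      unfolding a_def b_def e_def u_def w_def using defect_powr_bounds[OF c cz z1 r] by auto
    have eu: "e / u \<le> 1 / a" "1 / b \<le> e / u" using au ub ab u e by (auto simp: field_simps)
    \<comment> \<open>The Toeplitz matrix of the generator, and the matrix of the change of basis in \<open>k\<close>.\<close>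
    define E where "E j i = g (i - j) / of_real (sqrt e)" for j i
    define D where "D m j = of_real (sqrt e) * z powr of_real s * w ^ m / (of_real u ^ m * of_real (sqrt u))
        * \<alpha> j m * (of_real e / z) ^ j" for m j
    define x where "x i = cnj (h i)" for i
    define y where "y j = (\<Sum>i=j..<n. E j i * x i)" for j
    define d where "d m = (\<Sum>j=m..<n. D m j * y j)" for m
    have EG: "\<forall>j<n. \<forall>i<n. cmod (E j i) \<le> G"
    proof (intro allI impI)
      fix j i assume "j < n" "i < n"
      then have "cmod (g (i - j)) \<le> G * sqrt e" using gG[of "i - j"] by (simp add: e_def)
      then show "cmod (E j i) \<le> G" using e by (simp add: E_def norm_divide field_simps)
    qed
    have E\<gamma>: "\<forall>j<n. \<gamma> \<le> cmod (E j j)"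
      using g\<gamma> e by (simp add: E_def norm_divide field_simps e_def)
    have normD: "cmod (D m j) = sqrt (e / u) * (cmod z powr s * cmod w ^ m) * (e ^ m / u ^ m)
        * cmod (\<alpha> j m) * (e ^ (j - m) / cmod z ^ j)" if "m \<le> j" for m j
    proof -
      have "e ^ j = e ^ m * e ^ (j - m)" using that by (simp flip: power_add)
      then show ?thesis
        using e u z0
        by (simp add: D_def norm_mult norm_divide norm_power cmod_powr_real power_divide real_sqrt_divide mult_ac)
    qed
    have DK: "\<forall>m<n. \<forall>j<n. cmod (D m j) \<le> K"
    proof (intro allI impI)
      fix m j assume mj: "m < n" "j < n"
      show "cmod (D m j) \<le> K"
      proof (cases "m \<le> j")
        case False
        then show ?thesis using K0 by (simp add: D_def \<alpha>zero)
      next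
        case True
        have "cmod z powr s \<le> 1" using s z1 by (intro powr_le1) auto
        moreover have "cmod w ^ m \<le> 1" using w1 by (simp add: power_le_one)
        ultimately have f2: "cmod z powr s * cmod w ^ m \<le> 1" by (simp add: mult_le_one)
        have "e ^ m / u ^ m = (e / u) ^ m" by (simp add: power_divide)
        also have "\<dots> \<le> (max 1 (1 / a)) ^ m" using eu e u by (intro power_mono) auto
        also have "\<dots> \<le> (max 1 (1 / a)) ^ N" using mj n by (intro power_increasing) auto
        finally have f3: "e ^ m / u ^ m \<le> (max 1 (1 / a)) ^ N" .
        have "e ^ (j - m) / cmod z ^ j \<le> 1 / cmod z ^ j"
          using e by (intro divide_right_mono) (auto simp: power_le_one)
        also have "\<dots> \<le> (1 / min 1 c) ^ j"
          using cz c z0 unfolding power_one_over[symmetric] by (intro power_mono divide_left_mono) auto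
        also have "\<dots> \<le> (1 / min 1 c) ^ N" using mj n c by (intro power_increasing) auto
        finally have f5: "e ^ (j - m) / cmod z ^ j \<le> (1 / min 1 c) ^ N" .
        have f1: "sqrt (e / u) \<le> sqrt (1 / a)" using eu by simp
        have f4: "cmod (\<alpha> j m) \<le> K1" using mj n by (intro K1) auto
        show ?thesis
          unfolding normD[OF True] K_def using f1 f2 f3 f4 f5 e u ab K10
          by (intro mult_mono) auto
      qed
    qed
    have D\<kappa>: "\<forall>m<n. \<kappa> \<le> cmod (D m m)"
    proof (intro allI impI)
      fix m assume m: "m < n"
      have cw: "c powr r \<le> cmod w" unfolding w_def cmod_powr_real[OF z0] using c cz r by (intro powr_mono2) auto
      have \<mu>: "0 < \<mu>" "\<mu> \<le> 1" using ab c r by (auto simp: \<mu>_def)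
      have "\<mu> \<le> c powr r * (1 / b) * r" by (simp add: \<mu>_def)
      also have "\<dots> \<le> cmod w * (e / u) * r"
        using cw eu ab c r e u by (intro mult_mono) auto
      also have "\<dots> \<le> cmod w * (e / u) * r / cmod z"
        using z0 z1 e u r by (simp add: field_simps mult_left_le)
      finally have base: "\<mu> \<le> cmod w * (e / u) * r / cmod z" .
      have "\<mu> ^ N \<le> \<mu> ^ m" using \<mu> m n by (intro power_decreasing) auto
      also have "\<dots> \<le> (cmod w * (e / u) * r / cmod z) ^ m" using base \<mu> by (intro power_mono) auto
      finally have f3: "\<mu> ^ N \<le> (cmod w * (e / u) * r / cmod z) ^ m" .
      have f2: "c powr s \<le> cmod z powr s" using c cz s by (intro powr_mono2) auto
      have f1: "sqrt (1 / b) \<le> sqrt (e / u)" using eu by simp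
      have "\<kappa> \<le> sqrt (e / u) * cmod z powr s * (cmod w * (e / u) * r / cmod z) ^ m"
        unfolding \<kappa>_def using f1 f2 f3 \<mu> e u ab by (intro mult_mono) auto
      also have "\<dots> = cmod (D m m)"
        using r by (simp add: normD \<alpha>diag norm_power power_mult_distrib power_divide)
      finally show "\<kappa> \<le> cmod (D m m)" .
    qed
    have expansion: "(\<Sum>i<n. (\<Sum>j\<le>i. jordan_powr_coeff z (r * real k + s) j * g (i - j)) * cnj (h i))
        = fps_nth (\<Sum>m<n. fps_const (d m) * blockvec w m) k" for k
    proof -
      let ?P = "\<lambda>j. jordan_powr_coeff z (r * real k + s) j"
      have P: "?P j = (\<Sum>m\<le>j. \<alpha> j m * of_nat (k choose m)) * (w ^ k * z powr of_real s / z ^ j) * of_real e ^ j" for j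
        unfolding jordan_powr_coeff_def powr_affine[OF z0] w_def[symmetric] e_def[symmetric] \<alpha>[symmetric] by simp
      have summand: "d m * fps_nth (blockvec w m) k
          = (\<Sum>j=m..<n. of_real (sqrt e) * (\<alpha> j m * of_nat (k choose m)) * (w ^ k * z powr of_real s / z ^ j) * of_real e ^ j * y j)" for m
      proof (cases "m \<le> k")
        case True
        then have wk: "w ^ k = w ^ m * w ^ (k - m)" by (simp flip: power_add)
        show ?thesis
          unfolding d_def sum_distrib_right
          using u by (intro sum.cong refl)
            (simp add: D_def fps_nth_blockvec u_def[symmetric] wk power_divide)
      next
        case False
        then show ?thesis by (simp add: fps_nth_blockvec binomial_eq_0)
      qed
      have "(\<Sum>i<n. (\<Sum>j\<le>i. ?P j * g (i - j)) * cnj (h i)) = (\<Sum>i<n. \<Sum>j\<le>i. ?P j * g (i - j) * x i)"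
        by (simp add: sum_distrib_right x_def)
      also have "\<dots> = (\<Sum>j<n. \<Sum>i=j..<n. ?P j * g (i - j) * x i)" by (rule sum_triangle_swap[symmetric])
      also have "\<dots> = (\<Sum>j<n. ?P j * of_real (sqrt e) * y j)"
        using e by (intro sum.cong refl) (simp add: y_def E_def sum_distrib_left mult.assoc)
      also have "\<dots> = (\<Sum>j<n. \<Sum>m\<le>j. of_real (sqrt e) * (\<alpha> j m * of_nat (k choose m))
          * (w ^ k * z powr of_real s / z ^ j) * of_real e ^ j * y j)"
        unfolding P by (intro sum.cong refl) (simp add: sum_distrib_left sum_distrib_right sum_divide_distrib mult_ac)
      also have "\<dots> = (\<Sum>m<n. d m * fps_nth (blockvec w m) k)"
        unfolding summand by (rule sum_triangle_swap[symmetric])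
      finally show ?thesis by (simp add: fps_sum_nth)
    qed
    have "(\<Sum>m<n. (cmod (d m))\<^sup>2) \<le> (N * K)\<^sup>2 * (\<Sum>j<n. (cmod (y j))\<^sup>2)"
      unfolding d_def using n DK by (intro triangular_bounded_above) auto
    also have "\<dots> \<le> (N * K)\<^sup>2 * ((N * G)\<^sup>2 * (\<Sum>i<n. (cmod (x i))\<^sup>2))"
      unfolding y_def using n EG by (intro mult_left_mono triangular_bounded_above) auto
    also have "\<dots> = ((N * K)\<^sup>2 * (N * G)\<^sup>2) * (\<Sum>i<n. (cmod (h i))\<^sup>2)" by (simp add: x_def)
    also have "\<dots> \<le> T * (\<Sum>i<n. (cmod (h i))\<^sup>2)"
      by (intro mult_right_mono) (auto simp: T_def intro: sum_nonneg)
    finally have up: "(\<Sum>m<n. (cmod (d m))\<^sup>2) \<le> T * (\<Sum>i<n. (cmod (h i))\<^sup>2)" .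
    have "(\<Sum>i<n. (cmod (h i))\<^sup>2) = (\<Sum>i<n. (cmod (x i))\<^sup>2)" by (simp add: x_def)
    also have "\<dots> \<le> T1 * (\<Sum>j<n. (cmod (y j))\<^sup>2)"
      unfolding y_def by (rule tri1[OF n EG E\<gamma>])
    also have "\<dots> \<le> T1 * (T2 * (\<Sum>m<n. (cmod (d m))\<^sup>2))"
      unfolding d_def using T1 by (intro mult_left_mono tri2[OF n DK D\<kappa>]) auto
    also have "\<dots> = (T1 * T2) * (\<Sum>m<n. (cmod (d m))\<^sup>2)" by simp
    also have "\<dots> \<le> T * (\<Sum>m<n. (cmod (d m))\<^sup>2)"
      by (intro mult_right_mono) (auto simp: T_def intro: sum_nonneg)
    finally have low: "(\<Sum>i<n. (cmod (h i))\<^sup>2) \<le> T * (\<Sum>m<n. (cmod (d m))\<^sup>2)" .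
    show ?thesis using expansion up low unfolding w_def by (intro exI[of _ d]) auto
  qed
  then show ?thesis using T by (intro exI[of _ T] conjI allI impI) blast+
qed

section \<open>Frames of real powers\<close>

text \<open>The vectors \<open>f k\<close> are prescribed on the blocks with \<open>z i \<noteq> 0\<close> only, and \<open>h\<close> is supported there: this
allows for one block with \<open>z i = 0\<close>, to be treated separately. The shift \<open>s\<close> permits the progression
to start late.\<close>

definition nonzero_frame_bounds ::
    "(nat \<Rightarrow> nat) \<Rightarrow> (nat \<Rightarrow> complex) \<Rightarrow> (nat \<Rightarrow> complex) \<Rightarrow> real \<Rightarrow> real \<Rightarrow> real \<Rightarrow> real \<Rightarrow> bool" where
  "nonzero_frame_bounds n z g r s c B \<longleftrightarrow> (\<forall>f h. (\<forall>k. f k \<in> ell2) \<longrightarrow> h \<in> ell2 \<longrightarrow>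
     (\<forall>k i a. z i \<noteq> 0 \<longrightarrow> a < n i \<longrightarrow> f k (offset n i + a)
        = (\<Sum>j\<le>a. jordan_powr_coeff (z i) (r * real k + s) j * g (offset n i + (a - j)))) \<longrightarrow>
     (\<forall>i a. z i = 0 \<longrightarrow> a < n i \<longrightarrow> h (offset n i + a) = 0) \<longrightarrow>
     summable (\<lambda>k. (cmod (ell2_inner h (f k)))\<^sup>2) \<and>
     c * (ell2_norm h)\<^sup>2 \<le> (\<Sum>k. (cmod (ell2_inner h (f k)))\<^sup>2) \<and>
     (\<Sum>k. (cmod (ell2_inner h (f k)))\<^sup>2) \<le> B * (ell2_norm h)\<^sup>2)"

lemma nonzero_blocks_frame_bounds:
  fixes n :: "nat \<Rightarrow> nat" and z g :: "nat \<Rightarrow> complex" and r s :: real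
  assumes fr: "block_diagonal_carleson_frame n z g"
    and rad: "carleson_sequence (\<lambda>i. complex_of_real (cmod (z i)))"
    and r: "0 < r" and s: "0 \<le> s"
  shows "\<exists>c>0. \<exists>B>0. nonzero_frame_bounds n z g r s c B"
proof -
  have n: "\<And>i. 0 < n i" and z: "\<And>i. cmod (z i) < 1" and bdd: "bdd_above (range n)"
    using fr by (auto simp: block_diagonal_carleson_frame_def)
  obtain N where N: "\<And>i. n i \<le> N" using bdd by (auto simp: bdd_above_def)
  have N0: "0 < N" using n[of 0] N[of 0] by linarith
  obtain \<gamma> G where \<gamma>: "0 < \<gamma>" and G: "0 < G" and g0: "\<And>i. \<gamma> * sqrt (defect (z i)) \<le> cmod (g (offset n i))"
    and gG: "\<And>i a. a < n i \<Longrightarrow> cmod (g (offset n i + a)) \<le> G * sqrt (defect (z i))"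
    using generator_bounds[OF fr] by blast
  obtain c where c: "0 < c" "\<And>i. z i \<noteq> 0 \<Longrightarrow> c \<le> cmod (z i)"
    using carleson_radial_bounded_below(1)[OF rad] by blast
  define w where "w i = z i powr complex_of_real r" for i
  obtain C \<delta> where C: "0 < C" and \<delta>: "0 < \<delta>" and sep: "\<And>A. finite A \<Longrightarrow> (\<forall>i\<in>A. z i \<noteq> 0) \<Longrightarrow>
      (\<forall>i\<in>A. (\<Sum>l\<in>A. ratio (defect (w i)) (defect (w l))) \<le> C \<and> \<delta> \<le> (\<Prod>l\<in>A - {i}. pseudohyp (w i) (w l)))"
    using carleson_radial_powr[OF rad r] unfolding w_def by meson
  obtain L :: real where L: "0 < L" and low: "\<And>(A :: nat set) n w d. finite A \<Longrightarrow>
      (\<forall>i\<in>A. cmod (w i) < 1 \<and> n i \<le> N) \<Longrightarrow>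
      (\<forall>i\<in>A. (\<Sum>l\<in>A. ratio (defect (w i)) (defect (w l))) \<le> C) \<Longrightarrow>
      (\<forall>i\<in>A. \<delta> \<le> (\<Prod>l\<in>A - {i}. pseudohyp (w i) (w l))) \<Longrightarrow>
      (\<Sum>i\<in>A. \<Sum>m<n i. (cmod (d i m))\<^sup>2)
        \<le> L * sq_norm (\<Sum>i\<in>A. \<Sum>m<n i. fps_const (d i m) * blockvec (w i) m)"
    using blocks_lower[OF N0 C \<delta>, where 'i=nat] by blast
  obtain T where T: "0 < T" and coeff: "\<And>z n g h. c \<le> cmod z \<Longrightarrow> cmod z < 1 \<Longrightarrow> n \<le> N \<Longrightarrow>
     (\<forall>a<n. cmod (g a) \<le> G * sqrt (defect z)) \<Longrightarrow> \<gamma> * sqrt (defect z) \<le> cmod (g 0) \<Longrightarrow>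
     (\<exists>d. (\<forall>k. (\<Sum>a<n. (\<Sum>j\<le>a. jordan_powr_coeff z (r * real k + s) j * g (a - j)) * cnj (h a))
               = fps_nth (\<Sum>m<n. fps_const (d m) * blockvec (z powr of_real r) m) k)
        \<and> (\<Sum>m<n. (cmod (d m))\<^sup>2) \<le> T * (\<Sum>a<n. (cmod (h a))\<^sup>2)
        \<and> (\<Sum>a<n. (cmod (h a))\<^sup>2) \<le> T * (\<Sum>m<n. (cmod (d m))\<^sup>2))"
    using block_orbit_coefficients[OF c(1) r s \<gamma> less_imp_le[OF G], of N] by meson
  define U where "U = 2 * 4 ^ N * real N * C"
  have U: "0 < U" using N0 C by (simp add: U_def)
  have main: "summable (\<lambda>k. (cmod (ell2_inner h (f k)))\<^sup>2)"
    "inverse (T * L) / 2 * (ell2_norm h)\<^sup>2 \<le> (\<Sum>k. (cmod (ell2_inner h (f k)))\<^sup>2)"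
    "(\<Sum>k. (cmod (ell2_inner h (f k)))\<^sup>2) \<le> U * T * (ell2_norm h)\<^sup>2"
    if f: "\<And>k. f k \<in> ell2" and h: "h \<in> ell2"
      and fk: "\<And>k i a. z i \<noteq> 0 \<Longrightarrow> a < n i \<Longrightarrow> f k (offset n i + a)
          = (\<Sum>j\<le>a. jordan_powr_coeff (z i) (r * real k + s) j * g (offset n i + (a - j)))"
      and h0: "\<And>i a. z i = 0 \<Longrightarrow> a < n i \<Longrightarrow> h (offset n i + a) = 0" for f h
  proof -
    define Q where "Q i d \<longleftrightarrow>
        (\<forall>k. (\<Sum>a<n i. (\<Sum>j\<le>a. jordan_powr_coeff (z i) (r * real k + s) j * g (offset n i + (a - j)))
                       * cnj (h (offset n i + a)))
           = fps_nth (\<Sum>m<n i. fps_const (d m) * blockvec (w i) m) k)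
        \<and> (\<Sum>m<n i. (cmod (d m))\<^sup>2) \<le> T * block_energy n h i
        \<and> block_energy n h i \<le> T * (\<Sum>m<n i. (cmod (d m))\<^sup>2)" for i d
    have "\<exists>d. Q i d" if "z i \<noteq> 0" for i
      unfolding w_def block_energy_def Q_def
      by (rule coeff[where g="\<lambda>a. g (offset n i + a)" and h="\<lambda>a. h (offset n i + a)"])
         (use that c z N g0[of i] gG in auto)
    then have "\<forall>i. \<exists>d. z i \<noteq> 0 \<longrightarrow> Q i d" by blast
    from choice[OF this] obtain d where Q: "\<And>i. z i \<noteq> 0 \<Longrightarrow> Q i (d i)" by blast
    have d: "\<And>i k. z i \<noteq> 0 \<Longrightarrow> (\<Sum>a<n i. (\<Sum>j\<le>a. jordan_powr_coeff (z i) (r * real k + s) j * g (offset n i + (a - j))) * cnj (h (offset n i + a)))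
               = fps_nth (\<Sum>m<n i. fps_const (d i m) * blockvec (w i) m) k"
      "\<And>i. z i \<noteq> 0 \<Longrightarrow> (\<Sum>m<n i. (cmod (d i m))\<^sup>2) \<le> T * block_energy n h i"
      "\<And>i. z i \<noteq> 0 \<Longrightarrow> block_energy n h i \<le> T * (\<Sum>m<n i. (cmod (d i m))\<^sup>2)"
      using Q unfolding Q_def by blast+
    have inner: "cnj (block_inner n h (f k) i) = fps_nth (\<Sum>m<n i. fps_const (d i m) * blockvec (w i) m) k"
      if "z i \<noteq> 0" for i k
      unfolding d(1)[OF that, symmetric] block_inner_def
      using fk[OF that] by (simp add: mult.commute)
    have w1: "cmod (w i) < 1" if "z i \<noteq> 0" for i unfolding w_def using that z r by (rule cmod_powr_less_1)
    have F: "(\<lambda>k. (cmod (\<Sum>i\<in>A. block_inner n h (f k) i))\<^sup>2)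
        = (\<lambda>k. (cmod (fps_nth (\<Sum>i\<in>A. \<Sum>m<n i. fps_const (d i m) * blockvec (w i) m) k))\<^sup>2)"
      if "A \<subseteq> {i. z i \<noteq> 0}" for A
    proof
      fix k
      have "cmod (\<Sum>i\<in>A. block_inner n h (f k) i) = cmod (cnj (\<Sum>i\<in>A. block_inner n h (f k) i))"
        by (simp only: complex_mod_cnj)
      also have "cnj (\<Sum>i\<in>A. block_inner n h (f k) i)
          = fps_nth (\<Sum>i\<in>A. \<Sum>m<n i. fps_const (d i m) * blockvec (w i) m) k"
        unfolding cnj_sum fps_sum_nth[of _ A] using that inner by (intro sum.cong) auto
      finally show "(cmod (\<Sum>i\<in>A. block_inner n h (f k) i))\<^sup>2
          = (cmod (fps_nth (\<Sum>i\<in>A. \<Sum>m<n i. fps_const (d i m) * blockvec (w i) m) k))\<^sup>2" by simp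
    qed
    have upper: "summable (\<lambda>k. (cmod (\<Sum>i\<in>A. block_inner n h (f k) i))\<^sup>2) \<and>
        (\<Sum>k. (cmod (\<Sum>i\<in>A. block_inner n h (f k) i))\<^sup>2) \<le> (U * T) * (\<Sum>i\<in>A. block_energy n h i)"
      if A: "finite A" "A \<subseteq> {i. z i \<noteq> 0}" for A
    proof
      have "wiener (\<Sum>i\<in>A. \<Sum>m<n i. fps_const (d i m) * blockvec (w i) m)"
        using A w1 by (intro wiener_sum wiener_scale wiener_blockvec) auto
      then show "summable (\<lambda>k. (cmod (\<Sum>i\<in>A. block_inner n h (f k) i))\<^sup>2)"
        unfolding F[OF A(2)] by (rule sq_summable)
      have "(\<Sum>k. (cmod (\<Sum>i\<in>A. block_inner n h (f k) i))\<^sup>2)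
          \<le> U * (\<Sum>i\<in>A. \<Sum>m<n i. (cmod (d i m))\<^sup>2)"
        unfolding F[OF A(2)] sq_norm_def[symmetric] U_def
        by (rule blocks_upper) (use A w1 N sep[OF A(1)] in auto)
      also have "\<dots> \<le> U * (\<Sum>i\<in>A. T * block_energy n h i)"
        using A d(2) U by (intro mult_left_mono sum_mono) auto
      finally show "(\<Sum>k. (cmod (\<Sum>i\<in>A. block_inner n h (f k) i))\<^sup>2) \<le> (U * T) * (\<Sum>i\<in>A. block_energy n h i)"
        by (simp add: sum_distrib_left mult.assoc)
    qed
    have lower: "inverse (T * L) * (\<Sum>i\<in>A. block_energy n h i)
        \<le> (\<Sum>k. (cmod (\<Sum>i\<in>A. block_inner n h (f k) i))\<^sup>2)"
      if A: "finite A" "A \<subseteq> {i. z i \<noteq> 0}" for A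
    proof -
      have "(\<Sum>i\<in>A. block_energy n h i) \<le> (\<Sum>i\<in>A. T * (\<Sum>m<n i. (cmod (d i m))\<^sup>2))"
        using A d(3) by (intro sum_mono) auto
      also have "\<dots> = T * (\<Sum>i\<in>A. \<Sum>m<n i. (cmod (d i m))\<^sup>2)" by (simp add: sum_distrib_left)
      also have "\<dots> \<le> T * (L * sq_norm (\<Sum>i\<in>A. \<Sum>m<n i. fps_const (d i m) * blockvec (w i) m))"
        using A w1 N sep[OF A(1)] T by (intro mult_left_mono low) auto
      also have "\<dots> = (T * L) * (\<Sum>k. (cmod (\<Sum>i\<in>A. block_inner n h (f k) i))\<^sup>2)"
        unfolding F[OF A(2)] sq_norm_def by simp
      finally show ?thesis using T L by (simp add: field_simps)
    qed
    have supp: "(\<forall>k. block_inner n h (f k) i = 0) \<and> block_energy n h i = 0" if "i \<notin> {i. z i \<noteq> 0}" for i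
      using that h0 by (simp add: block_inner_def block_energy_def)
    have "0 \<le> inverse (T * L)" "0 \<le> U * T" using T L U by auto
    note limit = frame_bounds_from_finite[where n=n and f=f and h=h and I="{i. z i \<noteq> 0}", OF n f h supp this upper lower]
    show "summable (\<lambda>k. (cmod (ell2_inner h (f k)))\<^sup>2)"
      "(\<Sum>k. (cmod (ell2_inner h (f k)))\<^sup>2) \<le> U * T * (ell2_norm h)\<^sup>2"
      using limit(1,2) by auto
    show "inverse (T * L) / 2 * (ell2_norm h)\<^sup>2 \<le> (\<Sum>k. (cmod (ell2_inner h (f k)))\<^sup>2)"
      using limit(3) by simp
  qed
  have "nonzero_frame_bounds n z g r s (inverse (T * L) / 2) (U * T)"
    unfolding nonzero_frame_bounds_def
  proof (intro allI impI)
    fix f h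
    assume *: "\<forall>k. f k \<in> ell2" "h \<in> ell2"
      "\<forall>k i a. z i \<noteq> 0 \<longrightarrow> a < n i \<longrightarrow> f k (offset n i + a)
        = (\<Sum>j\<le>a. jordan_powr_coeff (z i) (r * real k + s) j * g (offset n i + (a - j)))"
      "\<forall>i a. z i = 0 \<longrightarrow> a < n i \<longrightarrow> h (offset n i + a) = 0"
    note hyps = *(1)[rule_format] *(2) *(3)[rule_format] *(4)[rule_format]
    show "summable (\<lambda>k. (cmod (ell2_inner h (f k)))\<^sup>2) \<and>
       inverse (T * L) / 2 * (ell2_norm h)\<^sup>2 \<le> (\<Sum>k. (cmod (ell2_inner h (f k)))\<^sup>2) \<and>
       (\<Sum>k. (cmod (ell2_inner h (f k)))\<^sup>2) \<le> U * T * (ell2_norm h)\<^sup>2"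
      using main(1)[OF hyps] main(2)[OF hyps] main(3)[OF hyps] by (intro conjI)
  qed
  moreover have "0 < inverse (T * L) / 2" "0 < U * T" using T L U by auto
  ultimately show ?thesis by blast
qed

text \<open>For a fixed exponent the blocks of the power are bounded uniformly: the negative powers of \<open>z i\<close> by
the lower bound for the moduli, the binomials because the sizes of the blocks are bounded.\<close>

lemma block_op_powr_ell2:
  assumes fr: "block_diagonal_carleson_frame n z g"
    and rad: "carleson_sequence (\<lambda>i. complex_of_real (cmod (z i)))"
    and t: "0 \<le> t" and zero: "\<And>i. z i = 0 \<Longrightarrow> real (n i) - 1 < t"
  shows "block_op_powr n z (of_real t) g \<in> ell2"
proof -
  have n: "\<And>i. 0 < n i" and z: "\<And>i. cmod (z i) < 1" and bdd: "bdd_above (range n)" and g: "g \<in> ell2"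
    using fr by (auto simp: block_diagonal_carleson_frame_def)
  obtain N where N: "\<And>i. n i \<le> N" using bdd by (auto simp: bdd_above_def)
  obtain c where c: "0 < c" "\<And>i. z i \<noteq> 0 \<Longrightarrow> c \<le> cmod (z i)"
    using carleson_radial_bounded_below(1)[OF rad] by blast
  define M where "M = (\<Sum>j<N. cmod (complex_of_real t gchoose j))"
  have M: "cmod (complex_of_real t gchoose j) \<le> M" if "j < N" for j
    unfolding M_def using that by (intro member_le_sum) auto
  have M0: "0 \<le> M" unfolding M_def by (rule sum_nonneg) auto
  define K where "K = M * (1 / min 1 c) ^ N"
  have K0: "0 \<le> K" unfolding K_def using M0 c by simp
  have P: "cmod (jordan_powr_coeff (z i) t j) \<le> K" if "z i \<noteq> 0" "j < N" for i j
  proof -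
    have "cmod (z i powr (of_real t - of_nat j)) = cmod (z i) powr t / cmod (z i) ^ j"
      using that powr_affine[of "z i" 0 0 t j] by (simp add: norm_divide norm_power cmod_powr_real)
    also have "\<dots> \<le> 1 / cmod (z i) ^ j"
      using t z[of i] by (intro divide_right_mono powr_le1) auto
    also have "\<dots> \<le> (1 / min 1 c) ^ j"
      using c(1) c(2)[of i] that unfolding power_one_over[symmetric]
      by (intro power_mono divide_left_mono) auto
    also have "\<dots> \<le> (1 / min 1 c) ^ N" using that c by (intro power_increasing) auto
    finally have 1: "cmod (z i powr (of_real t - of_nat j)) \<le> (1 / min 1 c) ^ N" .
    have 2: "cmod (of_real (defect (z i)) ^ j) \<le> 1"
      using defect_pos[OF z] defect_le_1[of "z i"] by (simp add: norm_power power_le_one less_imp_le)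
    have "cmod (jordan_powr_coeff (z i) t j) \<le> M * (1 / min 1 c) ^ N * 1"
      unfolding jordan_powr_coeff_def norm_mult using 1 2 M[OF that(2)] M0 c
      by (intro mult_mono) auto
    then show ?thesis by (simp add: K_def)
  qed
  let ?f = "block_op_powr n z (of_real t) g"
  have bound: "(\<Sum>a<n i. (cmod (?f (offset n i + a)))\<^sup>2) \<le> N * (N * K\<^sup>2) * block_energy n g i" for i
  proof -
    have "(cmod (?f (offset n i + a)))\<^sup>2 \<le> N * K\<^sup>2 * block_energy n g i" if a: "a < n i" for a
    proof (cases "z i = 0")
      case True
      then show ?thesis
        using block_op_powr_zero[of a n i z t g] a zero by (simp add: block_energy_nonneg)
    next
      case False
      have "(cmod (?f (offset n i + a)))\<^sup>2
          = (cmod (\<Sum>j\<in>{..a}. jordan_powr_coeff (z i) t j * g (offset n i + (a - j))))\<^sup>2"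
        using block_op_powr_at[of a n i z t g] a False by simp
      also have "\<dots> \<le> card {..a} * K\<^sup>2 * (\<Sum>j\<in>{..a}. (cmod (g (offset n i + (a - j))))\<^sup>2)"
        using P[OF False] a N[of i] by (intro norm_sum_sq_le) auto
      also have "(\<Sum>j\<in>{..a}. (cmod (g (offset n i + (a - j))))\<^sup>2) = (\<Sum>j\<in>{..a}. (cmod (g (offset n i + j)))\<^sup>2)"
        by (rule sum.reindex_bij_witness[of _ "\<lambda>j. a - j" "\<lambda>j. a - j"]) auto
      also have "card {..a} * K\<^sup>2 * \<dots> \<le> N * K\<^sup>2 * block_energy n g i"
        unfolding block_energy_def using a N[of i]
        by (intro mult_mono sum_mono2) (auto intro: sum_nonneg)
      finally show ?thesis .
    qed
    then have "(\<Sum>a<n i. (cmod (?f (offset n i + a)))\<^sup>2) \<le> (\<Sum>a<n i. N * K\<^sup>2 * block_energy n g i)"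
      by (intro sum_mono) auto
    also have "\<dots> = n i * (N * K\<^sup>2 * block_energy n g i)" by simp
    also have "\<dots> \<le> N * (N * K\<^sup>2 * block_energy n g i)"
      using N[of i] by (intro mult_right_mono) (auto simp: block_energy_nonneg)
    finally show ?thesis by (simp add: mult.assoc)
  qed
  have "summable (\<lambda>i. N * (N * K\<^sup>2) * block_energy n g i)"
    using block_energy_sums[OF n g] by (intro summable_mult) (auto simp: sums_iff)
  then have "summable (\<lambda>i. \<Sum>a<n i. (cmod (?f (offset n i + a)))\<^sup>2)"
    by (rule summable_comparison_test') (use bound in \<open>simp add: sum_nonneg\<close>)
  then show ?thesis
    unfolding ell2_def using n by (auto intro!: summable_blocks[where n=n])
qed

lemma real_powers_frame:
  assumes fr: "block_diagonal_carleson_frame n z g"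
    and rad: "carleson_sequence (\<lambda>i. complex_of_real (cmod (z i)))"
    and r: "0 < r" and nz: "\<And>i. z i \<noteq> 0"
  shows "is_frame (\<lambda>k. block_op_powr n z (complex_of_real (r * real k)) g)"
proof -
  let ?f = "\<lambda>k. block_op_powr n z (complex_of_real (r * real k)) g"
  have f: "?f k \<in> ell2" for k
    using r nz by (intro block_op_powr_ell2[OF fr rad]) auto
  obtain c B where c: "0 < c" "0 < B" and bounds: "nonzero_frame_bounds n z g r 0 c B"
    using nonzero_blocks_frame_bounds[OF fr rad r order_refl] by blast
  have main: "summable (\<lambda>k. (cmod (ell2_inner h (?f k)))\<^sup>2) \<and>
     c * (ell2_norm h)\<^sup>2 \<le> (\<Sum>k. (cmod (ell2_inner h (?f k)))\<^sup>2) \<and>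
     (\<Sum>k. (cmod (ell2_inner h (?f k)))\<^sup>2) \<le> max c B * (ell2_norm h)\<^sup>2" if h: "h \<in> ell2" for h
  proof -
    have "summable (\<lambda>k. (cmod (ell2_inner h (?f k)))\<^sup>2) \<and>
     c * (ell2_norm h)\<^sup>2 \<le> (\<Sum>k. (cmod (ell2_inner h (?f k)))\<^sup>2) \<and>
     (\<Sum>k. (cmod (ell2_inner h (?f k)))\<^sup>2) \<le> B * (ell2_norm h)\<^sup>2"
    proof (rule bounds[unfolded nonzero_frame_bounds_def, rule_format])
      fix k i a assume ia: "z i \<noteq> 0" "a < n i"
      show "?f k (offset n i + a)
        = (\<Sum>j\<le>a. jordan_powr_coeff (z i) (r * real k + 0) j * g (offset n i + (a - j)))"
        unfolding add_0_right by (rule block_op_powr_at[of a n i z "r * real k" g, OF ia(2,1)])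
    qed (use f h nz in auto)
    moreover have "B * (ell2_norm h)\<^sup>2 \<le> max c B * (ell2_norm h)\<^sup>2" by (intro mult_right_mono) auto
    ultimately show ?thesis by linarith
  qed
  then show ?thesis
    unfolding is_frame_def using f c by (intro conjI allI exI[of _ c] exI[of _ "max c B"] ballI) auto
qed

text \<open>From exponent \<open>r K > n 0 - 1\<close> on, block 0 of the orbit vanishes. Hence the tail of the
sequence is comparable with the part \<open>h'\<close> of \<open>h\<close> outside block 0. On block 0 the orbit vectors
\<open>J^k g\<close> with \<open>k < n 0\<close> form the triangular matrix of shifts of \<open>g\<close>, with diagonal \<open>g 0 \<noteq> 0\<close>; the
influence of \<open>h'\<close> on these coefficients is controlled by the original upper frame bound.\<close>

lemma real_powers_frame_zero:
  fixes n :: "nat \<Rightarrow> nat"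
  assumes fr: "block_diagonal_carleson_frame n z g"
    and rad: "carleson_sequence (\<lambda>i. complex_of_real (cmod (z i)))"
    and r: "0 < r" and z0: "z 0 = 0" and K: "int K = \<lfloor>(real (n 0) - 1) / r\<rfloor> + 1"
  shows "is_frame (\<lambda>k. if k < n 0 then (block_op n z ^^ k) g
                       else block_op_powr n z (complex_of_real (r * real (K + (k - n 0)))) g)"
proof -
  let ?p = "n 0"
  let ?J = "\<lambda>k. (block_op n z ^^ k) g"
  let ?f = "\<lambda>k. block_op_powr n z (complex_of_real (r * real (K + k))) g"
  let ?\<phi> = "\<lambda>k. if k < ?p then ?J k else block_op_powr n z (complex_of_real (r * real (K + (k - ?p)))) g"
  have n: "\<And>i. 0 < n i" and J: "is_frame ?J"
    using fr by (auto simp: block_diagonal_carleson_frame_def)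
  have nz: "z i \<noteq> 0" if "i \<noteq> 0" for i
    using carleson_radial_bounded_below(2)[OF rad, of i 0] z0 that by auto
  have "(real ?p - 1) / r < real K" using K by linarith
  then have "real ?p - 1 < r * real K" using r by (simp add: field_simps)
  moreover have "r * real K \<le> r * real (K + k)" for k using r by simp
  ultimately have big: "real ?p - 1 < r * real (K + k)" for k by (rule less_le_trans)
  have f: "?f k \<in> ell2" for k
  proof (rule block_op_powr_ell2[OF fr rad])
    show "real (n i) - 1 < r * real (K + k)" if "z i = 0" for i
      using nz[of i] that big by (cases "i = 0") auto
  qed (use r in auto)
  have f0: "?f k m = 0" if "m < ?p" for k m
    using block_op_powr_zero[of m n 0 z "r * real (K + k)" g] that z0 big by (simp add: offset_def)
  have rK: "0 \<le> r * real K" using r by simp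
  obtain c B where c: "0 < c" "0 < B" and bounds: "nonzero_frame_bounds n z g r (r * real K) c B"
    using nonzero_blocks_frame_bounds[OF fr rad r rK] by blast
  obtain A0 B0 where A0: "0 < A0" "A0 \<le> B0" and Jbounds: "\<And>h. h \<in> ell2 \<Longrightarrow>
      summable (\<lambda>k. (cmod (ell2_inner h (?J k)))\<^sup>2) \<and>
      (\<Sum>k. (cmod (ell2_inner h (?J k)))\<^sup>2) \<le> B0 * (ell2_norm h)\<^sup>2" and J2: "\<And>k. ?J k \<in> ell2"
    using J by (auto simp: is_frame_def)
  have B0: "0 < B0" using A0 by linarith
  have Jpart: "(\<Sum>k<?p. (cmod (ell2_inner h (?J k)))\<^sup>2) \<le> B0 * (ell2_norm h)\<^sup>2" if "h \<in> ell2" for h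
    using sum_le_suminf[of "\<lambda>k. (cmod (ell2_inner h (?J k)))\<^sup>2" "{..<?p}"] Jbounds[OF that] by auto
  have g0: "0 < cmod (g 0)"
    using generator_bounds[OF fr] z0 by (force simp: offset_def defect_def dest: spec[of _ 0])
  define G where "G = (\<Sum>a<?p. cmod (g a))"
  have G: "cmod (g a) \<le> G" if "a < ?p" for a unfolding G_def using that by (intro member_le_sum) auto
  have G0: "0 \<le> G" unfolding G_def by (rule sum_nonneg) auto
  obtain T where T: "0 < T" and tri: "\<And>m (A :: nat \<Rightarrow> nat \<Rightarrow> complex) x. m \<le> ?p \<Longrightarrow>
    (\<forall>k<m. \<forall>j<m. cmod (A k j) \<le> G) \<Longrightarrow> (\<forall>k<m. cmod (g 0) \<le> cmod (A k k)) \<Longrightarrow>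
    (\<Sum>j<m. (cmod (x j))\<^sup>2) \<le> T * (\<Sum>k<m. (cmod (\<Sum>j=k..<m. A k j * x j))\<^sup>2)"
    using triangular_bounded_below[OF G0 g0, of ?p] by blast
  \<comment> \<open>The first entry pays for the coefficients with \<open>k < n 0\<close>, the second for the tail.\<close>
  define C1 where "C1 = max (2 * T) ((2 * T * B0 + 1) / c)"
  have C1: "0 < C1" using T by (simp add: C1_def less_max_iff_disj)
  have main: "summable (\<lambda>k. (cmod (ell2_inner h (?\<phi> k)))\<^sup>2)"
     "inverse C1 * (ell2_norm h)\<^sup>2 \<le> (\<Sum>k. (cmod (ell2_inner h (?\<phi> k)))\<^sup>2)"
     "(\<Sum>k. (cmod (ell2_inner h (?\<phi> k)))\<^sup>2) \<le> (B0 + B) * (ell2_norm h)\<^sup>2" if h: "h \<in> ell2" for h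
  proof -
    define h0 where "h0 m = (if m < ?p then h m else 0)" for m
    define h' where "h' m = (if m < ?p then 0 else h m)" for m
    have hsum: "summable (\<lambda>m. (cmod (h m))\<^sup>2)" using h by (simp add: ell2_def)
    have h': "h' \<in> ell2"
      unfolding ell2_def mem_Collect_eq
      by (rule summable_comparison_test'[OF hsum]) (simp add: h'_def)
    have h0: "h0 \<in> ell2"
      unfolding ell2_def mem_Collect_eq
      by (rule summable_comparison_test'[OF hsum]) (simp add: h0_def)
    define X where "X = (\<Sum>m<?p. (cmod (h m))\<^sup>2)"
    define Y where "Y = (ell2_norm h')\<^sup>2"
    have norm_split: "(ell2_norm h)\<^sup>2 = X + Y"
    proof -
      have "(\<lambda>m. (cmod (h0 m))\<^sup>2) sums (\<Sum>m<?p. (cmod (h0 m))\<^sup>2)"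
        by (rule sums_finite) (auto simp: h0_def)
      then have "(\<lambda>m. (cmod (h0 m))\<^sup>2) sums X" by (simp add: h0_def X_def)
      moreover have "(\<lambda>m. (cmod (h' m))\<^sup>2) sums Y"
        using h' unfolding Y_def ell2_norm_sq[OF h'] by (auto simp: ell2_def intro: summable_sums)
      ultimately have "(\<lambda>m. (cmod (h0 m))\<^sup>2 + (cmod (h' m))\<^sup>2) sums (X + Y)" by (rule sums_add)
      moreover have "(\<lambda>m. (cmod (h0 m))\<^sup>2 + (cmod (h' m))\<^sup>2) = (\<lambda>m. (cmod (h m))\<^sup>2)"
        by (auto simp: h0_def h'_def)
      ultimately show ?thesis unfolding ell2_norm_sq[OF h] by (simp add: sums_iff)
    qed
    have Y0: "0 \<le> Y" and X0: "0 \<le> X" by (auto simp: Y_def X_def sum_nonneg)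
    define S1 where "S1 = (\<Sum>k<?p. (cmod (ell2_inner h (?J k)))\<^sup>2)"
    define S2 where "S2 = (\<Sum>k. (cmod (ell2_inner h (?f k)))\<^sup>2)"
    have inner': "ell2_inner h (?f k) = ell2_inner h' (?f k)" for k
      unfolding ell2_inner_def using f0 by (intro suminf_cong) (auto simp: h'_def)
    have tail: "summable (\<lambda>k. (cmod (ell2_inner h (?f k)))\<^sup>2) \<and> c * Y \<le> S2 \<and> S2 \<le> B * Y"
      unfolding inner' S2_def Y_def
    proof (rule bounds[unfolded nonzero_frame_bounds_def, rule_format])
      fix k i a assume ia: "z i \<noteq> 0" "a < n i"
      show "?f k (offset n i + a)
        = (\<Sum>j\<le>a. jordan_powr_coeff (z i) (r * real k + r * real K) j * g (offset n i + (a - j)))"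
      proof -
        have "r * real (K + k) = r * real k + r * real K" by (simp add: algebra_simps)
        then show ?thesis
          using block_op_powr_at[of a n i z "r * real (K + k)" g] ia by (simp only: not_False_eq_True)
      qed
    next
      fix i a assume "z i = 0" "a < n i"
      then show "h' (offset n i + a) = 0" using nz[of i] by (cases "i = 0") (auto simp: h'_def offset_def)
    qed (use f h' in auto)
    have head: "S1 \<le> B0 * (X + Y)" unfolding S1_def using Jpart[OF h] by (simp add: norm_split)
    have head': "(\<Sum>k<?p. (cmod (ell2_inner h' (?J k)))\<^sup>2) \<le> B0 * Y"
      unfolding Y_def by (rule Jpart[OF h'])
    have split: "ell2_inner h0 (?J k) = ell2_inner h (?J k) - ell2_inner h' (?J k)" for k
    proof -
      have "(\<lambda>m. h0 m * cnj (?J k m)) = (\<lambda>m. h m * cnj (?J k m) - h' m * cnj (?J k m))"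
        by (auto simp: h0_def h'_def)
      then show ?thesis
        unfolding ell2_inner_def using ell2_inner_summable[OF h J2] ell2_inner_summable[OF h' J2]
        by (simp add: suminf_diff)
    qed
    have orbit: "cnj (ell2_inner h0 (?J k)) = (\<Sum>a=k..<?p. g (a - k) * cnj (h a))" for k
    proof -
      have "(\<lambda>m. h0 m * cnj (?J k m)) sums (\<Sum>m<?p. h0 m * cnj (?J k m))"
        by (rule sums_finite) (auto simp: h0_def)
      then have "cnj (ell2_inner h0 (?J k)) = (\<Sum>m<?p. ?J k m * cnj (h m))"
        by (simp add: ell2_inner_def sums_iff h0_def mult.commute)
      also have "\<dots> = (\<Sum>m<?p. (if k \<le> m then g (m - k) else 0) * cnj (h m))"
      proof (rule sum.cong)
        fix m assume "m \<in> {..<?p}"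
        then have "?J k m = (\<Sum>j\<le>m. jordan_coeff 0 k j * g (m - j))"
          using block_op_power[of m n 0 k z g] z0 by (simp add: offset_def)
        also have "\<dots> = (\<Sum>j\<le>m. if j = k then g (m - j) else 0)"
          by (intro sum.cong) (auto simp: jordan_coeff_def defect_def power_0_left binomial_eq_0)
        finally show "?J k m * cnj (h m) = (if k \<le> m then g (m - k) else 0) * cnj (h m)" by simp
      qed simp
      also have "\<dots> = (\<Sum>a=k..<?p. g (a - k) * cnj (h a))"
        by (intro sum.mono_neutral_cong_right) auto
      finally show ?thesis .
    qed
    have "X = (\<Sum>m<?p. (cmod (cnj (h m)))\<^sup>2)" by (simp add: X_def)
    also have "\<dots> \<le> T * (\<Sum>k<?p. (cmod (\<Sum>a=k..<?p. g (a - k) * cnj (h a)))\<^sup>2)"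
      using G by (intro tri) auto
    also have "\<dots> = T * (\<Sum>k<?p. (cmod (ell2_inner h (?J k) - ell2_inner h' (?J k)))\<^sup>2)"
      unfolding orbit[symmetric] split by (simp only: complex_mod_cnj)
    also have "\<dots> \<le> T * (\<Sum>k<?p. 2 * (cmod (ell2_inner h (?J k)))\<^sup>2 + 2 * (cmod (ell2_inner h' (?J k)))\<^sup>2)"
    proof (intro mult_left_mono sum_mono)
      fix k
      have "(cmod (ell2_inner h (?J k) - ell2_inner h' (?J k)))\<^sup>2
          \<le> (cmod (ell2_inner h (?J k)) + cmod (ell2_inner h' (?J k)))\<^sup>2"
        by (intro power_mono norm_triangle_ineq4) auto
      also have "\<dots> \<le> 2 * (cmod (ell2_inner h (?J k)))\<^sup>2 + 2 * (cmod (ell2_inner h' (?J k)))\<^sup>2"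
        using sum_squares_bound[of "cmod (ell2_inner h (?J k))" "cmod (ell2_inner h' (?J k))"]
        by (simp add: power2_sum)
      finally show "(cmod (ell2_inner h (?J k) - ell2_inner h' (?J k)))\<^sup>2
          \<le> 2 * (cmod (ell2_inner h (?J k)))\<^sup>2 + 2 * (cmod (ell2_inner h' (?J k)))\<^sup>2" .
    qed (use T in auto)
    also have "\<dots> \<le> T * (2 * S1 + 2 * (B0 * Y))"
      using T head' by (intro mult_left_mono) (simp_all add: S1_def sum.distrib sum_distrib_left[symmetric])
    finally have X: "X \<le> T * (2 * S1 + 2 * (B0 * Y))" .
    have S10: "0 \<le> S1" unfolding S1_def by (rule sum_nonneg) auto
    have S20: "0 \<le> S2" using tail mult_nonneg_nonneg[of c Y] c Y0 by linarith
    have "X + Y \<le> 2 * T * S1 + (2 * T * B0 + 1) * Y" using X by (simp add: algebra_simps)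
    also have "\<dots> \<le> 2 * T * S1 + (2 * T * B0 + 1) * (S2 / c)"
      using tail c T B0 by (intro add_left_mono mult_left_mono) (auto simp: field_simps)
    also have "\<dots> = 2 * T * S1 + (2 * T * B0 + 1) / c * S2" by simp
    also have "\<dots> \<le> C1 * S1 + C1 * S2"
      using S10 S20 by (intro add_mono mult_right_mono) (auto simp: C1_def)
    finally have low: "X + Y \<le> C1 * (S1 + S2)" by (simp add: algebra_simps)
    have shift: "(\<lambda>k. (cmod (ell2_inner h (?\<phi> (k + ?p))))\<^sup>2) = (\<lambda>k. (cmod (ell2_inner h (?f k)))\<^sup>2)"
      by simp
    show s: "summable (\<lambda>k. (cmod (ell2_inner h (?\<phi> k)))\<^sup>2)"
      by (rule summable_iff_shift[where k="?p", THEN iffD1]) (use tail shift in simp)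
    have total: "(\<Sum>k. (cmod (ell2_inner h (?\<phi> k)))\<^sup>2) = S2 + S1"
      using suminf_split_initial_segment[OF s, of ?p] unfolding shift S1_def S2_def by simp
    show "inverse C1 * (ell2_norm h)\<^sup>2 \<le> (\<Sum>k. (cmod (ell2_inner h (?\<phi> k)))\<^sup>2)"
      unfolding total norm_split using low C1 by (simp add: field_simps)
    have "S2 \<le> B * (X + Y)" using tail mult_left_mono[of Y "X + Y" B] X0 c by linarith
    then show "(\<Sum>k. (cmod (ell2_inner h (?\<phi> k)))\<^sup>2) \<le> (B0 + B) * (ell2_norm h)\<^sup>2"
      unfolding total norm_split using head by (simp add: algebra_simps)
  qed
  have mem: "?\<phi> k \<in> ell2" for k
    using f[of "k - ?p"] J2[of k] by (cases "k < ?p") (simp_all only: if_True if_False)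
  have pos: "0 < inverse C1" using C1 by simp
  have le: "inverse C1 \<le> B0 + B"
  proof -
    have "inverse C1 * (ell2_norm (basis_vec n 0 0))\<^sup>2 \<le> (B0 + B) * (ell2_norm (basis_vec n 0 0))\<^sup>2"
      using main(2,3)[OF basis_vec_ell2[of n 0 0]] by linarith
    then show ?thesis by (simp add: ell2_norm_basis_vec)
  qed
  show ?thesis
    unfolding is_frame_def
    by (intro conjI allI exI[of _ "inverse C1"] exI[of _ "B0 + B"] ballI mem pos le main)
qed

theorem theorem3p1:
  fixes n :: "nat \<Rightarrow> nat" and z :: "nat \<Rightarrow> complex" and g :: "nat \<Rightarrow> complex" and r :: real
  assumes "block_diagonal_carleson_frame n z g"
    and "point_spectrum (block_op n z) = range z"
    and "carleson_sequence z"
    and "carleson_sequence (\<lambda>i. complex_of_real (cmod (z i)))"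
    and "r > 0"
  shows "((\<forall>i. z i \<noteq> 0) \<longrightarrow>
            is_frame (\<lambda>k. block_op_powr n z (complex_of_real (r * real k)) g)) \<and>
         (\<forall>K. z 0 = 0 \<and> int K = \<lfloor>(real (n 0) - 1) / r\<rfloor> + 1 \<longrightarrow>
            is_frame (\<lambda>k. if k < n 0 then (block_op n z ^^ k) g
                          else block_op_powr n z (complex_of_real (r * real (K + (k - n 0)))) g))"
  using real_powers_frame[OF assms(1,4,5)] real_powers_frame_zero[OF assms(1,4,5)] by blast

end
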